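(* For every integer $d\geq 2$ and every $\lambda\in\mathbb{C}\setminus\{0\}$, the Julia set of the rational map $$U_{d\lambda}(z)=\left(\frac{(z+\lambda-1)^d+(\lambda-1)(z-1)^d}{(z+\lambda-1)^d-(z-1)^d}\right)^d$$ is connected.
   Context: The Julia set of a rational map is taken as a subset of the Riemann sphere $\overline{\mathbb{C}}=\mathbb{C}\cup\{\infty\}$. *)

theory Defs
  imports "HOL-Analysis.Analysis" "HOL-Computational_Algebra.Computational_Algebra"
begin

datatype riemann_sphere = Finite complex | Infinity

text \<open>Inverse stereographic projection onto the unit sphere of \<open>complex \<times> real\<close>. Pulling the
  Euclidean metric back along it gives the chordal metric, see \<open>dist_Finite_Finite\<close> and
  \<open>dist_Finite_Infinity\<close>.\<close>

fun stereo :: "riemann_sphere \<Rightarrow> complex \<times> real" where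
  "stereo (Finite z) =
     (2 * z / of_real (1 + (cmod z)\<^sup>2), ((cmod z)\<^sup>2 - 1) / ((cmod z)\<^sup>2 + 1))"
| "stereo Infinity = (0, 1)"

lemma stereo_Finite_snd: "snd (stereo (Finite z)) = 1 - 2 / (1 + (cmod z)\<^sup>2)"
proof -
  have "1 + (cmod z)\<^sup>2 \<noteq> 0" by (smt (verit) zero_le_power2)
  then show ?thesis by (simp add: field_simps)
qed

lemma inj_stereo: "inj stereo"
proof (rule injI)
  fix x y :: riemann_sphere
  assume eq: "stereo x = stereo y"
  have pos: "1 + (cmod z)\<^sup>2 > 0" for z by (smt (verit) zero_le_power2)
  have ne: "stereo (Finite z) \<noteq> stereo Infinity" for z
  proof
    assume "stereo (Finite z) = stereo Infinity"
    then have "snd (stereo (Finite z)) = 1" by simp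
    then have "2 / (1 + (cmod z)\<^sup>2) = 0" unfolding stereo_Finite_snd by simp
    with pos[of z] show False by simp
  qed
  show "x = y"
  proof (cases x)
    case x: (Finite z)
    show ?thesis
    proof (cases y)
      case y: (Finite w)
      have "1 - 2 / (1 + (cmod z)\<^sup>2) = 1 - 2 / (1 + (cmod w)\<^sup>2)"
        using eq x y stereo_Finite_snd by metis
      then have n: "1 + (cmod z)\<^sup>2 = 1 + (cmod w)\<^sup>2" using pos[of z] pos[of w]
        by (simp add: field_simps)
      have "2 * z / of_real (1 + (cmod z)\<^sup>2) = 2 * w / of_real (1 + (cmod w)\<^sup>2)"
        using eq x y by simp
      moreover have "complex_of_real (1 + (cmod w)\<^sup>2) \<noteq> 0"
        unfolding of_real_eq_0_iff using pos[of w] by linarith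
      ultimately have "z = w" unfolding n by (simp del: of_real_add)
      with x y show ?thesis by simp
    next
      case Infinity
      with eq x ne show ?thesis by metis
    qed
  next
    case x: Infinity
    show ?thesis using eq x ne by (cases y) metis+
  qed
qed

instantiation riemann_sphere :: metric_space
begin

definition dist_riemann_sphere :: "riemann_sphere \<Rightarrow> riemann_sphere \<Rightarrow> real" where
  "dist_riemann_sphere x y = dist (stereo x) (stereo y)"

definition uniformity_riemann_sphere :: "(riemann_sphere \<times> riemann_sphere) filter" where
  "uniformity_riemann_sphere = (INF e\<in>{0<..}. principal {(x, y). dist x y < e})"

definition open_riemann_sphere :: "riemann_sphere set \<Rightarrow> bool" where
  "open_riemann_sphere U \<longleftrightarrow> (\<forall>x\<in>U. eventually (\<lambda>(x', y). x' = x \<longrightarrow> y \<in> U) uniformity)"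

instance
proof
  fix x y z :: riemann_sphere
  show "dist x y = 0 \<longleftrightarrow> x = y"
    by (simp add: dist_riemann_sphere_def inj_eq[OF inj_stereo])
  show "dist x y \<le> dist x z + dist y z"
    by (simp add: dist_riemann_sphere_def dist_triangle2)
qed (simp_all add: uniformity_riemann_sphere_def open_riemann_sphere_def)

end

lemma dist_Finite_Infinity: "dist (Finite z) Infinity = 2 / sqrt (1 + (cmod z)\<^sup>2)"
proof -
  let ?s = "1 + (cmod z)\<^sup>2"
  have pos: "?s > 0" by (smt (verit) zero_le_power2)
  have a: "dist (fst (stereo (Finite z))) 0 = 2 * cmod z / ?s"
    using pos by (simp add: norm_divide norm_mult del: of_real_add)
  have b: "dist (snd (stereo (Finite z))) 1 = 2 / ?s"
    unfolding stereo_Finite_snd using pos by (simp add: dist_real_def)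
  have "dist (Finite z) Infinity = sqrt ((2 * cmod z / ?s)\<^sup>2 + (2 / ?s)\<^sup>2)"
    unfolding dist_riemann_sphere_def dist_prod_def using a b by simp
  also have "(2 * cmod z / ?s)\<^sup>2 + (2 / ?s)\<^sup>2 = 4 * ?s / ?s\<^sup>2"
    by (simp add: power_divide power_mult_distrib add_divide_distrib distrib_left)
  also have "\<dots> = 2\<^sup>2 / ?s" using pos mult_divide_mult_cancel_right[of ?s 4 ?s]
    unfolding power2_eq_square[of ?s] by (simp del: distrib_left_numeral)
  also have "sqrt \<dots> = 2 / sqrt ?s" by (simp add: real_sqrt_divide)
  finally show ?thesis .
qed

lemma dist_Finite_Finite:
  "dist (Finite z) (Finite w) = 2 * cmod (z - w) / (sqrt (1 + (cmod z)\<^sup>2) * sqrt (1 + (cmod w)\<^sup>2))"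
proof -
  let ?s = "1 + (cmod z)\<^sup>2" and ?t = "1 + (cmod w)\<^sup>2"
  have pos: "?s > 0" "?t > 0" by (smt (verit) zero_le_power2)+
  have nz: "complex_of_real ?s \<noteq> 0" "complex_of_real ?t \<noteq> 0"
    unfolding of_real_eq_0_iff using pos by linarith+
  have "fst (stereo (Finite z)) - fst (stereo (Finite w)) =
        2 * (of_real ?t * z - of_real ?s * w) / of_real (?s * ?t)"
    unfolding of_real_mult using nz by (simp add: diff_frac_eq right_diff_distrib mult_ac del: of_real_add)
  then have "dist (fst (stereo (Finite z))) (fst (stereo (Finite w))) =
        2 * cmod (of_real ?t * z - of_real ?s * w) / (?s * ?t)"
    unfolding dist_norm using pos
    by (simp only: norm_divide norm_mult norm_of_real abs_mult abs_of_pos norm_numeral)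
  then have a: "(dist (fst (stereo (Finite z))) (fst (stereo (Finite w))))\<^sup>2 =
        4 * (cmod (of_real ?t * z - of_real ?s * w))\<^sup>2 / (?s * ?t)\<^sup>2"
    by (simp add: power_divide power_mult_distrib)
  have "snd (stereo (Finite z)) - snd (stereo (Finite w)) = 2 * (?s - ?t) / (?s * ?t)"
    unfolding stereo_Finite_snd using pos by (simp add: field_simps)
  then have b: "(dist (snd (stereo (Finite z))) (snd (stereo (Finite w))))\<^sup>2 =
        4 * (?s - ?t)\<^sup>2 / (?s * ?t)\<^sup>2"
    unfolding dist_real_def power2_abs by (simp only: power_divide power_mult_distrib) simp
  have key: "(cmod (of_real ?t * z - of_real ?s * w))\<^sup>2 + (?s - ?t)\<^sup>2 = (cmod (z - w))\<^sup>2 * (?s * ?t)"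
    unfolding cmod_power2 by (simp add: power2_eq_square algebra_simps)
  have "dist (Finite z) (Finite w) =
        sqrt (4 * (cmod (of_real ?t * z - of_real ?s * w))\<^sup>2 / (?s * ?t)\<^sup>2 + 4 * (?s - ?t)\<^sup>2 / (?s * ?t)\<^sup>2)"
    unfolding dist_riemann_sphere_def dist_prod_def a b ..
  also have "4 * (cmod (of_real ?t * z - of_real ?s * w))\<^sup>2 / (?s * ?t)\<^sup>2 + 4 * (?s - ?t)\<^sup>2 / (?s * ?t)\<^sup>2
      = 4 * ((cmod (z - w))\<^sup>2 * (?s * ?t)) / (?s * ?t)\<^sup>2"
    unfolding key[symmetric] by (simp add: add_divide_distrib distrib_left)
  also have "\<dots> = (2 * cmod (z - w))\<^sup>2 / (?s * ?t)"
    using pos by (simp add: power2_eq_square)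
  also have "sqrt \<dots> = 2 * cmod (z - w) / (sqrt ?s * sqrt ?t)"
    by (simp only: real_sqrt_divide real_sqrt_mult real_sqrt_abs) simp
  finally show ?thesis .
qed

text \<open>The self-map of the sphere given by the rational function \<open>p / q\<close>. The value at a zero of
  \<open>q\<close> is the right one only when \<open>p\<close> and \<open>q\<close> are coprime. At \<open>Infinity\<close>, if
  \<open>degree p < degree q\<close> then \<open>coeff p (degree q) = 0\<close>.\<close>

fun rational_map :: "complex poly \<Rightarrow> complex poly \<Rightarrow> riemann_sphere \<Rightarrow> riemann_sphere" where
  "rational_map p q (Finite z) =
     (if poly q z = 0 then Infinity else Finite (poly p z / poly q z))"
| "rational_map p q Infinity =
     (if degree p > degree q then Infinity else Finite (coeff p (degree q) / lead_coeff q))"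

definition normal_family_on ::
    "'a::metric_space set \<Rightarrow> ('a \<Rightarrow> 'b::metric_space) set \<Rightarrow> bool" where
  "normal_family_on U F \<longleftrightarrow>
     (\<forall>s :: nat \<Rightarrow> 'a \<Rightarrow> 'b. range s \<subseteq> F \<longrightarrow>
        (\<exists>r g. strict_mono (r :: nat \<Rightarrow> nat) \<and>
           (\<forall>K. compact K \<and> K \<subseteq> U \<longrightarrow> uniform_limit K (s \<circ> r) g sequentially)))"

definition fatou_set :: "(riemann_sphere \<Rightarrow> riemann_sphere) \<Rightarrow> riemann_sphere set" where
  "fatou_set f = {x. \<exists>U. open U \<and> x \<in> U \<and> normal_family_on U (range (\<lambda>n. f ^^ n))}"

definition julia_set :: "(riemann_sphere \<Rightarrow> riemann_sphere) \<Rightarrow> riemann_sphere set" where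
  "julia_set f = - fatou_set f"

definition U_num :: "nat \<Rightarrow> complex \<Rightarrow> complex poly" where
  "U_num d lam = ([:lam - 1, 1:] ^ d + smult (lam - 1) ([:-1, 1:] ^ d)) ^ d"

definition U_den :: "nat \<Rightarrow> complex \<Rightarrow> complex poly" where
  "U_den d lam = ([:lam - 1, 1:] ^ d - [:-1, 1:] ^ d) ^ d"

definition U_map :: "nat \<Rightarrow> complex \<Rightarrow> riemann_sphere \<Rightarrow> riemann_sphere" where
  "U_map d lam = rational_map (U_num d lam) (U_den d lam)"

lemma coprime_U_num_U_den:
  assumes "d \<noteq> 0" "lam \<noteq> 0"
  shows "coprime (U_num d lam) (U_den d lam)"
proof (rule coprimeI)
  fix c assume c: "c dvd U_num d lam" "c dvd U_den d lam"
  have no_root: "poly c z \<noteq> 0" for z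
  proof
    assume "poly c z = 0"
    then have "poly (U_num d lam) z = 0" "poly (U_den d lam) z = 0"
      using c by (auto elim!: dvdE)
    then have eqs: "(lam - 1 + z) ^ d + (lam - 1) * (z - 1) ^ d = 0" "(lam - 1 + z) ^ d = (z - 1) ^ d"
      using assms(1) by (simp_all add: U_num_def U_den_def)
    have "lam * (z - 1) ^ d = 0" using eqs by (simp add: algebra_simps)
    then have "z = 1" using assms by simp
    with eqs(2) assms show False by (simp add: zero_power)
  qed
  then have "constant (poly c)" using fundamental_theorem_of_algebra by blast
  then have "degree c = 0" by (simp add: constant_degree)
  moreover have "c \<noteq> 0" using no_root by auto
  ultimately show "c dvd 1" by (simp add: is_unit_iff_degree)
qed

lemma U_map_Finite:
  assumes "(z + lam - 1) ^ d \<noteq> (z - 1) ^ d"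
  shows "U_map d lam (Finite z) =
    Finite ((((z + lam - 1) ^ d + (lam - 1) * (z - 1) ^ d) / ((z + lam - 1) ^ d - (z - 1) ^ d)) ^ d)"
proof -
  have c: "lam - 1 + z = z + lam - 1" by simp
  show ?thesis using assms
    by (simp add: c U_map_def U_num_def U_den_def power_divide)
qed

end

theory Submission
  imports Defs "HOL-Complex_Analysis.Complex_Analysis"
begin

text \<open>With the involution \<open>M z = (z + \<lambda> - 1) / (z - 1)\<close> and \<open>F z = (M z) ^ d\<close> one has \<open>U = F \<circ> F\<close>, and \<open>F\<close>
  interchanges the points \<open>1\<close> and \<open>\<infinity>\<close>, the former being critical. The critical values of \<open>F\<close> are \<open>0\<close>
  and \<open>\<infinity>\<close>. The Julia set is the frontier of the complement \<open>K\<close> of the basin of the cycle \<open>{1, \<infinity>}\<close>.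

  The key point is that certain continua \<open>Y\<close> containing both critical values and disjoint from \<open>F ` Y\<close>
  cannot exist. The inverse branch \<open>g\<close> of \<open>F\<close> off \<open>Y\<close> with \<open>g 1 = \<infinity>\<close> would map the annulus between \<open>Y\<close>
  and \<open>F ` Y\<close> into itself and interchange its ends. Averaging \<open>log (g\<^sup>n z - 1)\<close> with alternating signs
  gives a nonconstant holomorphic \<open>e\<close> with \<open>e (g z) * e z\<close> constant, so \<open>e \<circ> g\<^sup>2 = e\<close>. The even iterates
  of \<open>g\<close> have no constant limits, because they preserve the homotopy class of the core of the annulus,
  and local injectivity of \<open>e\<close> then forces \<open>g\<^sup>m z = z\<close> on an open set for some \<open>m > 0\<close>, which is
  impossible because \<open>F\<close> has degree \<open>d > 1\<close>.

  Consequently \<open>0\<close> is not in the immediate basin of \<open>\<infinity>\<close>, the successive preimages of a suitable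
  annulus are connected, and their intersection \<open>K\<close> is connected. If its frontier were not, some
  component of the interior of \<open>K\<close> would separate \<open>1\<close> from \<open>\<infinity>\<close>. By normality it may be taken periodic,
  with \<open>F\<close> injective on each component of the cycle, hence with \<open>0\<close> on the same side as \<open>\<infinity>\<close>. The side
  of \<open>\<infinity>\<close> for the outermost component of the cycle would then be a forbidden continuum \<open>Y\<close>.\<close>

section \<open>Holomorphic maps interchanging the ends of an annulus\<close>

text \<open>\<open>F\<close> is a Moebius involution followed by the d-th power, so its critical
  values 0 and \<infinity> are totally ramified, and in the coordinate \<open>msp\<close> every
  other fibre is an orbit of rotations by roots of unity. Hence the preimage of a continuum is
  connected as soon as the continuum contains 0 or \<infinity> or separates them. The annulus
  argument disposes of the remaining position, in which 0 is joined to \<infinity> off the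
  continuum. On the annulus log (z - 1) is multivalued. A map interchanging the ends reverses
  winding about 1, however, so log (g z - 1) + log (z - 1) has a single-valued choice; this is why
  the mean alternates in sign. Periodicity and injectivity come from normal families alone. The
  image of a set separating 1 from \<infinity> separates them again, so such sets cannot shrink to a
  point, and limits of iterates on a component carrying one are not constant. No classification of
  Fatou components and no estimate of moduli enters.\<close>

lemma no_log_around_bounded_component:
  fixes S :: "complex set"
  assumes "compact S" "a \<notin> S" "bounded (connected_component_set (- S) a)"
  shows "\<not> (\<exists>L. continuous_on S L \<and> (\<forall>z\<in>S. z - a = exp (L z)))"
proof
  assume "\<exists>L. continuous_on S L \<and> (\<forall>z\<in>S. z - a = exp (L z))"
  then obtain L where L: "continuous_on S L" "\<And>z. z \<in> S \<Longrightarrow> z - a = exp (L z)" by blast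
  \<comment> \<open>The imaginary part of \<open>L\<close> lifts the Borsuk map of \<open>a\<close>
    from the circle to the line. So that map is inessential on \<open>S\<close>, which fails when
    \<open>a\<close> lies in a bounded component of the complement.\<close>
  have "inverse (norm (z - a)) *\<^sub>R (z - a) = exp (\<i> * of_real (Im (L z)))" if "z \<in> S" for z
  proof -
    have "norm (z - a) = exp (Re (L z))" using L(2)[OF that] by simp
    moreover have "exp (L z) = of_real (exp (Re (L z))) * exp (\<i> * of_real (Im (L z)))"
      by (metis exp_add exp_of_real complex_eq)
    ultimately show ?thesis using L(2)[OF that] by (simp add: scaleR_conv_of_real exp_minus)
  qed
  moreover have "continuous_on S (\<lambda>z. Im (L z))" using L(1) by (intro continuous_intros)
  ultimately have "\<exists>c. homotopic_with_canon (\<lambda>x. True) S (sphere 0 1)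
                               (\<lambda>x. inverse (norm (x - a)) *\<^sub>R (x - a)) (\<lambda>x. c)"
    unfolding inessential_eq_continuous_logarithm_circle by blast
  with Borsuk_map_essential_bounded_component[OF assms(1,2)] assms(3) show False by blast
qed

text \<open>The quotient \<open>h z / w\<close> stays in the unit disc about 1, hence in the right
  half-plane, where the principal logarithm is continuous. For \<open>w = 0\<close> the strict
  inequality forces \<open>S\<close> to be empty.\<close>

lemma continuous_log_near_constant:
  fixes h :: "'a::topological_space \<Rightarrow> complex"
  assumes "continuous_on S h" and close: "\<And>z. z \<in> S \<Longrightarrow> cmod (h z - w) < cmod w"
  shows "\<exists>L. continuous_on S L \<and> (\<forall>z\<in>S. h z = exp (L z))"
proof (cases "w = 0")
  case True
  with close have "S = {}" by fastforce
  then show ?thesis by auto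
next
  case False
  have pos: "Re (h z / w) > 0" if "z \<in> S" for z
  proof -
    have "cmod (h z / w - 1) = cmod (h z - w) / cmod w" using False by (simp add: divide_simps flip: norm_divide)
    also have "\<dots> < 1" using close[OF that] False by simp
    finally have "cmod (1 - h z / w) < 1" by (simp add: norm_minus_commute)
    then have "Re (1 - h z / w) < 1" by (meson complex_Re_le_cmod le_less_trans)
    then show ?thesis by simp
  qed
  then have ne: "h z / w \<noteq> 0" "h z / w \<notin> \<real>\<^sub>\<le>\<^sub>0" if "z \<in> S" for z
    using that by (force simp: complex_nonpos_Reals_iff)+
  have "continuous_on S (\<lambda>z. Ln (h z / w) + Ln w)"
    using assms(1) ne False by (intro continuous_intros) auto
  moreover have "h z = exp (Ln (h z / w) + Ln w)" if "z \<in> S" for z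
    using ne(1)[OF that] False by (simp add: exp_add)
  ultimately show ?thesis by (intro exI conjI) auto
qed

section \<open>Alternating means of logarithms along orbits\<close>

text \<open>Given a logarithm \<open>l\<close> of \<open>(g z - a) * (z - a)\<close>, this is a
  single-valued logarithm of \<open>(g ^^ n) z - a\<close> divided by \<open>z - a\<close> for even
  \<open>n\<close> and multiplied by it for odd \<open>n\<close>. The sign in the recursion
  alternates because each \<open>g\<close> turns \<open>z - a\<close> into its inverse times
  \<open>exp (l z)\<close>.\<close>

primrec iter_log :: "(complex \<Rightarrow> complex) \<Rightarrow> (complex \<Rightarrow> complex) \<Rightarrow> nat \<Rightarrow> complex \<Rightarrow> complex" where
  "iter_log g l 0 z = 0"
| "iter_log g l (Suc n) z = iter_log g l n (g z) + (-1) ^ n * l z"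

lemma funpow_in: "g ` A \<subseteq> A \<Longrightarrow> z \<in> A \<Longrightarrow> (g ^^ n) z \<in> A"
  by (induction n) auto

lemma holomorphic_on_funpow:
  assumes "g holomorphic_on A" "g ` A \<subseteq> A"
  shows "(g ^^ n) holomorphic_on A"
proof (induction n)
  case 0
  show ?case by (simp add: id_def)
next
  case (Suc n)
  have "(g \<circ> (g ^^ n)) holomorphic_on A"
    by (rule holomorphic_on_compose_gen[OF Suc assms(1)]) (auto intro: funpow_in[OF assms(2)])
  then show ?case by (simp add: o_def)
qed

lemma holomorphic_on_iter_log:
  assumes "g holomorphic_on A" "g ` A \<subseteq> A" "l holomorphic_on A"
  shows "iter_log g l n holomorphic_on A"
proof (induction n)
  case 0
  show ?case by (simp add: holomorphic_on_def)
next
  case (Suc n)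
  have "(iter_log g l n \<circ> g) holomorphic_on A"
    by (rule holomorphic_on_compose_gen[OF assms(1) Suc assms(2)])
  then have "(\<lambda>z. iter_log g l n (g z) + (-1) ^ n * l z) holomorphic_on A"
    using assms(3) by (intro holomorphic_intros) (auto simp: o_def)
  then show ?case by (simp add: fun_eq_iff[symmetric])
qed

text \<open>The logarithm \<open>l\<close> expresses that \<open>g\<close> reverses winding about
  \<open>a\<close>, as a map interchanging the ends of an annulus does. The set
  \<open>\<beta>\<close> plays the core curve: by \<open>no_log\<close>, winding about
  \<open>a\<close> is seen on it. The distance \<open>\<delta>\<close> and the boundedness of
  \<open>A\<close> keep \<open>ln (cmod (z - a))\<close> bounded along orbits.\<close>

locale end_swapping_map =
  fixes A :: "complex set" and g l :: "complex \<Rightarrow> complex" and a :: complex and \<delta> :: real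
    and \<beta> :: "complex set"
  assumes A: "open A" "connected A" "bounded A"
    and \<delta>: "\<delta> > 0" "\<And>z. z \<in> A \<Longrightarrow> \<delta> \<le> cmod (z - a)"
    and g: "g holomorphic_on A" "g ` A \<subseteq> A" "inj_on g A"
    and l: "l holomorphic_on A" "\<And>z. z \<in> A \<Longrightarrow> (g z - a) * (z - a) = exp (l z)"
    and \<beta>: "compact \<beta>" "\<beta> \<subseteq> A"
    and no_log: "\<not> (\<exists>L. continuous_on \<beta> L \<and> (\<forall>z\<in>\<beta>. z - a = exp (L z)))"
begin

lemma iter_eq:
  assumes "z \<in> A"
  shows "(g ^^ n) z - a = exp (iter_log g l n z) * (if even n then z - a else inverse (z - a))"
  using assms
proof (induction n arbitrary: z)
  case 0
  then show ?case by simp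
next
  case (Suc n)
  have gz: "g z \<in> A" using Suc.prems g(2) by auto
  have ne: "z - a \<noteq> 0" "g z - a \<noteq> 0" using \<delta>(2)[OF Suc.prems] \<delta>(2)[OF gz] \<delta>(1) by auto
  have eq: "g z - a = exp (l z) / (z - a)" using l(2)[OF Suc.prems] ne by (simp add: field_simps)
  have "(g ^^ Suc n) z - a = (g ^^ n) (g z) - a" by (simp add: funpow_swap1)
  also have "\<dots> = exp (iter_log g l n (g z)) * (if even n then g z - a else inverse (g z - a))"
    by (rule Suc.IH[OF gz])
  also have "\<dots> = exp (iter_log g l (Suc n) z) * (if even (Suc n) then z - a else inverse (z - a))"
    unfolding eq using ne by (auto simp: exp_add exp_diff exp_minus divide_simps)
  finally show ?case .
qed

lemma bounds:
  obtains C where "\<And>z. z \<in> A \<Longrightarrow> \<bar>ln (cmod (z - a))\<bar> \<le> C"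
proof -
  obtain B where B: "\<And>z. z \<in> A \<Longrightarrow> cmod z \<le> B" using A(3) bounded_iff by blast
  have "\<bar>ln (cmod (z - a))\<bar> \<le> \<bar>ln \<delta>\<bar> + \<bar>ln (\<bar>B\<bar> + cmod a + 1)\<bar>" if "z \<in> A" for z
  proof -
    have 1: "\<delta> \<le> cmod (z - a)" by (rule \<delta>(2)[OF that])
    have 2: "cmod (z - a) \<le> \<bar>B\<bar> + cmod a + 1" using B[OF that] norm_triangle_ineq4[of z a] by linarith
    have "ln \<delta> \<le> ln (cmod (z - a))" using 1 \<delta>(1) by (subst ln_le_cancel_iff) auto
    moreover have "ln (cmod (z - a)) \<le> ln (\<bar>B\<bar> + cmod a + 1)"
      using 1 2 \<delta>(1) by (subst ln_le_cancel_iff) auto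
    ultimately show ?thesis by linarith
  qed
  then show ?thesis by (rule that)
qed

text \<open>By \<open>iter_eq\<close>, \<open>E k\<close> is a geometric mean of the functions \<open>((g ^^ n) z - a) powi ((-1) ^ n)\<close>,
  \<open>n < 2 * Suc k\<close>. Its modulus is therefore bounded, and \<open>E k (g z) * E k z\<close> tends to a constant.\<close>

definition S :: "nat \<Rightarrow> complex \<Rightarrow> complex" where
  "S k z = (\<Sum>n<2 * Suc k. (-1) ^ n * iter_log g l n z) / of_nat (2 * Suc k)"

definition E :: "nat \<Rightarrow> complex \<Rightarrow> complex" where
  "E k z = (z - a) * exp (S k z)"

lemma ln_norm_iter:
  assumes "z \<in> A"
  shows "(-1) ^ n * Re (iter_log g l n z) + ln (cmod (z - a)) = (-1) ^ n * ln (cmod ((g ^^ n) z - a))"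
proof -
  have p: "cmod (z - a) > 0" using \<delta>(2)[OF assms] \<delta>(1) by linarith
  have "cmod ((g ^^ n) z - a) = exp (Re (iter_log g l n z)) * (if even n then cmod (z - a) else inverse (cmod (z - a)))"
    unfolding iter_eq[OF assms] by (simp add: norm_mult norm_inverse)
  then have "ln (cmod ((g ^^ n) z - a)) = Re (iter_log g l n z) + (if even n then ln (cmod (z - a)) else - ln (cmod (z - a)))"
    using p by (simp add: ln_mult ln_inverse)
  then show ?thesis by auto
qed

lemma ln_norm_E:
  assumes "z \<in> A"
  shows "ln (cmod (E k z)) = (\<Sum>n<2 * Suc k. (-1) ^ n * ln (cmod ((g ^^ n) z - a))) / of_nat (2 * Suc k)"
proof -
  have p: "cmod (z - a) > 0" using \<delta>(2)[OF assms] \<delta>(1) by linarith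
  let ?N = "2 * Suc k"
  have Re1: "Re ((-1) ^ n * x) = (-1) ^ n * Re x" for n x
    by (cases "even n") auto
  have "ln (cmod (E k z)) = ln (cmod (z - a)) + Re (S k z)"
    unfolding E_def using p by (simp add: norm_mult ln_mult)
  also have "Re (S k z) = (\<Sum>n<?N. (-1) ^ n * Re (iter_log g l n z)) / of_nat ?N"
    unfolding S_def using Re_divide_of_nat[of _ ?N] by (simp only: Re_sum Re1 Re_divide_of_nat)
  also have "ln (cmod (z - a)) + \<dots> = (\<Sum>n<?N. (-1) ^ n * Re (iter_log g l n z) + ln (cmod (z - a))) / of_nat ?N"
    by (simp add: sum.distrib add_divide_distrib del: mult_Suc_right sum.lessThan_Suc)
  also have "\<dots> = (\<Sum>n<?N. (-1) ^ n * ln (cmod ((g ^^ n) z - a))) / of_nat ?N"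
    using ln_norm_iter[OF assms] by (simp del: mult_Suc_right sum.lessThan_Suc)
  finally show ?thesis .
qed

lemma norm_E_bounds:
  obtains C where "\<And>k z. z \<in> A \<Longrightarrow> exp (- C) \<le> cmod (E k z) \<and> cmod (E k z) \<le> exp C"
proof -
  obtain C where C: "\<And>z. z \<in> A \<Longrightarrow> \<bar>ln (cmod (z - a))\<bar> \<le> C" using bounds by blast
  have "exp (- C) \<le> cmod (E k z) \<and> cmod (E k z) \<le> exp C" if "z \<in> A" for k z
  proof -
    let ?N = "2 * Suc k"
    have "z - a \<noteq> 0" using \<delta>(2)[OF that] \<delta>(1) by auto
    then have ne: "cmod (E k z) > 0" by (simp add: E_def)
    have "\<bar>\<Sum>n<?N. (-1) ^ n * ln (cmod ((g ^^ n) z - a))\<bar> \<le> (\<Sum>n<?N. \<bar>(-1) ^ n * ln (cmod ((g ^^ n) z - a))\<bar>)"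
      by (rule sum_abs)
    also have "\<dots> \<le> (\<Sum>n<?N. C)"
      by (rule sum_mono) (use C funpow_in[OF g(2) that] in \<open>auto simp: abs_mult\<close>)
    finally have "\<bar>\<Sum>n<?N. (-1) ^ n * ln (cmod ((g ^^ n) z - a))\<bar> \<le> of_nat ?N * C"
      by (simp del: mult_Suc_right sum.lessThan_Suc)
    moreover have "real ?N > 0" by simp
    ultimately have "\<bar>ln (cmod (E k z))\<bar> \<le> C"
      unfolding ln_norm_E[OF that] abs_divide by (simp add: divide_le_eq mult.commute del: mult_Suc_right sum.lessThan_Suc)
    then have "- C \<le> ln (cmod (E k z))" "ln (cmod (E k z)) \<le> C" by linarith+
    then show ?thesis using ne by (metis exp_le_cancel_iff exp_ln)
  qed
  then show ?thesis by (rule that)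
qed

text \<open>Passing from \<open>z\<close> to \<open>g z\<close> shifts the index in the mean and
  thereby reverses every sign. The sums cancel up to the end term, since the term of index 0
  vanishes, and the copies of \<open>l z\<close> cancel the logarithm of
  \<open>(g z - a) * (z - a)\<close>.\<close>

lemma E_mult:
  assumes "z \<in> A"
  shows "E k (g z) * E k z = exp (- iter_log g l (2 * Suc k) z / of_nat (2 * Suc k))"
proof -
  let ?N = "2 * Suc k" and ?L = "\<lambda>n. iter_log g l n z"
  have N: "(of_nat ?N :: complex) \<noteq> 0" unfolding of_nat_eq_0_iff by simp
  have "(\<Sum>n<?N. (-1) ^ n * iter_log g l n (g z)) = (\<Sum>n<?N. - ((-1) ^ Suc n * ?L (Suc n)) - l z)"
    by (rule sum.cong) (auto simp: algebra_simps simp flip: power_mult_distrib)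
  also have "\<dots> = - (\<Sum>n<?N. (-1) ^ Suc n * ?L (Suc n)) - of_nat ?N * l z"
    by (simp add: sum_subtractf sum_negf del: mult_Suc_right sum.lessThan_Suc)
  also have "(\<Sum>n<?N. (-1) ^ Suc n * ?L (Suc n)) = (\<Sum>n<Suc ?N. (-1) ^ n * ?L n) - ?L 0"
    by (subst sum.lessThan_Suc_shift) simp
  also have "\<dots> = (\<Sum>n<?N. (-1) ^ n * ?L n) + ?L ?N" by simp
  finally have s: "S k (g z) = - S k z - ?L ?N / of_nat ?N - l z"
    unfolding S_def using N by (simp add: diff_divide_distrib add_divide_distrib del: mult_Suc_right sum.lessThan_Suc of_nat_mult of_nat_Suc)
  have "E k (g z) * E k z = ((g z - a) * (z - a)) * exp (S k (g z) + S k z)"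
    unfolding E_def exp_add by (simp add: mult_ac)
  also have "\<dots> = exp (l z + (S k (g z) + S k z))" unfolding exp_add by (simp add: l(2)[OF assms])
  also have "l z + (S k (g z) + S k z) = - ?L ?N / of_nat ?N" unfolding s by (simp del: iter_log.simps mult_Suc_right of_nat_mult of_nat_Suc)
  finally show ?thesis .
qed

text \<open>Along an orbit the real part of \<open>iter_log\<close> is bounded, being a combination
  of logarithms of moduli, so division by \<open>2 * Suc k\<close> kills it. The imaginary part is
  not controlled, which is why only the modulus is claimed.\<close>

lemma norm_E_mult_tendsto:
  assumes "z \<in> A"
  shows "(\<lambda>k. cmod (E k (g z) * E k z)) \<longlonglongrightarrow> 1"
proof -
  obtain C where C: "\<And>z. z \<in> A \<Longrightarrow> \<bar>ln (cmod (z - a))\<bar> \<le> C" using bounds by blast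
  have L: "\<bar>Re (iter_log g l (2 * Suc k) z)\<bar> \<le> 2 * C" for k
    using ln_norm_iter[OF assms, of "2 * Suc k"] C[OF assms] C[OF funpow_in[OF g(2) assms], of "2 * Suc k"]
    by simp
  have "(\<lambda>k. Re (- iter_log g l (2 * Suc k) z / of_nat (2 * Suc k))) \<longlonglongrightarrow> 0"
  proof (rule Lim_null_comparison)
    show "\<forall>\<^sub>F k in sequentially. norm (Re (- iter_log g l (2 * Suc k) z / of_nat (2 * Suc k))) \<le> 2 * C * inverse (real (Suc k))"
    proof (intro always_eventually allI)
      fix k
      have "norm (Re (- iter_log g l (2 * Suc k) z / of_nat (2 * Suc k))) = \<bar>Re (iter_log g l (2 * Suc k) z)\<bar> / real (2 * Suc k)"
        by (simp only: Re_divide_of_nat) (simp add: del: mult_Suc_right)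
      also have "\<dots> \<le> 2 * C / real (Suc k)" using L[of k] by (intro frac_le) auto
      finally show "norm (Re (- iter_log g l (2 * Suc k) z / of_nat (2 * Suc k))) \<le> 2 * C * inverse (real (Suc k))"
        by (simp add: divide_inverse)
    qed
    show "(\<lambda>k. 2 * C * inverse (real (Suc k))) \<longlonglongrightarrow> 0"
      using tendsto_mult[OF tendsto_const[of "2 * C"] LIMSEQ_inverse_real_of_nat] by simp
  qed
  then have "(\<lambda>k. exp (Re (- iter_log g l (2 * Suc k) z / of_nat (2 * Suc k)))) \<longlonglongrightarrow> exp 0"
    by (rule tendsto_exp)
  then show ?thesis unfolding E_mult[OF assms] by (simp only: norm_exp_eq_Re exp_zero)
qed

lemma holomorphic_E: "E k holomorphic_on A"
proof -
  have "(\<lambda>z. (z - a) * exp (S k z)) holomorphic_on A"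
    unfolding S_def by (intro holomorphic_intros holomorphic_on_iter_log g l) auto
  then show ?thesis by (simp add: E_def[abs_def])
qed

text \<open>A Montel limit of the \<open>E k\<close> serves. The lower bound in
  \<open>norm_E_bounds\<close> keeps it free of zeros, so the constancy of
  \<open>e (g z) * e z\<close> may be used at \<open>z\<close> and at \<open>g z\<close> and the
  common factor divided out.\<close>

lemma invariant_function:
  obtains e where "e holomorphic_on A" "\<not> e constant_on A" "\<And>z. z \<in> A \<Longrightarrow> e (g (g z)) = e z"
proof -
  obtain C where C: "\<And>k z. z \<in> A \<Longrightarrow> exp (- C) \<le> cmod (E k z) \<and> cmod (E k z) \<le> exp C"
    using norm_E_bounds by blast
  obtain e r where e: "e holomorphic_on A" "strict_mono (r :: nat \<Rightarrow> nat)"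
    "\<And>x. x \<in> A \<Longrightarrow> (\<lambda>n. E (r n) x) \<longlonglongrightarrow> e x"
    "\<And>K. \<lbrakk>compact K; K \<subseteq> A\<rbrakk> \<Longrightarrow> uniform_limit K (E \<circ> r) e sequentially"
  proof (rule Montel[of A "range E" E])
    show "\<exists>B. \<forall>h\<in>range E. \<forall>z\<in>K. cmod (h z) \<le> B" if "K \<subseteq> A" for K
      using C that by (intro exI[of _ "exp C"]) auto
  qed (use A(1) holomorphic_E in auto)
  have nz: "e z \<noteq> 0" if "z \<in> A" for z
  proof -
    have "(\<lambda>n. cmod (E (r n) z)) \<longlonglongrightarrow> cmod (e z)" by (intro tendsto_norm e(3) that)
    then have "exp (- C) \<le> cmod (e z)" by (rule tendsto_lowerbound) (use C[OF that] in auto)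
    then show ?thesis using exp_gt_zero[of "- C"] by auto
  qed
  have gA: "g z \<in> A" if "z \<in> A" for z using g(2) that by auto
  have one: "cmod (e (g z) * e z) = 1" if "z \<in> A" for z
  proof (rule LIMSEQ_unique)
    show "(\<lambda>n. cmod (E (r n) (g z) * E (r n) z)) \<longlonglongrightarrow> cmod (e (g z) * e z)"
      by (intro tendsto_norm tendsto_mult e(3) gA that)
    show "(\<lambda>n. cmod (E (r n) (g z) * E (r n) z)) \<longlonglongrightarrow> 1"
      using LIMSEQ_subseq_LIMSEQ[OF norm_E_mult_tendsto[OF that] e(2)] by (simp add: o_def)
  qed
  have hol: "(\<lambda>z. e (g z) * e z) holomorphic_on A"
    using holomorphic_on_compose_gen[OF g(1) e(1) g(2)] e(1) by (intro holomorphic_intros) (auto simp: o_def)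
  \<comment> \<open>The modulus is 1 everywhere, so every point is a maximum of it.\<close>
  have "(\<lambda>z. e (g z) * e z) constant_on A"
  proof (cases "A = {}")
    case False
    then obtain \<xi> where "\<xi> \<in> A" by blast
    show ?thesis
      by (rule maximum_modulus_principle[OF hol A(1,2) A(1) order_refl \<open>\<xi> \<in> A\<close>]) (simp add: one \<open>\<xi> \<in> A\<close>)
  qed (simp add: constant_on_def)
  then obtain c where c: "\<And>z. z \<in> A \<Longrightarrow> e (g z) * e z = c" by (auto simp: constant_on_def)
  have inv: "e (g (g z)) = e z" if "z \<in> A" for z
  proof -
    have "e (g (g z)) * e (g z) = e z * e (g z)" using c[OF that] c[OF gA[OF that]] by (simp add: mult.commute)
    then show ?thesis using nz[OF gA[OF that]] by simp
  qed
  \<comment> \<open>If \<open>e\<close> were constant, some \<open>E k\<close> would be close to a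
    nonzero constant on \<open>\<beta>\<close> and have a continuous logarithm there. Subtracting
    \<open>S k\<close> would give one of \<open>z - a\<close>, against
    \<open>no_log\<close>.\<close>
  have "\<not> e constant_on A"
  proof
    assume "e constant_on A"
    then obtain e0 where e0: "\<And>z. z \<in> A \<Longrightarrow> e z = e0" by (auto simp: constant_on_def)
    show False
    proof (cases "\<beta> = {}")
      case True
      then show False using no_log by simp
    next
      case False
      then have "e0 \<noteq> 0" using nz e0 \<beta>(2) by blast
      then have "\<forall>\<^sub>F n in sequentially. \<forall>z\<in>\<beta>. dist ((E \<circ> r) n z) (e z) < cmod e0"
        using e(4)[OF \<beta>] unfolding uniform_limit_iff by simp
      then obtain n where n: "\<And>z. z \<in> \<beta> \<Longrightarrow> dist (E (r n) z) (e z) < cmod e0"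
        using eventually_happens'[OF sequentially_bot] by fastforce
      let ?k = "r n"
      have "\<exists>L. continuous_on \<beta> L \<and> (\<forall>z\<in>\<beta>. E ?k z = exp (L z))"
      proof (rule continuous_log_near_constant)
        show "continuous_on \<beta> (E ?k)" using holomorphic_E \<beta>(2)
          by (meson continuous_on_subset holomorphic_on_imp_continuous_on)
        show "cmod (E ?k z - e0) < cmod e0" if "z \<in> \<beta>" for z
          using n[OF that] e0 \<beta>(2) that by (auto simp: dist_norm)
      qed
      then obtain L where L: "continuous_on \<beta> L" "\<And>z. z \<in> \<beta> \<Longrightarrow> E ?k z = exp (L z)" by blast
      have "S ?k holomorphic_on A"
        unfolding S_def[abs_def] by (intro holomorphic_intros holomorphic_on_iter_log g l) auto
      then have "continuous_on \<beta> (\<lambda>z. L z - S ?k z)"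
        using L(1) \<beta>(2) by (intro continuous_intros) (auto intro: continuous_on_subset holomorphic_on_imp_continuous_on)
      moreover have "z - a = exp (L z - S ?k z)" if "z \<in> \<beta>" for z
        using L(2)[OF that] by (simp add: E_def exp_diff divide_simps)
      ultimately show False using no_log by blast
    qed
  qed
  with e(1) inv show ?thesis using that by blast
qed

text \<open>A constant limit \<open>w\<close> is not \<open>a\<close>, because orbits stay
  \<open>\<delta>\<close> away from \<open>a\<close>; so \<open>(g ^^ (2 * n k)) z - a\<close> would
  have a logarithm on \<open>\<beta>\<close> for some \<open>k\<close>. By \<open>iter_eq\<close> it
  differs from \<open>z - a\<close> only by an exponential factor, and \<open>z - a\<close> would
  have a logarithm as well.\<close>

lemma even_iterates_no_constant_limit:
  assumes "\<And>z. z \<in> A \<Longrightarrow> h z = w"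
    and "uniform_limit \<beta> (\<lambda>k. g ^^ (2 * n k)) h sequentially"
  shows False
proof (cases "\<beta> = {}")
  case True
  then show False using no_log by simp
next
  case False
  then obtain b where b: "b \<in> \<beta>" by blast
  have "(\<lambda>k. (g ^^ (2 * n k)) b) \<longlonglongrightarrow> w"
    using tendsto_uniform_limitI[OF assms(2) b] assms(1) b \<beta>(2) by auto
  then have "(\<lambda>k. cmod ((g ^^ (2 * n k)) b - a)) \<longlonglongrightarrow> cmod (w - a)" by (intro tendsto_intros)
  then have wa: "\<delta> \<le> cmod (w - a)"
    by (rule tendsto_lowerbound) (use \<delta>(2) funpow_in[OF g(2)] b \<beta>(2) in auto)
  then have "\<forall>\<^sub>F k in sequentially. \<forall>z\<in>\<beta>. dist ((g ^^ (2 * n k)) z) (h z) < cmod (w - a)"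
    using uniform_limitD[OF assms(2), of "cmod (w - a)"] \<delta>(1) by linarith
  then obtain k where k: "\<And>z. z \<in> \<beta> \<Longrightarrow> dist ((g ^^ (2 * n k)) z) (h z) < cmod (w - a)"
    using eventually_happens'[OF sequentially_bot] by fastforce
  let ?G = "g ^^ (2 * n k)"
  have "\<exists>L. continuous_on \<beta> L \<and> (\<forall>z\<in>\<beta>. ?G z - a = exp (L z))"
  proof (rule continuous_log_near_constant)
    show "continuous_on \<beta> (\<lambda>z. ?G z - a)" using holomorphic_on_funpow[OF g(1,2)] \<beta>(2)
      by (intro continuous_intros) (meson continuous_on_subset holomorphic_on_imp_continuous_on)
    show "cmod (?G z - a - (w - a)) < cmod (w - a)" if "z \<in> \<beta>" for z
      using k[OF that] assms(1) \<beta>(2) that by (auto simp: dist_norm)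
  qed
  then obtain L where L: "continuous_on \<beta> L" "\<And>z. z \<in> \<beta> \<Longrightarrow> ?G z - a = exp (L z)" by blast
  have "continuous_on \<beta> (\<lambda>z. L z - iter_log g l (2 * n k) z)"
    using L(1) continuous_on_subset[OF holomorphic_on_imp_continuous_on[OF holomorphic_on_iter_log[OF g(1,2) l(1)]] \<beta>(2)]
    by (intro continuous_intros) auto
  moreover have "z - a = exp (L z - iter_log g l (2 * n k) z)" if "z \<in> \<beta>" for z
    using L(2)[OF that] iter_eq[of z "2 * n k"] that \<beta>(2) by (auto simp: exp_diff divide_simps)
  ultimately show False using no_log by blast
qed

text \<open>Iterates along a convergent subsequence end up close together, and the invariant
  \<open>e\<close> takes the same value on them. Where \<open>e\<close> is injective near the limit
  value, two such iterates must therefore agree on a whole disc.\<close>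

lemma many_periodic_points:
  obtains m where "m > 0" "infinite {z \<in> A. (g ^^ m) z = z}"
proof -
  obtain e where e: "e holomorphic_on A" "\<not> e constant_on A" "\<And>z. z \<in> A \<Longrightarrow> e (g (g z)) = e z"
    using invariant_function by blast
  let ?G = "\<lambda>k. g ^^ (2 * k)"
  have GA: "?G k z \<in> A" if "z \<in> A" for k z by (rule funpow_in[OF g(2) that])
  have eG: "e (?G k z) = e z" if "z \<in> A" for k z
    using that by (induction k) (auto simp: e(3) GA)
  obtain B where B: "\<And>z. z \<in> A \<Longrightarrow> cmod z \<le> B" using A(3) bounded_iff by blast
  obtain h r where h: "h holomorphic_on A" "strict_mono (r :: nat \<Rightarrow> nat)"
    "\<And>x. x \<in> A \<Longrightarrow> (\<lambda>n. ?G (r n) x) \<longlonglongrightarrow> h x"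
    "\<And>K. \<lbrakk>compact K; K \<subseteq> A\<rbrakk> \<Longrightarrow> uniform_limit K (?G \<circ> r) h sequentially"
  proof (rule Montel[of A "range ?G" ?G])
    show "\<exists>B. \<forall>h\<in>range ?G. \<forall>z\<in>K. cmod (h z) \<le> B" if "K \<subseteq> A" for K
      using B GA that by (intro exI[of _ B]) (auto simp: subset_iff)
  qed (use A(1) holomorphic_on_funpow[OF g(1,2)] in auto)
  have hc: "\<not> h constant_on A"
    using even_iterates_no_constant_limit[of h _ r] h(4)[OF \<beta>] by (auto simp: constant_on_def o_def)
  \<comment> \<open>A value outside \<open>A\<close> is omitted by all iterates, hence by Hurwitz
    also by their nonconstant limit.\<close>
  have hA: "h z0 \<in> A" if "z0 \<in> A" for z0
  proof (rule ccontr)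
    assume nA: "h z0 \<notin> A"
    have "h z0 - h z0 \<noteq> 0"
    proof (rule Hurwitz_no_zeros[where \<F> = "\<lambda>n z. ?G (r n) z - h z0" and S = A and g = "\<lambda>z. h z - h z0"])
      show "uniform_limit K (\<lambda>n z. ?G (r n) z - h z0) (\<lambda>z. h z - h z0) sequentially" if "compact K" "K \<subseteq> A" for K
        using h(4)[OF that] by (intro uniform_limit_intros) (simp add: o_def)
      show "\<not> (\<lambda>z. h z - h z0) constant_on A"
        using hc by (simp add: constant_on_def) (metis diff_add_cancel)
      show "?G (r n) z - h z0 \<noteq> 0" if "z \<in> A" for n z
        using GA[OF that] nA by (metis eq_iff_diff_eq_0)
    qed (use A that h(1) holomorphic_on_funpow[OF g(1,2)] in \<open>auto intro!: holomorphic_intros\<close>)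
    then show False by simp
  qed
  obtain z1 where z1: "z1 \<in> A" using hc by (auto simp: constant_on_def)
  have oh: "open (h ` A)" by (rule open_mapping_thm[OF h(1) A(1,2) A(1) order_refl hc])
  \<comment> \<open>The image of \<open>A\<close> under \<open>h\<close> is open; if the derivative
    of \<open>e\<close> vanished on it, analytic continuation would make \<open>e\<close>
    constant.\<close>
  have "\<exists>w\<in>h ` A. deriv e w \<noteq> 0"
  proof (rule ccontr)
    assume "\<not> ?thesis"
    then have d0: "deriv e w = 0" if "w \<in> h ` A" for w using that by blast
    obtain \<rho> where \<rho>: "\<rho> > 0" "ball (h z1) \<rho> \<subseteq> h ` A" using oh z1 by (meson imageI openE)
    have "deriv e holomorphic_on A" by (rule holomorphic_deriv[OF e(1) A(1)])
    then have d: "deriv e w = 0" if "w \<in> A" for w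
      using analytic_continuation_open[of "ball (h z1) \<rho>" A "deriv e" "\<lambda>_. 0" w] \<rho> d0 hA A that by (force simp: subset_iff)
    have "e constant_on A"
    proof (rule has_field_derivative_0_imp_constant_on)
      show "(e has_field_derivative 0) (at z)" if "z \<in> A" for z
        using holomorphic_derivI[OF e(1) A(1) that] d[OF that] by simp
    qed (use A in auto)
    then show False using e(2) by blast
  qed
  then obtain z0 where z0: "z0 \<in> A" "deriv e (h z0) \<noteq> 0" by blast
  obtain \<rho> where \<rho>: "\<rho> > 0" "ball (h z0) \<rho> \<subseteq> A" "inj_on e (ball (h z0) \<rho>)"
    using has_complex_derivative_locally_injective[OF e(1) hA[OF z0(1)] A(1) z0(2)] by blast
  have "isCont h z0" using h(1) A(1) z0(1) continuous_on_eq_continuous_at holomorphic_on_imp_continuous_on by blast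
  then obtain \<eta> where \<eta>: "\<eta> > 0" "\<And>z. dist z z0 < \<eta> \<Longrightarrow> dist (h z) (h z0) < \<rho> / 2"
    using \<rho>(1) unfolding continuous_at_eps_delta by (meson half_gt_zero)
  obtain \<eta>' where \<eta>': "\<eta>' > 0" "cball z0 \<eta>' \<subseteq> A" using A(1) z0(1) open_contains_cball by blast
  define \<epsilon> where "\<epsilon> = min (\<eta> / 2) \<eta>'"
  have \<epsilon>: "\<epsilon> > 0" "cball z0 \<epsilon> \<subseteq> A" "\<And>z. z \<in> cball z0 \<epsilon> \<Longrightarrow> dist (h z) (h z0) < \<rho> / 2"
    using \<eta> \<eta>' by (auto simp: \<epsilon>_def dist_commute)
  have "\<forall>\<^sub>F n in sequentially. \<forall>z\<in>cball z0 \<epsilon>. dist (?G (r n) z) (h z) < \<rho> / 2"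
    using uniform_limitD[OF h(4)[OF compact_cball \<epsilon>(2)], of "\<rho> / 2"] \<rho>(1) by (simp add: o_def)
  then obtain k where k: "\<And>n z. n \<ge> k \<Longrightarrow> z \<in> cball z0 \<epsilon> \<Longrightarrow> dist (?G (r n) z) (h z) < \<rho> / 2"
    unfolding eventually_sequentially by blast
  have near: "?G (r n) z \<in> ball (h z0) \<rho>" if "n \<ge> k" "z \<in> cball z0 \<epsilon>" for n z
    using k[OF that] \<epsilon>(3)[OF that(2)] dist_triangle_half_r[of "h z" "h z0" \<rho> "?G (r n) z"]
    by (metis dist_commute mem_ball)
  have lt: "r k < r (Suc k)" using h(2) by (simp add: strict_mono_def)
  define m where "m = 2 * (r (Suc k) - r k)"
  have eq: "?G (r k) z = ?G (r (Suc k)) z" if "z \<in> cball z0 \<epsilon>" for z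
    using inj_onD[OF \<rho>(3), of "?G (r k) z" "?G (r (Suc k)) z"] near that eG \<epsilon>(2) by (auto simp: subset_iff)
  have fix1: "(g ^^ m) (?G (r k) z) = ?G (r k) z" if "z \<in> cball z0 \<epsilon>" for z
  proof -
    have "(g ^^ m) (?G (r k) z) = (g ^^ (m + 2 * r k)) z" by (simp add: funpow_add)
    also have "m + 2 * r k = 2 * r (Suc k)" unfolding m_def using lt by simp
    finally show ?thesis using eq[OF that] by simp
  qed
  \<comment> \<open>Injectivity of \<open>g\<close> keeps the image of the disc infinite, and by
    \<open>fix1\<close> that image consists of periodic points.\<close>
  have "inj_on (g ^^ n) A" for n
    by (induction n) (use g funpow_in[OF g(2)] in \<open>auto simp: inj_on_def\<close>)
  then have "infinite (?G (r k) ` ball z0 \<epsilon>)"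
    using finite_imp_not_open[of "ball z0 \<epsilon>"] \<epsilon>(1,2) open_ball[of z0 \<epsilon>] centre_in_ball[of z0 \<epsilon>] ball_subset_cball[of z0 \<epsilon>]
    by (metis empty_iff finite_image_iff inj_on_subset subset_trans)
  moreover have "?G (r k) ` ball z0 \<epsilon> \<subseteq> {z \<in> A. (g ^^ m) z = z}"
    using fix1 GA \<epsilon>(2) by (auto simp: subset_iff)
  ultimately have "infinite {z \<in> A. (g ^^ m) z = z}" using infinite_super by blast
  moreover have "m > 0" using lt by (simp add: m_def)
  ultimately show ?thesis using that by blast
qed

end

section \<open>Topology of the Riemann sphere\<close>

lemma dist_Finite_le: "dist (Finite z) (Finite w) \<le> 2 * cmod (z - w)"
proof -
  have "1 \<le> sqrt (1 + (cmod z)\<^sup>2) * sqrt (1 + (cmod w)\<^sup>2)"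
    using mult_mono[of 1 "sqrt (1 + (cmod z)\<^sup>2)" 1 "sqrt (1 + (cmod w)\<^sup>2)"] by simp
  then show ?thesis unfolding dist_Finite_Finite
    using divide_left_mono[of 1 "sqrt (1 + (cmod z)\<^sup>2) * sqrt (1 + (cmod w)\<^sup>2)" "2 * cmod (z - w)"] by simp
qed

lemma isCont_Finite: "isCont Finite z"
  unfolding continuous_at_eps_delta
proof (intro allI impI)
  fix e :: real assume "e > 0"
  then show "\<exists>d>0. \<forall>x'. dist x' z < d \<longrightarrow> dist (Finite x') (Finite z) < e"
    using dist_Finite_le by (intro exI[of _ "e / 2"]) (smt (verit) dist_norm field_sum_of_halves)
qed

definition recip :: "complex \<Rightarrow> riemann_sphere" where
  "recip z = (if z = 0 then Infinity else Finite (1 / z))"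

lemma recip_0 [simp]: "recip 0 = Infinity"
  by (simp add: recip_def)

text \<open>Carries metric facts about the chart \<open>Finite\<close> over to the chart
  \<open>recip\<close> around \<open>Infinity\<close>.\<close>

lemma dist_recip: "dist (recip z) (recip w) = dist (Finite z) (Finite w)"
proof -
  have inf: "dist Infinity (Finite (1 / w)) = dist (Finite 0) (Finite w)" if "w \<noteq> 0" for w
  proof -
    have "1 + (cmod (1 / w))\<^sup>2 = (1 + (cmod w)\<^sup>2) / (cmod w)\<^sup>2"
      using that by (simp add: norm_divide power_divide field_simps)
    then show ?thesis
      unfolding dist_commute[of Infinity] dist_Finite_Infinity dist_Finite_Finite
      using that by (simp add: real_sqrt_divide)
  qed
  have fin: "dist (Finite (1 / z)) (Finite (1 / w)) = dist (Finite z) (Finite w)" if "z \<noteq> 0" "w \<noteq> 0"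
  proof -
    have s: "sqrt (1 + (cmod (1 / w))\<^sup>2) = sqrt (1 + (cmod w)\<^sup>2) / cmod w" if "w \<noteq> 0" for w
    proof -
      have "1 + (cmod (1 / w))\<^sup>2 = (1 + (cmod w)\<^sup>2) / (cmod w)\<^sup>2"
        using that by (simp add: norm_divide power_divide field_simps)
      then show ?thesis by (simp add: real_sqrt_divide)
    qed
    have "1 / z - 1 / w = (w - z) / (z * w)" using that by (simp add: field_simps)
    then show ?thesis unfolding dist_Finite_Finite s[OF that(1)] s[OF that(2)]
      using that by (simp add: norm_divide norm_mult norm_minus_commute)
  qed
  show ?thesis
    using inf fin by (auto simp: recip_def dist_commute)
qed

lemma isCont_recip: "isCont recip z"
  using isCont_Finite[of z] by (simp add: continuous_at_eps_delta dist_recip)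

lemmas continuous_on_Finite = continuous_at_imp_continuous_on[of S Finite for S, OF ballI, OF isCont_Finite]
lemmas continuous_on_recip = continuous_at_imp_continuous_on[of S recip for S, OF ballI, OF isCont_recip]

lemma sphere_cases:
  obtains (Finite) z where "cmod z \<le> 1" "x = Finite z" | (recip) z where "cmod z \<le> 1" "x = recip z"
proof (cases x)
  case (Finite z)
  show ?thesis
  proof (cases "cmod z \<le> 1")
    case False
    then have "x = recip (1 / z)" "cmod (1 / z) \<le> 1" using Finite False by (auto simp: recip_def norm_divide divide_le_eq)
    then show ?thesis using that(2) by blast
  qed (use Finite that in blast)
next
  case Infinity
  then show ?thesis using that(2)[of 0] by simp
qed

lemma sphere_cover: "x \<in> Finite ` cball 0 1 \<union> recip ` cball 0 1"
  by (cases x rule: sphere_cases) auto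

lemma compact_UNIV_sphere: "compact (UNIV :: riemann_sphere set)"
proof -
  have "UNIV = Finite ` cball 0 1 \<union> recip ` cball 0 1" using sphere_cover by blast
  then show ?thesis
    by (metis compact_Un compact_cball compact_continuous_image continuous_on_Finite continuous_on_recip)
qed

lemma closed_imp_compact_sphere: "closed (S :: riemann_sphere set) \<Longrightarrow> compact S"
  using compact_Int_closed[OF compact_UNIV_sphere] by simp

lemma open_inverse_vimage:
  assumes "open S"
  shows "open {z::complex. z \<noteq> 0 \<and> 1 / z \<in> S}"
proof -
  have "continuous_on (- {0}) (\<lambda>z::complex. 1 / z)" by (intro continuous_intros) auto
  then have "open (- {0} \<inter> (\<lambda>z::complex. 1 / z) -` S)"
    by (rule continuous_open_preimage) (use assms in auto)
  moreover have "- {0} \<inter> (\<lambda>z::complex. 1 / z) -` S = {z::complex. z \<noteq> 0 \<and> 1 / z \<in> S}" by auto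
  ultimately show ?thesis by simp
qed

lemma Finite_in_recip_image: "Finite z \<in> recip ` S \<longleftrightarrow> z \<noteq> 0 \<and> 1 / z \<in> S"
proof
  assume "Finite z \<in> recip ` S"
  then show "z \<noteq> 0 \<and> 1 / z \<in> S" by (auto simp: recip_def split: if_splits)
next
  assume "z \<noteq> 0 \<and> 1 / z \<in> S"
  then show "Finite z \<in> recip ` S" by (intro image_eqI[of _ _ "1 / z"]) (auto simp: recip_def)
qed

lemma recip_in_recip_image: "recip z \<in> recip ` S \<longleftrightarrow> z \<in> S"
proof -
  have "inj recip" by (auto simp: inj_def recip_def split: if_splits)
  then show ?thesis by (simp add: inj_image_mem_iff)
qed

lemma recip_in_Finite_image: "recip z \<in> Finite ` S \<longleftrightarrow> z \<noteq> 0 \<and> 1 / z \<in> S"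
  by (auto simp: recip_def)

lemma Finite_in_Finite_image: "Finite z \<in> Finite ` S \<longleftrightarrow> z \<in> S"
  by auto

text \<open>Openness comes from compactness: the two closed unit discs cover the sphere, so the
  complement of \<open>X\<close> is a union of two continuous images of compact sets. The maps
  \<open>c\<close> and \<open>e\<close> are the two charts in either order.\<close>

lemma open_chart_image_aux:
  fixes S T :: "complex set"
  assumes "open S" "open T" "continuous_on UNIV c" "continuous_on UNIV e"
    and c: "\<And>z. c z \<in> X \<longleftrightarrow> z \<in> S" and e: "\<And>z. e z \<in> X \<longleftrightarrow> z \<in> T"
    and cover: "\<And>x. x \<in> c ` cball 0 1 \<union> e ` cball 0 1"
  shows "open (X :: riemann_sphere set)"
proof -
  have "- X = c ` (cball 0 1 - S) \<union> e ` (cball (0::complex) 1 - T)" (is "_ = ?R")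
  proof (intro equalityI subsetI)
    fix x assume x: "x \<in> - X"
    show "x \<in> ?R" using cover[of x] x c e by auto
  next
    fix x assume "x \<in> ?R"
    then show "x \<in> - X" using c e by auto
  qed
  moreover have "compact (c ` (cball 0 1 - S))"
    by (intro compact_continuous_image compact_diff continuous_on_subset[OF assms(3)]) (use assms in auto)
  moreover have "compact (e ` (cball 0 1 - T))"
    by (intro compact_continuous_image compact_diff continuous_on_subset[OF assms(4)]) (use assms in auto)
  ultimately show ?thesis using compact_imp_closed open_closed by (metis closed_Un)
qed

lemma open_Finite_image: "open S \<Longrightarrow> open (Finite ` S)"
  by (rule open_chart_image_aux[of S "{z. z \<noteq> 0 \<and> 1 / z \<in> S}" Finite recip])
    (use sphere_cover in \<open>auto simp: open_inverse_vimage Finite_in_Finite_image recip_in_Finite_image intro: continuous_on_Finite continuous_on_recip\<close>)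

lemma open_recip_image: "open S \<Longrightarrow> open (recip ` S)"
  by (rule open_chart_image_aux[of S "{z. z \<noteq> 0 \<and> 1 / z \<in> S}" recip Finite])
    (use sphere_cover in \<open>auto simp: open_inverse_vimage Finite_in_recip_image recip_in_recip_image intro: continuous_on_Finite continuous_on_recip\<close>)

lemma isCont_transfer: "\<lbrakk>\<forall>\<^sub>F w in nhds z. h w = k w; isCont k z\<rbrakk> \<Longrightarrow> isCont h z"
  by (simp add: isCont_cong)

lemma isCont_chart:
  fixes h :: "riemann_sphere \<Rightarrow> 'a::topological_space" and c :: "complex \<Rightarrow> riemann_sphere"
  assumes "isCont (\<lambda>w. h (c w)) z" and chart: "\<And>S. open S \<Longrightarrow> open (c ` S)"
  shows "isCont h (c z)"
  unfolding continuous_at_open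
proof (intro allI impI)
  fix t assume t: "open t \<and> h (c z) \<in> t"
  then obtain s where "open s" "z \<in> s" "\<forall>w\<in>s. h (c w) \<in> t"
    using assms(1) unfolding continuous_at_open by blast
  then show "\<exists>s. open s \<and> c z \<in> s \<and> (\<forall>x'\<in>s. h x' \<in> t)" using chart by (intro exI[of _ "c ` s"]) auto
qed

lemma open_Finite_vimage: "open W \<Longrightarrow> open {z. Finite z \<in> W}"
  using continuous_open_vimage[of W Finite] isCont_Finite by (simp add: vimage_def)

lemma closed_Finite_vimage: "closed W \<Longrightarrow> closed {z. Finite z \<in> W}"
  using open_Finite_vimage[of "- W"] unfolding closed_def by (simp add: Compl_eq)

lemma open_recip_vimage: "open W \<Longrightarrow> open {z. recip z \<in> W}"
  using continuous_open_vimage[of W recip] isCont_recip by (simp add: vimage_def)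

text \<open>By compactness a frontier point of the image has a preimage in \<open>closure S\<close>.
  Were that preimage in \<open>S\<close>, openness of \<open>h\<close> would make the point
  interior.\<close>

lemma frontier_open_map_subset:
  fixes h :: "'a::metric_space \<Rightarrow> 'b::metric_space"
  assumes "continuous_on UNIV h" "\<And>W. open W \<Longrightarrow> open (h ` W)" "compact (UNIV :: 'a set)" "open S"
  shows "frontier (h ` S) \<subseteq> h ` frontier S"
proof
  fix y assume y: "y \<in> frontier (h ` S)"
  have "compact (closure S)" using compact_Int_closed[OF assms(3)] closed_closure[of S] by simp
  then have "closed (h ` closure S)"
    by (meson assms(1) compact_continuous_image compact_imp_closed continuous_on_subset subset_UNIV)
  then have "closure (h ` S) \<subseteq> h ` closure S" by (intro closure_minimal image_mono closure_subset)
  then obtain x where "x \<in> closure S" "y = h x" using y by (auto simp: frontier_def)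
  moreover have "y \<notin> h ` S" using y assms(2)[OF assms(4)] by (simp add: frontier_def interior_open)
  ultimately show "y \<in> h ` frontier S" using assms(4) by (auto simp: frontier_def interior_open)
qed

lemma connected_subset_if_frontier_disjoint:
  "connected X \<Longrightarrow> X \<inter> frontier S = {} \<Longrightarrow> X \<inter> S \<noteq> {} \<Longrightarrow> X \<subseteq> S"
  using connected_Int_frontier[of X S] by blast

lemma power_open_map:
  assumes "d \<ge> 1" "open W"
  shows "open ((\<lambda>z::complex. z ^ d) ` W)"
proof (rule open_mapping_thm[where S = UNIV])
  show "\<not> (\<lambda>z::complex. z ^ d) constant_on UNIV"
  proof
    assume "(\<lambda>z::complex. z ^ d) constant_on UNIV"
    then obtain c where "\<And>z::complex. z ^ d = c" by (auto simp: constant_on_def)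
    from this[of 0] this[of 1] show False using assms(1) by (simp add: power_0_left)
  qed
qed (use assms in \<open>auto intro!: holomorphic_intros\<close>)

lemma connected_subset_component:
  "\<lbrakk>connected T; T \<subseteq> S; p \<in> T; p \<in> connected_component_set S a\<rbrakk> \<Longrightarrow> T \<subseteq> connected_component_set S a"
  by (metis connected_component_eq connected_component_maximal)

text \<open>The value at \<open>Infinity\<close> is a dummy; the map serves as inverse of the chart
  on sets without \<open>Infinity\<close>.\<close>

fun toC :: "riemann_sphere \<Rightarrow> complex" where
  "toC (Finite z) = z"
| "toC Infinity = 0"

lemma isCont_toC: "isCont toC (Finite z)"
  by (rule isCont_chart) (auto intro: open_Finite_image)

lemma toC_image: "Infinity \<notin> T \<Longrightarrow> toC ` T = {z. Finite z \<in> T}"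
proof (intro equalityI subsetI)
  fix z assume inf: "Infinity \<notin> T"
  {
    assume "z \<in> toC ` T"
    then obtain x where "x \<in> T" "z = toC x" by blast
    then show "z \<in> {z. Finite z \<in> T}" using inf by (cases x) auto
  next
    assume "z \<in> {z. Finite z \<in> T}"
    then show "z \<in> toC ` T" by (intro image_eqI[of _ _ "Finite z"]) auto
  }
qed

lemma continuous_on_toC: "Infinity \<notin> T \<Longrightarrow> continuous_on T toC"
  by (intro continuous_at_imp_continuous_on) (metis isCont_toC riemann_sphere.exhaust)

lemma connected_Finite_vimage: "connected T \<Longrightarrow> Infinity \<notin> T \<Longrightarrow> connected {z. Finite z \<in> T}"
  by (metis connected_continuous_image continuous_on_toC toC_image)

lemma compact_Finite_vimage: "closed T \<Longrightarrow> Infinity \<notin> T \<Longrightarrow> compact {z. Finite z \<in> T}"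
  by (metis compact_continuous_image closed_imp_compact_sphere continuous_on_toC toC_image)

lemma connected_Finite_image: "connected S \<Longrightarrow> connected (Finite ` S)"
  by (intro connected_continuous_image continuous_on_Finite)

lemma closure_Finite_image: "bounded S \<Longrightarrow> closure (Finite ` S) \<subseteq> Finite ` closure S"
  by (intro closure_minimal image_mono closure_subset compact_imp_closed compact_continuous_image continuous_on_Finite)
    (simp add: compact_closure)

text \<open>Boundedness keeps \<open>Infinity\<close> out of the frontier.\<close>

lemma frontier_Finite_image:
  assumes "bounded S"
  shows "frontier (Finite ` S) \<subseteq> Finite ` frontier S"
proof -
  have "Finite ` interior S \<subseteq> interior (Finite ` S)"
    by (intro interior_maximal image_mono interior_subset open_Finite_image) simp
  then show ?thesis using closure_Finite_image[OF assms] unfolding frontier_def by blast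
qed

text \<open>If the two were disjoint, the points of smallest and of largest modulus of the rotated copy would
  connect it to \<open>0\<close> and to \<open>a\<close> within the complement of \<open>C\<close>.\<close>

lemma rotated_continuum_meets:
  fixes C :: "complex set"
  assumes C: "compact C" "connected C" "0 \<notin> C" "C \<subseteq> ball 0 (cmod a)"
    and sep: "\<not> connected_component (- C) 0 a" and \<zeta>: "cmod \<zeta> = 1"
  shows "(\<lambda>z. \<zeta> * z) ` C \<inter> C \<noteq> {}"
proof
  let ?C = "(\<lambda>z. \<zeta> * z) ` C"
  assume disj: "?C \<inter> C = {}"
  have "C \<noteq> {}" using sep by (auto simp: connected_component_def connected_UNIV intro: exI[of _ UNIV])
  have cn: "continuous_on C cmod" by (intro continuous_intros)
  obtain x where x: "x \<in> C" "\<And>z. z \<in> C \<Longrightarrow> cmod z \<le> cmod x"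
    using continuous_attains_sup[OF C(1) \<open>C \<noteq> {}\<close> cn] by blast
  obtain y where y: "y \<in> C" "\<And>z. z \<in> C \<Longrightarrow> cmod y \<le> cmod z"
    using continuous_attains_inf[OF C(1) \<open>C \<noteq> {}\<close> cn] by blast
  have x0: "cmod x > 0" "cmod x < cmod a" using x(1) C(3,4) by auto
  define k where "k = cmod a / cmod x"
  have k: "k > 1" "k * cmod x = cmod a" using x0 by (auto simp: k_def)
  let ?S1 = "closed_segment 0 (\<zeta> * y)" and ?S2 = "closed_segment (\<zeta> * x) (of_real k * (\<zeta> * x))"
  let ?D = "((?S1 \<union> ?C) \<union> ?S2) \<union> sphere 0 (cmod a)"
  have 0: "connected ?C" by (intro connected_continuous_image continuous_intros C)
  have "?S1 \<inter> ?C \<noteq> {}" using y(1) ends_in_segment(2)[of "\<zeta> * y" 0] by blast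
  then have 1: "connected (?S1 \<union> ?C)" by (rule connected_Un[OF connected_segment(1) 0])
  have "(?S1 \<union> ?C) \<inter> ?S2 \<noteq> {}" using x(1) ends_in_segment(1)[of "\<zeta> * x" "of_real k * (\<zeta> * x)"] by blast
  then have 2: "connected ((?S1 \<union> ?C) \<union> ?S2)" by (rule connected_Un[OF 1 connected_segment(1)])
  have "of_real k * (\<zeta> * x) \<in> sphere 0 (cmod a)" using k \<zeta> by (simp add: norm_mult)
  moreover have "connected (sphere (0::complex) (cmod a))" by (intro connected_sphere) simp
  ultimately have "connected ?D"
    using ends_in_segment(2)[of "of_real k * (\<zeta> * x)" "\<zeta> * x"] by (intro connected_Un[OF 2]) auto
  moreover have "?D \<inter> C = {}"
  proof -
    have "?S1 \<inter> C = {}"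
    proof (rule ccontr)
      assume "?S1 \<inter> C \<noteq> {}"
      then obtain u where u: "0 \<le> u" "u \<le> 1" "of_real u * (\<zeta> * y) \<in> C"
        by (auto simp: in_segment scaleR_conv_of_real)
      have "cmod y > 0" using y(1) C(3) by auto
      moreover have "cmod y \<le> u * cmod y" using y(2)[OF u(3)] u \<zeta> by (simp add: norm_mult)
      ultimately have "u = 1" using u by (simp add: mult_le_cancel_right1)
      then show False using u(3) y(1) disj by auto
    qed
    moreover have "?S2 \<inter> C = {}"
    proof (rule ccontr)
      assume "?S2 \<inter> C \<noteq> {}"
      then obtain u where u: "0 \<le> u" "u \<le> 1" "(1 - u) *\<^sub>R (\<zeta> * x) + u *\<^sub>R (of_real k * (\<zeta> * x)) \<in> C"
        by (auto simp: in_segment)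
      have e: "(1 - u) *\<^sub>R (\<zeta> * x) + u *\<^sub>R (of_real k * (\<zeta> * x)) = of_real (1 + u * (k - 1)) * (\<zeta> * x)"
        by (simp add: scaleR_conv_of_real algebra_simps)
      have p: "1 + u * (k - 1) \<ge> 1" using u k by simp
      have "cmod (of_real (1 + u * (k - 1)) * (\<zeta> * x)) = (1 + u * (k - 1)) * cmod x"
        using p \<zeta> unfolding norm_mult norm_of_real by simp
      then have "(1 + u * (k - 1)) * cmod x \<le> cmod x" using x(2)[OF u(3)] unfolding e by simp
      then have "u * (k - 1) \<le> 0" using x0 by (simp add: mult_le_cancel_right2)
      then have "u = 0" using u k by (simp add: mult_le_0_iff)
      then show False using u(3) x(1) disj by auto
    qed
    moreover have "sphere 0 (cmod a) \<inter> C = {}" using C(4) by auto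
    ultimately show ?thesis using disj by blast
  qed
  moreover have "0 \<in> ?D" "a \<in> ?D" by auto
  ultimately have "connected_component (- C) 0 a" unfolding connected_component_def by blast
  then show False using sep by blast
qed

section \<open>Normal families and separation of closed sets\<close>

text \<open>\<open>normal_family_on\<close> quantifies over arbitrary sequences of iterates, whose
  exponents need not increase; these are the two cases to treat.\<close>

lemma subseq_const_or_at_top:
  fixes m :: "nat \<Rightarrow> nat"
  obtains r :: "nat \<Rightarrow> nat" and c where "strict_mono r" "\<And>k. m (r k) = c"
  | "filterlim m at_top sequentially"
proof (cases "\<exists>c. infinite {k. m k = c}")
  case True
  then obtain c where c: "infinite {k. m k = c}" by blast
  have "m (enumerate {k. m k = c} k) = c" for k using enumerate_in_set[OF c, of k] by simp
  then show ?thesis using that(1)[OF strict_mono_enumerate[OF c]] by blast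
next
  case False
  have "\<forall>\<^sub>F k in sequentially. N \<le> m k" for N
  proof -
    have "{k. \<not> N \<le> m k} = (\<Union>c<N. {k. m k = c})" by auto
    then have "finite {k. \<not> N \<le> m k}" using False by auto
    then show ?thesis unfolding cofinite_eq_sequentially[symmetric] eventually_cofinite .
  qed
  then have "filterlim m at_top sequentially" by (simp add: filterlim_at_top)
  then show ?thesis by (rule that(2))
qed

lemma normal_family_onI:
  fixes h :: "nat \<Rightarrow> 'a::metric_space \<Rightarrow> 'b::metric_space"
  assumes "\<And>m :: nat \<Rightarrow> nat. (\<exists>g. \<forall>Q. compact Q \<and> Q \<subseteq> W \<longrightarrow> uniform_limit Q (\<lambda>k. h (m k)) g sequentially) \<or>
     (\<exists>r g. strict_mono (r :: nat \<Rightarrow> nat) \<and> (\<forall>Q. compact Q \<and> Q \<subseteq> W \<longrightarrow> uniform_limit Q (\<lambda>k. h (m (r k))) g sequentially))"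
  shows "normal_family_on W (range h)"
  unfolding normal_family_on_def
proof (intro allI impI)
  fix s :: "nat \<Rightarrow> 'a \<Rightarrow> 'b" assume "range s \<subseteq> range h"
  then have "\<forall>k. \<exists>m. s k = h m" by blast
  then obtain m where m: "\<And>k. s k = h (m k)" by metis
  have s: "s \<circ> r = (\<lambda>k. h (m (r k)))" for r by (simp add: fun_eq_iff m)
  show "\<exists>r g. strict_mono r \<and> (\<forall>K. compact K \<and> K \<subseteq> W \<longrightarrow> uniform_limit K (s \<circ> r) g sequentially)"
    using assms[of m] unfolding s
  proof
    assume "\<exists>g. \<forall>Q. compact Q \<and> Q \<subseteq> W \<longrightarrow> uniform_limit Q (\<lambda>k. h (m k)) g sequentially"
    then show "\<exists>r g. strict_mono r \<and> (\<forall>K. compact K \<and> K \<subseteq> W \<longrightarrow> uniform_limit K (\<lambda>k. h (m (r k))) g sequentially)"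
      by (intro exI[of _ "\<lambda>k. k"]) (auto simp: strict_mono_def)
  qed
qed

text \<open>The points strictly closer to \<open>T\<close> than to \<open>D\<close> serve: their
  frontier consists of equidistant points, which lie in neither set. Both sets are required to be
  nonempty because \<open>infdist\<close> to the empty set is 0.\<close>

lemma separate_closed_by_open:
  fixes T D :: "'a::metric_space set"
  assumes cl: "closed T" "closed D" and disj: "T \<inter> D = {}" and ne: "T \<noteq> {}" "D \<noteq> {}"
  obtains S where "open S" "T \<subseteq> S" "S \<inter> D = {}" "frontier S \<inter> (T \<union> D) = {}"
proof -
  define S where "S = {x. infdist x T < infdist x D}"
  have oS: "open S" unfolding S_def by (intro open_Collect_less continuous_intros)
  have posT: "infdist x D > 0" if "x \<in> T" for x
    using in_closed_iff_infdist_zero[OF cl(2) ne(2), of x] that disj infdist_nonneg[of x D] by fastforce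
  have posD: "infdist x T > 0" if "x \<in> D" for x
    using in_closed_iff_infdist_zero[OF cl(1) ne(1), of x] that disj infdist_nonneg[of x T] by fastforce
  have "closure S \<subseteq> {x. infdist x T \<le> infdist x D}"
    by (intro closure_minimal closed_Collect_le continuous_intros) (auto simp: S_def)
  then have fr: "infdist x T = infdist x D" if "x \<in> frontier S" for x
    using that oS by (auto simp: frontier_def interior_open S_def)
  have "x \<notin> T \<union> D" if "x \<in> frontier S" for x
    using fr[OF that] posT[of x] posD[of x] by auto
  moreover have "T \<subseteq> S" "S \<inter> D = {}" using posT posD by (fastforce simp: S_def)+
  ultimately show ?thesis using oS that by blast
qed

text \<open>In a compact Hausdorff space components and quasi-components agree, so relatively clopen
  sets cut \<open>a\<close> off from \<open>p\<close> and from \<open>q\<close>. Their intersection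
  is thickened to an open set by \<open>separate_closed_by_open\<close>.\<close>

lemma clopen_separation:
  fixes X :: "'a::metric_space set"
  assumes X: "compact X" "a \<in> X" and p: "p \<in> X" "\<And>C. \<lbrakk>connected C; C \<subseteq> X; a \<in> C\<rbrakk> \<Longrightarrow> p \<notin> C"
    and q: "q \<in> X" "\<And>C. \<lbrakk>connected C; C \<subseteq> X; a \<in> C\<rbrakk> \<Longrightarrow> q \<notin> C"
  obtains S where "open S" "a \<in> S" "p \<notin> S" "q \<notin> S" "frontier S \<inter> X = {}"
proof -
  let ?X = "top_of_set X"
  have qc: "quasi_component_of ?X a = connected_component_of ?X a"
    by (rule quasi_eq_connected_component_of) (use X(1) in \<open>auto simp: compact_space_subtopology Hausdorff_space_subtopology\<close>)
  have clopen: "\<exists>T. closedin ?X T \<and> openin ?X T \<and> a \<in> T \<and> p \<notin> T"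
    if p: "p \<in> X" "\<And>C. \<lbrakk>connected C; C \<subseteq> X; a \<in> C\<rbrakk> \<Longrightarrow> p \<notin> C" for p
  proof -
    have "\<not> connected_component_of ?X a p"
      using p(2) by (auto simp: connected_component_of_def connectedin_subtopology)
    then have "\<not> quasi_component_of ?X a p" using qc by simp
    then obtain T where T: "closedin ?X T" "openin ?X T" "\<not> (a \<in> T \<longleftrightarrow> p \<in> T)"
      using X(2) p(1) unfolding quasi_component_of_def by auto
    show ?thesis
    proof (cases "a \<in> T")
      case True
      then show ?thesis using T by blast
    next
      case False
      have "closedin ?X (X - T)" "openin ?X (X - T)"
        using T(1,2) by (metis closedin_diff closedin_topspace topspace_euclidean_subtopology, metis openin_diff openin_topspace topspace_euclidean_subtopology)
      moreover have "a \<in> X - T" "p \<notin> X - T" using False T(3) X(2) by auto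
      ultimately show ?thesis by blast
    qed
  qed
  obtain T1 where T1: "closedin ?X T1" "openin ?X T1" "a \<in> T1" "p \<notin> T1" using clopen[OF p] by blast
  obtain T2 where T2: "closedin ?X T2" "openin ?X T2" "a \<in> T2" "q \<notin> T2" using clopen[OF q] by blast
  define T where "T = T1 \<inter> T2"
  have T: "closedin ?X T" "openin ?X T" "a \<in> T" "p \<notin> T" "q \<notin> T"
    using T1 T2 by (auto simp: T_def openin_Int)
  have cX: "closed X" using X(1) by (rule compact_imp_closed)
  have cT: "closed T" using T(1) cX by (metis closedin_closed_trans)
  have "closedin ?X (X - T)" using T(2) by (metis closedin_diff closedin_topspace topspace_euclidean_subtopology)
  then have cD: "closed (X - T)" using cX by (metis closedin_closed_trans)
  have "T \<inter> (X - T) = {}" "T \<noteq> {}" "X - T \<noteq> {}" using T(3,4) p(1) by auto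
  then obtain S where S: "open S" "T \<subseteq> S" "S \<inter> (X - T) = {}" "frontier S \<inter> (T \<union> (X - T)) = {}"
    by (rule separate_closed_by_open[OF cT cD])
  then show ?thesis using that[of S] T(3-5) p(1) q(1) by blast
qed

lemma frontier_Compl_closure_subset: "frontier (- closure S) \<subseteq> frontier S"
  using interior_mono[OF closure_subset[of S]] by (auto simp: frontier_def closure_complement interior_complement)

lemma tendsto_uniform_limit_moving:
  fixes h :: "nat \<Rightarrow> complex \<Rightarrow> complex"
  assumes "uniform_limit (cball y \<rho>) h \<eta> sequentially" "\<rho> > 0" "u \<longlonglongrightarrow> y" "isCont \<eta> y"
  shows "(\<lambda>k. h k (u k)) \<longlonglongrightarrow> \<eta> y"
proof (rule tendstoI)
  fix e :: real assume e: "e > 0"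
  have 1: "\<forall>\<^sub>F k in sequentially. \<forall>z\<in>cball y \<rho>. dist (h k z) (\<eta> z) < e / 2"
    using assms(1) e by (intro uniform_limitD) auto
  have "(\<lambda>k. \<eta> (u k)) \<longlonglongrightarrow> \<eta> y" using assms(3,4) isCont_tendsto_compose by blast
  then have 2: "\<forall>\<^sub>F k in sequentially. dist (\<eta> (u k)) (\<eta> y) < e / 2" using e by (intro tendstoD) auto
  have 3: "\<forall>\<^sub>F k in sequentially. dist (u k) y < \<rho>" using assms(2,3) by (intro tendstoD)
  show "\<forall>\<^sub>F k in sequentially. dist (h k (u k)) (\<eta> y) < e" using 1 2 3
  proof eventually_elim
    case (elim k)
    have "dist (h k (u k)) (\<eta> (u k)) < e / 2" using elim(1,3) by (auto simp: dist_commute)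
    then show ?case using elim(2) dist_triangle[of "h k (u k)" "\<eta> y" "\<eta> (u k)"] by linarith
  qed
qed

section \<open>The map and its inverse branches\<close>

locale diamond =
  fixes d :: nat and lam :: complex
  assumes d: "d \<ge> 2" and lam: "lam \<noteq> 0"
begin

text \<open>At the pole 1 this takes the dummy value 0, so \<open>f\<close> describes
  \<open>F\<close> only on orbits that avoid 1.\<close>

definition f :: "complex \<Rightarrow> complex" where
  "f z = ((z + lam - 1) / (z - 1)) ^ d"

fun msp :: "riemann_sphere \<Rightarrow> riemann_sphere" where
  "msp (Finite z) = (if z = 1 then Infinity else Finite ((z + lam - 1) / (z - 1)))"
| "msp Infinity = Finite 1"

fun psp :: "riemann_sphere \<Rightarrow> riemann_sphere" where
  "psp (Finite z) = Finite (z ^ d)"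
| "psp Infinity = Infinity"

definition F :: "riemann_sphere \<Rightarrow> riemann_sphere" where
  "F x = psp (msp x)"

lemma moebius_ne_1: "z \<noteq> 1 \<Longrightarrow> (z + lam - 1) / (z - 1) \<noteq> 1"
  using lam by (auto simp: field_simps)

lemma moebius_invol: "z \<noteq> 1 \<Longrightarrow> ((z + lam - 1) / (z - 1) + lam - 1) / ((z + lam - 1) / (z - 1) - 1) = z"
  using lam moebius_ne_1[of z] by (simp add: divide_simps) (simp add: algebra_simps)

lemma msp_msp [simp]: "msp (msp x) = x"
proof (cases x)
  case (Finite z)
  then show ?thesis using moebius_ne_1[of z] moebius_invol[of z] by auto
qed auto

lemma F_Finite [simp]: "z \<noteq> 1 \<Longrightarrow> F (Finite z) = Finite (f z)"
  and F_1 [simp]: "F (Finite 1) = Infinity"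
  and F_Infinity [simp]: "F Infinity = Finite 1"
  by (auto simp: F_def f_def)

lemma F_eq_Infinity_iff: "F x = Infinity \<longleftrightarrow> x = Finite 1"
  by (cases x) (metis F_1 F_Finite riemann_sphere.distinct(1), simp)

lemma isCont_msp: "isCont msp x"
proof (cases x)
  case (Finite z)
  have "isCont (\<lambda>w. msp (Finite w)) z"
  proof (cases "z = 1")
    case False
    have "\<forall>\<^sub>F w in nhds z. w \<in> - {1}" using False by (intro eventually_nhds_in_open) auto
    then have "\<forall>\<^sub>F w in nhds z. msp (Finite w) = Finite ((w + lam - 1) / (w - 1))"
      by eventually_elim auto
    moreover have "isCont (\<lambda>w. Finite ((w + lam - 1) / (w - 1))) z"
      using False by (intro isCont_o2[OF _ isCont_Finite] continuous_intros) auto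
    ultimately show ?thesis by (rule isCont_transfer)
  next
    case True
    have "\<forall>\<^sub>F w in nhds z. w \<in> - {1 - lam}" using True lam by (intro eventually_nhds_in_open) auto
    then have "\<forall>\<^sub>F w in nhds z. msp (Finite w) = recip ((w - 1) / (w + lam - 1))"
      by eventually_elim (auto simp: recip_def algebra_simps)
    moreover have "isCont (\<lambda>w. recip ((w - 1) / (w + lam - 1))) z"
      using True lam by (intro isCont_o2[OF _ isCont_recip] continuous_intros) auto
    ultimately show ?thesis by (rule isCont_transfer)
  qed
  then show ?thesis unfolding Finite by (rule isCont_chart) (rule open_Finite_image)
next
  case Infinity
  have "\<forall>\<^sub>F w in nhds 0. w \<in> - {1::complex}" by (intro eventually_nhds_in_open) auto
  then have "\<forall>\<^sub>F w in nhds 0. msp (recip w) = Finite ((1 + (lam - 1) * w) / (1 - w))"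
    by eventually_elim (auto simp: recip_def divide_simps, auto simp: algebra_simps)
  moreover have "isCont (\<lambda>w. Finite ((1 + (lam - 1) * w) / (1 - w))) 0"
    by (intro isCont_o2[OF _ isCont_Finite] continuous_intros) auto
  ultimately have "isCont (\<lambda>w. msp (recip w)) 0" by (rule isCont_transfer)
  then have "isCont msp (recip 0)" by (rule isCont_chart) (rule open_recip_image)
  then show ?thesis using Infinity by simp
qed

lemma psp_recip: "psp (recip w) = recip (w ^ d)"
  using d by (auto simp: recip_def power_divide)

lemma isCont_psp: "isCont psp x"
proof (cases x)
  case (Finite z)
  have "isCont (\<lambda>w. psp (Finite w)) z"
    by (simp, intro isCont_o2[OF _ isCont_Finite] continuous_intros)
  then show ?thesis unfolding Finite by (rule isCont_chart) (rule open_Finite_image)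
next
  case Infinity
  have "isCont (\<lambda>w. psp (recip w)) 0" unfolding psp_recip
    by (intro isCont_o2[OF _ isCont_recip] continuous_intros)
  then have "isCont psp (recip 0)" by (rule isCont_chart) (rule open_recip_image)
  then show ?thesis using Infinity by simp
qed

lemma isCont_F: "isCont F x"
  unfolding F_def by (intro isCont_o2[OF isCont_msp isCont_psp])

lemma continuous_F: "continuous_on S F"
  by (simp add: continuous_at_imp_continuous_on isCont_F)

lemma continuous_msp: "continuous_on S msp"
  by (simp add: continuous_at_imp_continuous_on isCont_msp)

lemma open_F:
  assumes "open W"
  shows "open (F ` W)"
proof -
  \<comment> \<open>As \<open>msp\<close> is an involution, its images are preimages.\<close>
  have "msp ` W = msp -` W" by (auto simp: image_iff) (metis msp_msp)
  then have W: "open (msp ` W)" using continuous_open_vimage[OF assms isCont_msp] by simp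
  let ?W = "msp ` W"
  have "psp ` ?W = Finite ` ((\<lambda>z. z ^ d) ` {z. Finite z \<in> ?W}) \<union> recip ` ((\<lambda>z. z ^ d) ` {z. recip z \<in> ?W})" (is "?L = ?R")
  proof (intro equalityI subsetI)
    fix y assume "y \<in> ?L"
    then obtain x where x: "x \<in> ?W" "y = psp x" by blast
    show "y \<in> ?R" by (cases x rule: sphere_cases) (use x psp_recip in auto)
  next
    fix y assume "y \<in> ?R"
    then show "y \<in> ?L" using psp_recip psp.simps(1) by (smt (verit) UnE image_iff mem_Collect_eq)
  qed
  moreover have "open ?R"
    using W d by (intro open_Un open_Finite_image open_recip_image power_open_map open_Finite_vimage open_recip_vimage) auto
  moreover have "F ` W = psp ` ?W" by (auto simp: F_def)
  ultimately show ?thesis by simp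
qed

lemma continuous_funpow_F: "continuous_on S (F ^^ n)"
proof (induction n)
  case (Suc n)
  have "continuous_on S (F \<circ> (F ^^ n))" by (intro continuous_on_compose Suc continuous_F)
  then show ?case by simp
qed (simp add: id_def)

lemma open_funpow_F: "open W \<Longrightarrow> open ((F ^^ n) ` W)"
proof (induction n)
  case (Suc n)
  then have "open (F ` ((F ^^ n) ` W))" by (intro open_F)
  then show ?case by (simp add: image_comp)
qed simp

lemma frontier_F: "open S \<Longrightarrow> frontier (F ` S) \<subseteq> F ` frontier S"
  by (intro frontier_open_map_subset continuous_F open_F compact_UNIV_sphere)

lemma frontier_funpow_F: "open S \<Longrightarrow> frontier ((F ^^ n) ` S) \<subseteq> (F ^^ n) ` frontier S"
  by (intro frontier_open_map_subset continuous_funpow_F open_funpow_F compact_UNIV_sphere)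

lemma closed_F: "closed S \<Longrightarrow> closed (F ` S)"
  by (simp add: closed_imp_compact_sphere compact_continuous_image compact_imp_closed continuous_F)

lemma U_map_eq: "U_map d lam = F \<circ> F"
proof
  fix x
  have c: "lam - 1 + z = z + lam - 1" for z by simp
  show "U_map d lam x = (F \<circ> F) x"
  proof (cases x)
    case (Finite z)
    have num: "poly (U_num d lam) z = ((z + lam - 1) ^ d + (lam - 1) * (z - 1) ^ d) ^ d"
      and den: "poly (U_den d lam) z = ((z + lam - 1) ^ d - (z - 1) ^ d) ^ d"
      by (auto simp: U_num_def U_den_def c)
    show ?thesis
    proof (cases "z = 1")
      case True
      then show ?thesis using lam d Finite num den by (simp add: U_map_def power_0_left)
    next
      case False
      have fz: "f z = (z + lam - 1) ^ d / (z - 1) ^ d" by (simp add: f_def power_divide)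
      have "f z = 1 \<longleftrightarrow> (z + lam - 1) ^ d = (z - 1) ^ d" unfolding fz using False by (simp add: field_simps)
      moreover have "f (f z) = (((z + lam - 1) ^ d + (lam - 1) * (z - 1) ^ d) / ((z + lam - 1) ^ d - (z - 1) ^ d)) ^ d"
        if "f z \<noteq> 1"
      proof -
        have "(f z + lam - 1) / (f z - 1) = ((z + lam - 1) ^ d + (lam - 1) * (z - 1) ^ d) / ((z + lam - 1) ^ d - (z - 1) ^ d)"
          unfolding fz using False that[unfolded fz] by (simp add: divide_simps) (simp add: algebra_simps)
        then show ?thesis by (simp add: f_def[of "f z"])
      qed
      ultimately show ?thesis using False Finite d
        by (cases "f z = 1") (auto simp: U_map_def num den power_divide)
    qed
  next
    case Infinity
    have deg: "degree ([:c, 1:] ^ d) = d" "coeff ([:c, 1:] ^ d) d = 1" for c :: complex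
    proof -
      show *: "degree ([:c, 1:] ^ d) = d" by (simp add: degree_power_eq)
      show "coeff ([:c, 1:] ^ d) d = 1" using lead_coeff_power[of "[:c, 1:]" d] unfolding * by simp
    qed
    let ?a = "[:lam - 1, 1:] ^ d + smult (lam - 1) ([:-1, 1:] ^ d)" and ?b = "[:lam - 1, 1:] ^ d - [:-1, 1:] ^ d"
    \<comment> \<open>At \<open>Infinity\<close> degrees are compared: the numerator keeps the
      coefficient \<open>lam\<close> in degree \<open>d\<close>, while the two monic powers in the
      denominator cancel there.\<close>
    have "coeff ?a d = lam" by (simp add: deg)
    then have a: "degree ?a \<ge> d" using lam by (intro le_degree) auto
    have "degree ?b \<le> d" by (intro degree_diff_le) (simp_all add: deg)
    moreover have "coeff ?b d = 0" by (simp add: deg)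
    ultimately have b: "degree ?b < d"
      using d by (metis eq_zero_or_degree_less degree_0 leD le_neq_implies_less not_numeral_le_zero not_gr_zero)
    have "degree (U_den d lam) \<le> degree ?b * d" unfolding U_den_def by (rule degree_power_le)
    also have "\<dots> < d * d" using b d by simp
    also have "\<dots> \<le> degree ?a * d" using a by simp
    also have "\<dots> = degree (U_num d lam)" unfolding U_num_def
      using a d by (subst degree_power_eq) (auto simp: mult.commute)
    finally show ?thesis using Infinity by (simp add: U_map_def)
  qed
qed

section \<open>Trapping neighbourhoods of 1 and infinity, and periodic points\<close>

lemma norm_power_minus_1:
  fixes u :: complex
  assumes "cmod u \<le> 1"
  shows "cmod ((1 + u) ^ n - 1) \<le> (2 ^ n - 1) * cmod u"
proof (induction n)
  case (Suc n)
  have "cmod (1 + u) \<le> 2" using assms norm_triangle_ineq[of 1 u] by simp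
  have "(1 + u) ^ Suc n - 1 = (1 + u) * ((1 + u) ^ n - 1) + u" by (simp add: algebra_simps)
  then have "cmod ((1 + u) ^ Suc n - 1) \<le> cmod (1 + u) * cmod ((1 + u) ^ n - 1) + cmod u"
    by (metis norm_mult norm_triangle_ineq)
  also have "\<dots> \<le> 2 * ((2 ^ n - 1) * cmod u) + cmod u"
    using \<open>cmod (1 + u) \<le> 2\<close> Suc by (intro add_mono mult_mono) auto
  finally show ?case by (simp add: algebra_simps)
qed simp

text \<open>With \<open>u = lam / (z - 1)\<close> the Moebius factor is \<open>1 + u\<close>, so
  \<open>f z - 1\<close> is of order \<open>1 / z\<close> at infinity. Near 1 the map has a pole of
  order \<open>d\<close>, at least 2, so the second iterate grows at least quadratically, which
  beats the required factor 2.\<close>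

lemma trap_exists:
  obtains R \<epsilon> where "1 + \<epsilon> < R" "0 < \<epsilon>"
    "\<And>z. R \<le> cmod z \<Longrightarrow> cmod (f z - 1) < \<epsilon>"
    "\<And>y. cmod (y - 1) < \<epsilon> \<Longrightarrow> y \<noteq> 1 \<Longrightarrow> R < cmod (f y)"
    "\<And>z. R \<le> cmod z \<Longrightarrow> f z \<noteq> 1 \<Longrightarrow> 2 * cmod z \<le> cmod (f (f z))"
proof -
  \<comment> \<open>\<open>C / cmod z\<close> will bound \<open>cmod (f z - 1)\<close>: the 2 comes
    from \<open>cmod (z - 1) \<ge> cmod z / 2\<close>, the power from
    \<open>norm_power_minus_1\<close>.\<close>
  define C where "C = 2 * cmod lam * 2 ^ d"
  have C: "C > 0" using lam by (simp add: C_def)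
  \<comment> \<open>Chosen so that the lower bound for the second iterate becomes
    \<open>(c * cmod z)\<^sup>2\<close>; with \<open>\<epsilon> = 2 * C / R\<close> also
    \<open>cmod lam / (2 * \<epsilon>)\<close> equals \<open>c * R\<close>.\<close>
  define c where "c = cmod lam / (4 * C)"
  have c: "c > 0" using lam C by (simp add: c_def)
  \<comment> \<open>The first two summands serve the bound on \<open>lam / (z - 1)\<close>; the
    others serve \<open>\<epsilon> \<le> cmod lam / 2\<close>, the inequality \<open>lin\<close> and
    \<open>\<epsilon> \<le> 1\<close>, in this order.\<close>
  define R where "R = 3 + 2 * cmod lam + 1 / c + 3 / c\<^sup>2 + 2 * C"
  define \<epsilon> where "\<epsilon> = 2 * C / R"
  have R: "R \<ge> 3" "R \<ge> 2 * cmod lam" "R \<ge> 1 / c" "R \<ge> 3 / c\<^sup>2" "R \<ge> 2 * C"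
    using c C unfolding R_def by (auto simp: add_nonneg_nonneg)
  have \<epsilon>0: "\<epsilon> > 0" using C R by (simp add: \<epsilon>_def)
  have "\<epsilon> \<le> 1" using R C by (simp add: \<epsilon>_def)
  then have 1: "1 + \<epsilon> < R" using R by simp
  have fz: "cmod (f z - 1) \<le> C / cmod z" if "R \<le> cmod z" for z
  proof -
    have z: "cmod z \<ge> 3" "cmod z \<ge> 2 * cmod lam" using that R by auto
    have "cmod (z - 1) \<ge> cmod z - 1" using norm_triangle_ineq2[of z 1] by simp
    then have z1: "cmod (z - 1) \<ge> cmod z / 2" using z by simp
    then have ne: "z \<noteq> 1" using z by auto
    let ?u = "lam / (z - 1)"
    have "cmod ?u \<le> cmod lam / (cmod z / 2)" unfolding norm_divide using z1 z by (intro divide_left_mono mult_pos_pos) (linarith | simp)+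
    then have u: "cmod ?u \<le> 2 * cmod lam / cmod z" by (simp add: mult.commute)
    also have "\<dots> \<le> 1" using z by (simp add: divide_le_eq)
    finally have u1: "cmod ?u \<le> 1" .
    have "(z + lam - 1) / (z - 1) = 1 + ?u" using ne by (simp add: field_simps)
    then have "cmod (f z - 1) \<le> (2 ^ d - 1) * cmod ?u" using norm_power_minus_1[OF u1, of d] by (simp add: f_def)
    also have "\<dots> \<le> 2 ^ d * (2 * cmod lam / cmod z)" using u by (intro mult_mono) auto
    finally show ?thesis by (simp add: C_def mult_ac)
  qed
  have fy: "(cmod lam / (2 * cmod (y - 1)))\<^sup>2 \<le> cmod (f y)" if "cmod (y - 1) \<le> cmod lam / 2" "y \<noteq> 1" for y
  proof -
    have y: "cmod (y - 1) > 0" using that by simp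
    have "y + lam - 1 = (y - 1) + lam" by simp
    then have "cmod (y + lam - 1) \<ge> cmod lam - cmod (y - 1)"
      by (metis add.commute diff_ge_0_iff_ge norm_diff_ineq)
    then have "cmod (y + lam - 1) \<ge> cmod lam / 2" using that by simp
    then have r: "cmod lam / (2 * cmod (y - 1)) \<le> cmod ((y + lam - 1) / (y - 1))"
      unfolding norm_divide using y by (simp add: field_simps)
    moreover have "1 \<le> cmod lam / (2 * cmod (y - 1))" using that y by (simp add: field_simps)
    ultimately have "(cmod lam / (2 * cmod (y - 1)))\<^sup>2 \<le> (cmod ((y + lam - 1) / (y - 1))) ^ 2"
      "(cmod ((y + lam - 1) / (y - 1))) ^ 2 \<le> (cmod ((y + lam - 1) / (y - 1))) ^ d"
      using d by (auto intro!: power_mono power_increasing)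
    then show ?thesis unfolding f_def norm_power by (rule order_trans)
  qed
  have small: "\<epsilon> \<le> cmod lam / 2"
  proof -
    have "1 / c \<le> R" by (rule R)
    then have "4 * C / cmod lam \<le> R" using lam C by (simp add: c_def)
    then have "4 * C \<le> R * cmod lam" using lam by (simp add: divide_le_eq)
    then show ?thesis using R by (simp add: \<epsilon>_def field_simps)
  qed
  have 2: "cmod (f z - 1) < \<epsilon>" if "R \<le> cmod z" for z
  proof -
    have "C / cmod z \<le> C / R" using that R C by (intro divide_left_mono mult_pos_pos; linarith)
    also have "\<dots> < \<epsilon>" using C R by (simp add: \<epsilon>_def divide_strict_right_mono)
    finally show ?thesis using fz[OF that] by simp
  qed
  have lin: "c\<^sup>2 * x\<^sup>2 \<ge> 3 * x" if "x \<ge> R" for x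
  proof -
    have "3 / c\<^sup>2 \<le> x" using R that by linarith
    then have "c\<^sup>2 * x \<ge> 3" using c by (simp add: divide_le_eq mult.commute)
    then have "c\<^sup>2 * x * x \<ge> 3 * x" using that R by (intro mult_right_mono) auto
    then show ?thesis by (simp add: power2_eq_square mult_ac)
  qed
  have 3: "R < cmod (f y)" if "cmod (y - 1) < \<epsilon>" "y \<noteq> 1" for y
  proof -
    have "R < 3 * R" using R by simp
    also have "\<dots> \<le> (c * R)\<^sup>2" using lin[of R] by (simp add: power_mult_distrib)
    also have "c * R = cmod lam / (2 * \<epsilon>)" using C R by (simp add: c_def \<epsilon>_def)
    also have "(cmod lam / (2 * \<epsilon>))\<^sup>2 \<le> (cmod lam / (2 * cmod (y - 1)))\<^sup>2"
      using that \<epsilon>0 by (intro power_mono divide_left_mono) (auto intro: mult_pos_pos)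
    also have "\<dots> \<le> cmod (f y)" using that small by (intro fy) auto
    finally show ?thesis .
  qed
  have 4: "2 * cmod z \<le> cmod (f (f z))" if "R \<le> cmod z" "f z \<noteq> 1" for z
  proof -
    have z: "cmod z > 0" using that(1) R(1) by linarith
    have "2 * cmod z \<le> 3 * cmod z" by simp
    also have "\<dots> \<le> (c * cmod z)\<^sup>2" using lin[of "cmod z"] that by (simp add: power_mult_distrib)
    also have "\<dots> \<le> (cmod lam / (2 * cmod (f z - 1)))\<^sup>2"
    proof (rule power_mono)
      have p: "cmod (f z - 1) > 0" using that by simp
      have "c * cmod z = cmod lam / (4 * (C / cmod z))" using z by (simp add: c_def)
      also have "\<dots> \<le> cmod lam / (4 * cmod (f z - 1))"
        using fz[OF that(1)] p z C by (intro divide_left_mono) (auto intro!: mult_pos_pos)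
      also have "\<dots> \<le> cmod lam / (2 * cmod (f z - 1))" using p by (intro divide_left_mono) (auto intro!: mult_pos_pos)
      finally show "c * cmod z \<le> cmod lam / (2 * cmod (f z - 1))" .
    qed (use c in auto)
    also have "\<dots> \<le> cmod (f (f z))" using 2[OF that(1)] small that by (intro fy) auto
    finally show ?thesis .
  qed
  show ?thesis by (rule that[OF 1 \<epsilon>0 2 3 4])
qed

text \<open>An equality \<open>(F ^^ m) x = x\<close> at infinitely many finite points would make
  \<open>a ^ d = X * b ^ d\<close> for two nonzero polynomials, impossible modulo \<open>d\<close> in the degree.\<close>

primrec fpol :: "nat \<Rightarrow> complex poly \<times> complex poly" where
  "fpol 0 = ([:0, 1:], 1)"
| "fpol (Suc n) = ((fst (fpol n) + smult (lam - 1) (snd (fpol n))) ^ d, (fst (fpol n) - snd (fpol n)) ^ d)"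

lemma funpow_f_poly:
  assumes "\<And>j. j < n \<Longrightarrow> (f ^^ j) x \<noteq> 1"
  shows "poly (snd (fpol n)) x \<noteq> 0 \<and> (f ^^ n) x = poly (fst (fpol n)) x / poly (snd (fpol n)) x"
  using assms
proof (induction n)
  case (Suc n)
  let ?P = "poly (fst (fpol n)) x" and ?Q = "poly (snd (fpol n)) x"
  have IH: "?Q \<noteq> 0" "(f ^^ n) x = ?P / ?Q" using Suc by auto
  have ne: "?P / ?Q \<noteq> 1" using Suc.prems[of n] IH by auto
  then have "?P - ?Q \<noteq> 0" using IH by auto
  moreover have "(?P / ?Q + lam - 1) / (?P / ?Q - 1) = (?P + (lam - 1) * ?Q) / (?P - ?Q)"
    using IH ne by (simp add: divide_simps) (simp add: algebra_simps)
  ultimately show ?case using IH by (simp add: f_def[of "?P / ?Q"] power_divide)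
qed simp

lemma finite_periodic_points:
  assumes "m > 0"
  shows "finite {x. (f ^^ m) x = x \<and> (\<forall>j<m. (f ^^ j) x \<noteq> 1)}" (is "finite ?S")
proof (rule ccontr)
  assume inf: "infinite ?S"
  obtain n where m: "m = Suc n" using assms gr0_conv_Suc by blast
  let ?a = "fst (fpol n) + smult (lam - 1) (snd (fpol n))" and ?b = "fst (fpol n) - snd (fpol n)"
  have eq: "poly (snd (fpol m)) x \<noteq> 0" "poly (fst (fpol m)) x = x * poly (snd (fpol m)) x" if "x \<in> ?S" for x
    using funpow_f_poly[of m x] that by (auto simp: field_simps)
  have "?S \<subseteq> {x. poly (fst (fpol m) - [:0, 1:] * snd (fpol m)) x = 0}" using eq(2) by auto
  then have "fst (fpol m) - [:0, 1:] * snd (fpol m) = 0"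
    using poly_roots_finite inf finite_subset by blast
  then have e: "?a ^ d = [:0, 1:] * ?b ^ d" by (simp add: m)
  obtain x where "x \<in> ?S" using infinite_imp_nonempty[OF inf] by blast
  then have "poly (snd (fpol m)) x \<noteq> 0" by (rule eq(1))
  then have "snd (fpol m) \<noteq> 0" by (metis poly_0)
  then have b: "?b \<noteq> 0" using d by (auto simp: m power_0_left)
  have "?b ^ d \<noteq> 0" using b by simp
  then have "degree ([:0, 1:] * ?b ^ d) = 1 + d * degree ?b"
    using b by (subst degree_mult_eq) (auto simp: degree_power_eq mult.commute)
  moreover have "?a \<noteq> 0"
  proof
    assume "?a = 0"
    then have "?a ^ d = 0" using d by (simp add: power_0_left)
    then show False using e \<open>?b ^ d \<noteq> 0\<close> by (metis mult_eq_0_iff pCons_eq_0_iff zero_neq_one)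
  qed
  then have "degree (?a ^ d) = d * degree ?a" by (simp add: degree_power_eq mult.commute)
  ultimately have "d * degree ?a = 1 + d * degree ?b" using e by metis
  then have "d dvd 1" by (metis dvd_add_left_iff dvd_triv_left)
  then show False using d by simp
qed

section \<open>Inverse branches and connected preimages\<close>

text \<open>The complement of \<open>Om\<close> is connected and unbounded, so \<open>Om\<close> is
  simply connected; as 0 lies outside it, a root exists and can be normalised at 1. The factor
  \<open>z - 1\<close> cancels the pole of the Moebius image of \<open>r\<close> at 1: the product
  extends to \<open>lam\<close> times a geometric sum in \<open>r\<close>, which has no zeros and
  hence a logarithm on all of \<open>Om\<close>. This supplies the \<open>l\<close> of
  \<open>end_swapping_map\<close>.\<close>

lemma root_branch:
  assumes Om: "open Om" "connected Om" and co: "connected (- Om)" "\<not> bounded (- Om)" and "0 \<notin> Om" "1 \<in> Om"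
  obtains r l where "r holomorphic_on Om" "\<And>z. z \<in> Om \<Longrightarrow> r z ^ d = z" "r 1 = 1"
    "l holomorphic_on Om" "\<And>z. z \<in> Om \<Longrightarrow> z \<noteq> 1 \<Longrightarrow> ((r z + lam - 1) / (r z - 1) - 1) * (z - 1) = exp (l z)"
proof -
  have "winding_number \<gamma> z = 0"
    if \<gamma>: "path \<gamma>" "path_image \<gamma> \<subseteq> Om" "pathfinish \<gamma> = pathstart \<gamma>" "z \<notin> Om" for \<gamma> z
  proof -
    obtain B where B: "\<And>z. B \<le> norm z \<Longrightarrow> winding_number \<gamma> z = 0"
      using winding_number_zero_at_infinity[OF \<gamma>(1,3)] by blast
    obtain w where w: "w \<in> - Om" "B \<le> norm w" using co(2) unfolding bounded_iff by (meson linear)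
    have "winding_number \<gamma> constant_on - Om"
      by (rule winding_number_constant[OF \<gamma>(1,3) co(1)]) (use \<gamma>(2) in auto)
    then show ?thesis using w B[OF w(2)] \<gamma>(4) by (metis ComplI constant_on_def)
  qed
  then have sc: "simply_connected Om"
    unfolding simply_connected_eq_winding_number_zero[OF Om(1)] using Om(2) by blast
  have logs: "\<exists>g. g holomorphic_on Om \<and> (\<forall>z\<in>Om. h z = exp (g z))"
    if "h holomorphic_on Om" "\<And>z. z \<in> Om \<Longrightarrow> h z \<noteq> 0" for h
    using sc that unfolding simply_connected_eq_holomorphic_log[OF Om(1)] by blast
  obtain L where L: "L holomorphic_on Om" "\<And>z. z \<in> Om \<Longrightarrow> z = exp (L z)"
    using logs[of "\<lambda>z. z"] assms(5) by (auto intro: holomorphic_intros)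
  define c where "c = exp (L 1 / of_nat d)"
  define r where "r = (\<lambda>z. exp (L z / of_nat d) / c)"
  have rt: "exp (L z / of_nat d) ^ d = z" if "z \<in> Om" for z
  proof -
    have "exp (L z / of_nat d) ^ d = exp (of_nat d * (L z / of_nat d))" by (rule exp_of_nat_mult[symmetric])
    also have "of_nat d * (L z / of_nat d) = L z" using d by simp
    finally show ?thesis using L(2)[OF that] by simp
  qed
  have c: "c \<noteq> 0" "c ^ d = 1" using rt[OF assms(6)] by (auto simp: c_def)
  have r: "r holomorphic_on Om" using L(1) c d unfolding r_def by (intro holomorphic_intros) auto
  have rd: "r z ^ d = z" if "z \<in> Om" for z
    using rt[OF that] c by (simp add: r_def power_divide)
  have r1: "r 1 = 1" using c by (simp add: r_def c_def)
  let ?h = "\<lambda>z. lam * (\<Sum>j<d. r z ^ j)"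
  have hz: "?h z \<noteq> 0" if "z \<in> Om" for z
  proof (cases "z = 1")
    case True
    then show ?thesis using r1 lam d by simp
  next
    case False
    have "(r z - 1) * (\<Sum>j<d. r z ^ j) = z - 1"
      unfolding power_diff_1_eq[symmetric] rd[OF that] by simp
    then have "(\<Sum>j<d. r z ^ j) \<noteq> 0" using False by (metis eq_iff_diff_eq_0 mult_zero_right)
    then show ?thesis using lam by simp
  qed
  have "?h holomorphic_on Om" using r by (intro holomorphic_intros)
  then obtain l where l: "l holomorphic_on Om" "\<And>z. z \<in> Om \<Longrightarrow> ?h z = exp (l z)"
    using logs[of ?h] hz by blast
  have "((r z + lam - 1) / (r z - 1) - 1) * (z - 1) = exp (l z)" if "z \<in> Om" "z \<noteq> 1" for z
  proof -
    have ne: "r z \<noteq> 1" using rd[OF that(1)] that(2) by auto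
    have "z - 1 = (r z - 1) * (\<Sum>j<d. r z ^ j)" using power_diff_1_eq[of "r z" d] rd[OF that(1)] by simp
    moreover have "(r z + lam - 1) / (r z - 1) - 1 = lam / (r z - 1)" using ne by (simp add: field_simps)
    ultimately have "((r z + lam - 1) / (r z - 1) - 1) * (z - 1) = ?h z" using ne by simp
    then show ?thesis using l(2)[OF that(1)] by simp
  qed
  then show ?thesis using that r rd r1 l(1) by blast
qed

lemma F_branch: "w ^ d = z \<Longrightarrow> F (msp (Finite w)) = Finite z"
  unfolding F_def msp_msp by simp

lemma continuous_on_branch:
  assumes "r holomorphic_on Om"
  shows "continuous_on Om (\<lambda>z. msp (Finite (r z)))"
  by (intro continuous_on_compose2[OF continuous_msp[of UNIV]] continuous_on_compose2[OF continuous_on_Finite[of UNIV]]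
      holomorphic_on_imp_continuous_on assms) auto

text \<open>\<open>F\<close> is both open and closed, so the image of \<open>A\<close> is clopen in
  \<open>X\<close>. Relative openness holds because that image is the trace on \<open>X\<close> of
  the image of the open set \<open>- B\<close>.\<close>

lemma clopen_piece_of_preimage:
  assumes X: "closed X" "connected X" and A: "closed A" "closed B" "A \<union> B = F -` X" "A \<inter> B = {}" "A \<noteq> {}"
  shows "F ` A = X"
proof -
  have "F ` A = F ` (- B) \<inter> X"
  proof (intro equalityI subsetI)
    fix y assume "y \<in> F ` A"
    then show "y \<in> F ` (- B) \<inter> X" using A(3,4) by blast
  next
    fix y assume "y \<in> F ` (- B) \<inter> X"
    then obtain x where x: "x \<notin> B" "y = F x" "F x \<in> X" by blast
    then have "x \<in> A" using A(3) by blast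
    then show "y \<in> F ` A" using x(2) by blast
  qed
  moreover have "open (F ` (- B))" using A(2) by (intro open_F) auto
  ultimately have "openin (top_of_set X) (F ` A)" by (metis Int_commute openin_open_Int)
  moreover have "closedin (top_of_set X) (F ` A)"
    using closed_F[OF A(1)] A(3) by (intro closed_subset) auto
  ultimately show ?thesis using X(2) A(5) unfolding connected_clopen by blast
qed

lemma connected_preimageI:
  assumes X: "closed X" "connected X"
    and "\<And>A B. \<lbrakk>closed A; closed B; A \<union> B = F -` X; A \<inter> B = {}; F ` A = X; F ` B = X\<rbrakk> \<Longrightarrow> False"
  shows "connected (F -` X)"
proof (rule ccontr)
  assume n: "\<not> connected (F -` X)"
  have cl: "closed (F -` X)" using X(1) isCont_F by (intro continuous_closed_vimage) auto
  obtain A B where AB: "closed A" "closed B" "A \<noteq> {}" "B \<noteq> {}" "A \<union> B = F -` X" "A \<inter> B = {}"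
    using n[unfolded connected_closed_set[OF cl]] by (simp only: not_not) (elim exE conjE)
  have BA: "B \<union> A = F -` X" "B \<inter> A = {}" using AB(5,6) by (simp_all add: Un_commute Int_commute)
  show False
    by (rule assms(3)[OF AB(1,2,5,6) clopen_piece_of_preimage[OF X AB(1,2,5,6,3)]
      clopen_piece_of_preimage[OF X AB(2,1) BA AB(4)]])
qed

text \<open>Both pieces of a separation would map onto \<open>X\<close>, so each would contain a
  preimage of the totally ramified point \<open>p\<close>; there is only one.\<close>

lemma connected_preimage_critical:
  assumes X: "closed X" "connected X" and p: "p \<in> X" "\<And>x. F x = p \<Longrightarrow> x = q"
  shows "connected (F -` X)"
proof (rule connected_preimageI[OF X])
  fix A B assume "A \<inter> B = {}" "F ` A = X" "F ` B = X"
  then show False using p by (metis disjoint_iff image_iff)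
qed

lemma F_eq_0: "F x = Finite 0 \<Longrightarrow> x = Finite (1 - lam)"
proof (cases x)
  case (Finite z)
  assume "F x = Finite 0"
  then have "z \<noteq> 1" "f z = 0" using Finite by (cases "z = 1"; simp)+
  then have "z + lam - 1 = 0" using d by (auto simp: f_def)
  then show ?thesis using Finite by (simp add: algebra_simps)
qed simp

text \<open>The set \<open>T\<close> of d-th roots of \<open>X\<close> still separates 0 from
  infinity, hence so does one of its components \<open>C\<close>. A copy of \<open>C\<close> rotated
  by a d-th root of unity must meet \<open>C\<close>, so it stays in \<open>C\<close>. Thus
  \<open>C\<close> contains whole fibres, and the piece of a separation that misses it cannot map
  onto \<open>X\<close>.\<close>

lemma connected_preimage_annular:
  fixes X :: "complex set"
  assumes X: "compact X" "connected X" "0 \<notin> X" and bd: "bounded (connected_component_set (- X) 0)"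
  shows "connected (F -` (Finite ` X))"
proof (rule connected_preimageI)
  show "closed (Finite ` X)" "connected (Finite ` X)"
    using X by (auto intro!: compact_imp_closed compact_continuous_image connected_Finite_image continuous_on_Finite)
  fix A B assume AB: "closed A" "closed B" "A \<union> B = F -` (Finite ` X)" "A \<inter> B = {}"
    "F ` A = Finite ` X" "F ` B = Finite ` X"
  define T where "T = {w::complex. w ^ d \<in> X}"
  obtain b where b: "b > 0" "X \<subseteq> ball 0 b" using compact_imp_bounded[OF X(1)] bounded_subset_ballD by blast
  define a where "a = complex_of_real (b + 1)"
  have na: "cmod a = b + 1" using b unfolding a_def norm_of_real by simp
  have Tb: "T \<subseteq> ball 0 (cmod a)"
  proof
    fix w assume w: "w \<in> T"
    show "w \<in> ball 0 (cmod a)"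
    proof (rule ccontr)
      assume "w \<notin> ball 0 (cmod a)"
      then have "b + 1 \<le> cmod w" by (simp add: na)
      moreover have "cmod w \<le> cmod w ^ d" using calculation b(1) d power_increasing[of 1 d "cmod w"] by simp
      ultimately have "w ^ d \<notin> ball 0 b" by (simp add: norm_power)
      then show False using w b(2) by (auto simp: T_def)
    qed
  qed
  have clT: "closed T"
    using continuous_closed_vimage[of X "\<lambda>w. w ^ d"] compact_imp_closed[OF X(1)] by (simp add: T_def vimage_def)
  have "\<not> connected_component (- T) 0 a"
  proof
    assume "connected_component (- T) 0 a"
    then obtain D where D: "connected D" "D \<subseteq> - T" "0 \<in> D" "a \<in> D" unfolding connected_component_def by blast
    \<comment> \<open>The d-th powers of a connected set in \<open>- T\<close> from 0 to
      \<open>a\<close> avoid \<open>X\<close> and reach the outside of a ball around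
      \<open>X\<close>, so 0 would lie in an unbounded component of the complement.\<close>
    have co: "connected ((\<lambda>w. w ^ d) ` D)" by (intro connected_continuous_image continuous_intros D)
    have "- ball 0 b \<inter> (\<lambda>w. w ^ d) ` D \<noteq> {}"
    proof -
      have "cmod a \<le> cmod (a ^ d)" using b(1) d power_increasing[of 1 d "cmod a"] na by (simp add: norm_power)
      then have "a ^ d \<in> - ball 0 b" using na by simp
      then show ?thesis using D(4) by blast
    qed
    then have "connected ((\<lambda>w. w ^ d) ` D \<union> - ball 0 b)"
      using co by (intro connected_Un connected_complement_bounded_convex) auto
    moreover have "(\<lambda>w. w ^ d) ` D \<union> - ball 0 b \<subseteq> - X" using D(2) b(2) by (auto simp: T_def)
    moreover have "0 \<in> (\<lambda>w. w ^ d) ` D" using D(3) d by (intro image_eqI[of _ _ 0]) auto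
    ultimately have "- ball 0 b \<subseteq> connected_component_set (- X) 0"
      using connected_component_maximal by (metis UnI1 Un_subset_iff)
    then have "bounded (- ball (0::complex) b)" using bd bounded_subset by blast
    then have "bounded (ball (0::complex) b \<union> - ball 0 b)" by (metis bounded_Un bounded_ball)
    then show False by (simp add: Compl_partition)
  qed
  then obtain C where C: "C \<in> components T" "\<not> connected_component (- C) 0 a"
    using separation_by_component_closed_pointwise[OF clT] by blast
  have CT: "C \<subseteq> T" "connected C" "C \<noteq> {}" using C(1) in_components_subset in_components_connected in_components_nonempty by blast+
  have "bounded C" by (rule bounded_subset[OF bounded_ball order_trans[OF CT(1) Tb]])
  then have cC: "compact C" using closed_components[OF clT C(1)] compact_eq_bounded_closed by blast
  have C0: "0 \<notin> C" using CT(1) X(3) d by (auto simp: T_def power_0_left)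
  have rot: "\<zeta> * c \<in> C" if "\<zeta> ^ d = 1" "c \<in> C" for \<zeta> c
  proof -
    have "cmod \<zeta> ^ d = 1" using that(1) by (metis norm_one norm_power)
    then have "cmod \<zeta> = 1" using d power_eq_imp_eq_base[of "cmod \<zeta>" d 1] by simp
    then have m: "(\<lambda>z. \<zeta> * z) ` C \<inter> C \<noteq> {}"
      using rotated_continuum_meets[OF cC CT(2) C0 _ C(2)] CT(1) Tb by blast
    have "(\<lambda>z. \<zeta> * z) ` C \<subseteq> T" using CT(1) that(1) by (auto simp: T_def power_mult_distrib)
    moreover have "connected ((\<lambda>z. \<zeta> * z) ` C)" by (intro connected_continuous_image continuous_intros CT)
    ultimately have "(\<lambda>z. \<zeta> * z) ` C \<subseteq> C" using components_maximal[OF C(1)] m by blast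
    then show ?thesis using that(2) by blast
  qed
  let ?C = "msp ` Finite ` C"
  have "F (msp (Finite w)) = Finite (w ^ d)" for w unfolding F_def msp_msp by simp
  then have "?C \<subseteq> A \<union> B" unfolding AB(3) using CT(1) by (auto simp: T_def)
  moreover have "connected ?C" by (intro connected_continuous_image continuous_msp connected_Finite_image CT)
  ultimately have AorB: "?C \<subseteq> A \<or> ?C \<subseteq> B" using connected_closedD[of ?C A B] AB(1,2,4) by blast
  have no: False if P: "?C \<subseteq> P" "P \<inter> P' = {}" "F ` P' = Finite ` X" for P P'
  proof -
    obtain c where c: "c \<in> C" using CT(3) by blast
    then have "c ^ d \<in> X" "c \<noteq> 0" using CT(1) C0 by (auto simp: T_def)
    then obtain x where x: "x \<in> P'" "F x = Finite (c ^ d)" using P(3) by (metis imageE imageI)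
    then obtain w where w: "msp x = Finite w" "w ^ d = c ^ d" unfolding F_def by (cases "msp x") auto
    then have "(w / c) ^ d = 1" using \<open>c \<noteq> 0\<close> by (simp add: power_divide)
    then have "w \<in> C" using rot[OF _ c] \<open>c \<noteq> 0\<close> by fastforce
    then have "x \<in> ?C" using w(1) by (metis imageI msp_msp)
    then show False using x(1) P by blast
  qed
  show False using AorB no[of A B] no[of B A] AB by blast
qed

end

section \<open>The basin of the cycle and its complement\<close>

locale trapped = diamond +
  fixes R \<epsilon> :: real
  assumes R: "1 + \<epsilon> < R" and \<epsilon>: "0 < \<epsilon>"
    and far: "\<And>z. R \<le> cmod z \<Longrightarrow> cmod (f z - 1) < \<epsilon>"
    and near: "\<And>y. cmod (y - 1) < \<epsilon> \<Longrightarrow> y \<noteq> 1 \<Longrightarrow> R < cmod (f y)"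
    and far2: "\<And>z. R \<le> cmod z \<Longrightarrow> f z \<noteq> 1 \<Longrightarrow> 2 * cmod z \<le> cmod (f (f z))"
begin

text \<open>\<open>F\<close> maps \<open>Doo\<close>, hence \<open>Voo\<close>, into
  \<open>V1\<close>, and \<open>V1\<close> into \<open>Voo\<close>. The closed disc
  \<open>Doo\<close> is what continua through \<infinity> are required to contain, so that removing
  \<infinity> does not disconnect them.\<close>

definition Voo :: "riemann_sphere set" where "Voo = insert Infinity (Finite ` {z. R < cmod z})"
definition Doo :: "riemann_sphere set" where "Doo = insert Infinity (Finite ` {z. R \<le> cmod z})"
definition V1 :: "riemann_sphere set" where "V1 = Finite ` ball 1 \<epsilon>"

lemma R_gt_1: "R > 1" using R \<epsilon> by simp

lemma Voo_eq: "Voo = recip ` ball 0 (1 / R)"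
proof -
  have "x \<in> Voo \<longleftrightarrow> x \<in> recip ` ball 0 (1 / R)" for x
  proof (cases x)
    case (Finite z)
    have "R < cmod z \<longleftrightarrow> z \<noteq> 0 \<and> cmod (1 / z) < 1 / R"
      using R_gt_1 by (cases "z = 0") (auto simp: norm_divide field_simps)
    then show ?thesis using Finite by (auto simp: Voo_def Finite_in_recip_image)
  next
    case Infinity
    then show ?thesis using R_gt_1 by (auto simp: Voo_def intro: image_eqI[of _ _ 0])
  qed
  then show ?thesis by blast
qed

lemma Doo_eq: "Doo = recip ` cball 0 (1 / R)"
proof -
  have "x \<in> Doo \<longleftrightarrow> x \<in> recip ` cball 0 (1 / R)" for x
  proof (cases x)
    case (Finite z)
    have "R \<le> cmod z \<longleftrightarrow> z \<noteq> 0 \<and> cmod (1 / z) \<le> 1 / R"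
      using R_gt_1 by (cases "z = 0") (auto simp: norm_divide field_simps)
    then show ?thesis using Finite by (auto simp: Doo_def Finite_in_recip_image)
  next
    case Infinity
    then show ?thesis using R_gt_1 by (auto simp: Doo_def intro: image_eqI[of _ _ 0])
  qed
  then show ?thesis by blast
qed

lemma open_Voo: "open Voo" and connected_Voo: "connected Voo"
  unfolding Voo_eq by (auto intro: open_recip_image connected_continuous_image continuous_on_recip)

lemma connected_Doo: "connected Doo" and closed_Doo: "closed Doo"
  unfolding Doo_eq by (auto intro!: connected_continuous_image continuous_on_recip compact_imp_closed compact_continuous_image)

lemma open_V1: "open V1" unfolding V1_def by (intro open_Finite_image) simp

lemma Infinity_in: "Infinity \<in> Voo" "Infinity \<in> Doo" "Infinity \<notin> V1" "Finite 1 \<in> V1" "Finite 1 \<notin> Voo"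
  using \<epsilon> R_gt_1 by (auto simp: Voo_def Doo_def V1_def)

lemma Voo_subset_Doo: "Voo \<subseteq> Doo" by (auto simp: Voo_def Doo_def)

lemma Voo_V1_disjoint: "Voo \<inter> V1 = {}"
proof -
  have "cmod z < R" if "cmod (z - 1) < \<epsilon>" for z
    using norm_triangle_ineq2[of z 1] that R by simp
  then show ?thesis by (auto simp: Voo_def V1_def dist_norm norm_minus_commute) (meson less_asym)
qed

lemma F_Doo: "F ` Doo \<subseteq> V1"
proof -
  have "F (Finite z) \<in> V1" if "R \<le> cmod z" for z
    using far[OF that] that R_gt_1 by (cases "z = 1") (auto simp: V1_def dist_norm norm_minus_commute)
  then show ?thesis using Infinity_in by (auto simp: Doo_def)
qed

lemma F_V1: "F ` V1 \<subseteq> Voo"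
proof -
  have "F (Finite y) \<in> Voo" if "cmod (y - 1) < \<epsilon>" for y
    using near[OF that] by (cases "y = 1") (auto simp: Voo_def)
  then show ?thesis by (auto simp: V1_def dist_norm norm_minus_commute)
qed

lemma connected_far: "connected {z::complex. R \<le> cmod z}"
proof -
  have "{z::complex. R \<le> cmod z} = - ball 0 R" by auto
  then show ?thesis by (simp add: connected_complement_bounded_convex)
qed

text \<open>The finite part of \<open>Doo\<close> is connected, so it lies on one side of any
  separation of the finite part of \<open>T\<close>. That side can be enlarged by the disc
  \<open>Voo\<close>, giving a separation of \<open>T\<close>.\<close>

lemma connected_finite_part:
  assumes T: "connected T" "Doo \<subseteq> T"
  shows "connected {z. Finite z \<in> T}" (is "connected ?X")
proof (rule ccontr)
  let ?E = "{z::complex. R \<le> cmod z}"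
  have E: "?E \<subseteq> ?X" using T(2) by (auto simp: Doo_def)
  have key: False if "open A" "open B" "?X \<subseteq> A \<union> B" "A \<inter> B \<inter> ?X = {}" "B \<inter> ?X \<noteq> {}" "?E \<subseteq> A" for A B
  proof -
    have "open (Finite ` A \<union> Voo)" "open (Finite ` B)"
      using that open_Voo by (auto intro: open_Finite_image)
    moreover have "T \<subseteq> (Finite ` A \<union> Voo) \<union> Finite ` B"
    proof
      fix x assume "x \<in> T"
      then show "x \<in> (Finite ` A \<union> Voo) \<union> Finite ` B" using that(3) Infinity_in by (cases x) auto
    qed
    moreover have "(Finite ` A \<union> Voo) \<inter> Finite ` B \<inter> T = {}"
      using that(4,6) by (fastforce simp: Voo_def dest: less_imp_le)
    moreover have "(Finite ` A \<union> Voo) \<inter> T \<noteq> {}" using T(2) Infinity_in by blast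
    moreover have "Finite ` B \<inter> T \<noteq> {}" using that(5) by auto
    ultimately show False using T(1) unfolding connected_def by meson
  qed
  assume "\<not> connected ?X"
  then obtain A B where AB: "open A" "open B" "?X \<subseteq> A \<union> B" "A \<inter> B \<inter> ?X = {}" "A \<inter> ?X \<noteq> {}" "B \<inter> ?X \<noteq> {}"
    unfolding connected_def by blast
  have "?E \<subseteq> A \<or> ?E \<subseteq> B"
  proof (rule ccontr)
    assume "\<not> ?thesis"
    then have "A \<inter> ?E \<noteq> {}" "B \<inter> ?E \<noteq> {}" "?E \<subseteq> A \<union> B" "A \<inter> B \<inter> ?E = {}" using AB E by blast+
    then show False using connected_far AB(1,2) unfolding connected_def by meson
  qed
  then show False
  proof
    assume "?E \<subseteq> A"
    then show False using key[of A B] AB by blast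
  next
    assume "?E \<subseteq> B"
    then show False using key[of B A] AB by blast
  qed
qed

text \<open>If the exceptional continuum \<open>Y\<close> existed, the inverse branch of \<open>F\<close> taking \<open>1\<close> to \<open>\<infinity>\<close>
  would map the annulus between \<open>Y\<close> and \<open>F ` Y\<close> into itself, interchanging its two ends.\<close>

lemma no_swapped_continuum:
  assumes Y: "closed Y" "connected Y" "Doo \<subseteq> Y" "Finite 0 \<in> Y" and disj: "F ` Y \<inter> Y = {}"
    and branch: "\<And>C. \<lbrakk>connected C; Infinity \<in> C; F ` C \<inter> Y = {}\<rbrakk> \<Longrightarrow> C \<inter> F ` Y = {}"
  shows False
proof -
  define Yp where "Yp = {z. Finite z \<in> Y}"
  define Zp where "Zp = {z. Finite z \<in> F ` Y}"
  have infY: "Infinity \<in> Y" "Infinity \<notin> F ` Y" using Y(3) Infinity_in disj by auto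
  have clY: "closed Yp" unfolding Yp_def by (rule closed_Finite_vimage[OF Y(1)])
  have coY: "connected Yp" unfolding Yp_def by (rule connected_finite_part[OF Y(2,3)])
  have farY: "{z. R \<le> cmod z} \<subseteq> Yp" using Y(3) by (auto simp: Yp_def Doo_def)
  have RY: "complex_of_real R \<in> Yp" using farY R_gt_1 by auto
  have cpZ: "compact Zp" unfolding Zp_def by (intro compact_Finite_vimage closed_F Y infY)
  have coZ: "connected Zp" unfolding Zp_def
    by (intro connected_Finite_vimage connected_continuous_image continuous_F Y infY)
  have "F Infinity \<in> F ` Y" using infY by blast
  then have Z1: "1 \<in> Zp" by (simp add: Zp_def)
  have ZY: "Zp \<inter> Yp = {}" using disj by (auto simp: Zp_def Yp_def)
  \<comment> \<open>A simply connected plane domain without the critical value 0, so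
    \<open>F\<close> has an inverse branch on it. It contains \<open>Zp\<close>, the image of
    \<open>Y\<close>.\<close>
  define Om where "Om = connected_component_set (- Yp) 1"
  have Y1: "1 \<notin> Yp" using Z1 ZY by blast
  have Om: "open Om" "connected Om" "1 \<in> Om" "Om \<subseteq> - Yp"
    using clY Y1 connected_component_subset[of "- Yp" 1] by (auto simp: Om_def connected_component_refl_eq intro: open_connected_component)
  have ZOm: "Zp \<subseteq> Om" unfolding Om_def by (rule connected_component_maximal[OF Z1 coZ]) (use ZY in auto)
  have coOm: "connected (- Om)"
    by (rule component_complement_connected[OF coY]) (use Y1 in \<open>auto simp: Om_def intro: componentsI\<close>)
  have OmR: "Om \<subseteq> ball 0 R" using Om(4) farY by (auto simp: not_le[symmetric])
  have ub: "\<not> bounded (- Om)"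
  proof
    assume "bounded (- Om)"
    then have "bounded (Om \<union> - Om)" using OmR bounded_subset bounded_ball by (metis bounded_Un)
    then show False by (simp add: Compl_partition)
  qed
  have "0 \<notin> Om" using Om(4) Y(4) by (auto simp: Yp_def)
  then obtain r l where r: "r holomorphic_on Om" "\<And>z. z \<in> Om \<Longrightarrow> r z ^ d = z" "r 1 = 1"
    and l: "l holomorphic_on Om" "\<And>z. z \<in> Om \<Longrightarrow> z \<noteq> 1 \<Longrightarrow> ((r z + lam - 1) / (r z - 1) - 1) * (z - 1) = exp (l z)"
    using root_branch[OF Om(1,2) coOm ub _ Om(3)] by blast
  define g where "g = (\<lambda>z. (r z + lam - 1) / (r z - 1))"
  define G where "G = (\<lambda>z. msp (Finite (r z)))"
  have rne: "r z \<noteq> 1" if "z \<in> Om" "z \<noteq> 1" for z using r(2)[OF that(1)] that(2) by auto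
  have Gg: "G z = Finite (g z)" if "z \<in> Om" "z \<noteq> 1" for z using rne[OF that] by (simp add: G_def g_def)
  have G1: "G 1 = Infinity" by (simp add: G_def r)
  have FG: "F (G z) = Finite z" if "z \<in> Om" for z unfolding G_def by (rule F_branch[OF r(2)[OF that]])
  have gne: "g z \<noteq> 1" if "z \<in> Om" "z \<noteq> 1" for z
    unfolding g_def using moebius_ne_1 rne that by simp
  have fg: "f (g z) = z" if "z \<in> Om" "z \<noteq> 1" for z
    using FG[OF that(1)] Gg[OF that] gne[OF that] by simp
  have holg: "g holomorphic_on (Om - {1})"
    unfolding g_def using r(1) rne by (intro holomorphic_intros) (auto intro: holomorphic_on_subset)
  have contG: "continuous_on Om G" unfolding G_def by (rule continuous_on_branch[OF r(1)])
  \<comment> \<open>The hypothesis \<open>branch\<close> is made for this set: it is connected,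
    contains \<open>Infinity\<close>, and \<open>F\<close> carries it back into \<open>Om\<close>,
    off \<open>Y\<close>.\<close>
  have "G ` Om \<inter> F ` Y = {}"
  proof (rule branch)
    show "connected (G ` Om)" by (rule connected_continuous_image[OF contG Om(2)])
    show "Infinity \<in> G ` Om" using G1 Om(3) by force
    show "F ` G ` Om \<inter> Y = {}" using FG Om(4) by (auto simp: Yp_def)
  qed
  then have gZ: "g z \<notin> Zp" if "z \<in> Om" "z \<noteq> 1" for z
    using Gg[OF that] that by (force simp: Zp_def)
  define Q where "Q = connected_component_set (- Zp) (of_real R)"
  have RQ: "of_real R \<in> Q" using RY ZY by (auto simp: Q_def connected_component_refl_eq)
  have farQ: "{z. R \<le> cmod z} \<subseteq> Q"
    unfolding Q_def by (rule connected_subset_component[OF connected_far, where p = "of_real R"])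
      (use farY ZY RQ R_gt_1 in \<open>auto simp: Q_def\<close>)
  have Q: "open Q" "connected Q" "Q \<subseteq> - Zp"
    using compact_imp_closed[OF cpZ] connected_component_subset[of "- Zp"]
    by (auto simp: Q_def intro: open_connected_component)
  have OmQ: "- Om \<subseteq> Q"
    unfolding Q_def by (rule connected_subset_component[OF coOm, where p = "of_real R"])
      (use ZOm RY Om(4) RQ in \<open>auto simp: Q_def\<close>)
  \<comment> \<open>The annulus between the two continua: \<open>Om\<close> ends at \<open>Y\<close>
    on the outside, and \<open>Q\<close> at the image of \<open>Y\<close> on the inside.\<close>
  define A where "A = Om \<inter> Q"
  have A1: "1 \<notin> A" using Q(3) Z1 by (auto simp: A_def)
  have openA: "open A" using Om(1) Q(1) by (simp add: A_def open_Int)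
  \<comment> \<open>\<open>Zp\<close> and \<open>Yp\<close> are disjoint and neither separates two
    points of \<open>A\<close>, so by Janiszewski their union does not either.\<close>
  have coA: "connected A"
  proof -
    have "\<exists>T. connected T \<and> T \<subseteq> A \<and> x \<in> T \<and> y \<in> T" if "x \<in> A" "y \<in> A" for x y
    proof -
      have 1: "connected_component (- Zp) x y"
        using that unfolding A_def Q_def by (metis Int_iff connected_component_eq mem_Collect_eq)
      have 2: "connected_component (- Yp) x y"
        using that unfolding A_def Om_def by (metis Int_iff connected_component_eq mem_Collect_eq)
      have "connected_component (- (Zp \<union> Yp)) x y"
        by (rule Janiszewski[OF cpZ clY _ 1 2]) (simp add: ZY)
      then obtain T where T: "connected T" "T \<subseteq> - (Zp \<union> Yp)" "x \<in> T" "y \<in> T"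
        unfolding connected_component_def by blast
      have "T \<subseteq> Om" unfolding Om_def
        by (rule connected_subset_component[OF T(1), where p = x]) (use T that in \<open>auto simp: A_def Om_def\<close>)
      moreover have "T \<subseteq> Q" unfolding Q_def
        by (rule connected_subset_component[OF T(1), where p = x]) (use T that in \<open>auto simp: A_def Q_def\<close>)
      ultimately show ?thesis using T by (auto simp: A_def)
    qed
    then have "\<forall>x\<in>A. \<forall>y\<in>A. connected_component A x y" unfolding connected_component_def by blast
    then show ?thesis by (rule connected_iff_connected_component[THEN iffD2])
  qed
  have gA: "g ` A \<subseteq> A"
  proof
    fix y assume "y \<in> g ` A"
    then obtain x where x: "x \<in> A" "y = g x" by blast
    have x': "x \<in> Om" "x \<in> Q" "x \<noteq> 1" using x(1) A1 by (auto simp: A_def)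
    \<comment> \<open>Near 1 the branch takes values beyond \<open>R\<close>, and its connected
      image avoids \<open>Zp\<close>, so all of it lies in the component \<open>Q\<close>.\<close>
    have yQ: "y \<in> Q"
    proof -
      have con: "connected (g ` (Om - {1}))"
        by (intro connected_continuous_image holomorphic_on_imp_continuous_on holg connected_open_delete Om) simp
      have "isCont G 1" using contG Om continuous_on_eq_continuous_at by blast
      then obtain s where s: "open s" "1 \<in> s" "\<And>z. z \<in> s \<Longrightarrow> G z \<in> Voo"
        unfolding continuous_at_open using open_Voo Infinity_in(1) G1 by metis
      have "s \<inter> Om \<noteq> {1}" using s(1,2) Om(1,3) not_open_singleton[of "1::complex"] by (metis open_Int)
      then obtain w where w: "w \<in> s" "w \<in> Om" "w \<noteq> 1" using s(2) Om(3) by blast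
      have "R < cmod (g w)" using s(3)[OF w(1)] Gg[OF w(2,3)] by (auto simp: Voo_def)
      then have "g w \<in> Q" using farQ by auto
      then have "g ` (Om - {1}) \<subseteq> Q" unfolding Q_def
        by (intro connected_subset_component[OF con, where p = "g w"]) (use w gZ in auto)
      then show ?thesis using x(2) x' by blast
    qed
    \<comment> \<open>Otherwise \<open>y\<close> lies in a bounded component \<open>C\<close> of
      \<open>- Yp\<close> other than \<open>Om\<close>. The frontier of the image of
      \<open>C\<close> lies in the image of \<open>Y\<close>, so this image, containing the point
      \<open>x\<close> of \<open>Q\<close>, contains \<infinity> as well. But only 1 maps to
      \<infinity>, and 1 is not in \<open>C\<close>.\<close>
    have yOm: "y \<in> Om"
    proof (rule ccontr)
      assume nOm: "y \<notin> Om"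
      have yY: "y \<notin> Yp"
      proof
        assume "y \<in> Yp"
        then have "F (Finite y) \<in> F ` Y" by (simp add: Yp_def)
        then have "x \<in> Zp" using FG[OF x'(1)] Gg[OF x'(1,3)] x(2) by (simp add: Zp_def)
        then show False using Q(3) x'(2) by blast
      qed
      define C where "C = connected_component_set (- Yp) y"
      have yC: "y \<in> C" using yY by (simp add: C_def connected_component_refl_eq)
      have "1 \<notin> C"
      proof
        assume "1 \<in> C"
        then have "C = Om" unfolding C_def Om_def by (metis connected_component_eq)
        then show False using yC nOm by simp
      qed
      have CY: "C \<subseteq> - Yp" unfolding C_def by (rule connected_component_subset)
      then have "C \<subseteq> ball 0 R" using farY by (auto simp: not_le[symmetric])
      then have bC: "bounded C" using bounded_subset bounded_ball by blast
      have oC: "open C" unfolding C_def using clY by (intro open_connected_component open_Compl)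
      have "frontier C \<subseteq> Yp"
        by (rule frontier_of_components_closed_complement[OF clY]) (use yY in \<open>auto simp: C_def intro: componentsI\<close>)
      then have "frontier (Finite ` C) \<subseteq> Y" using frontier_Finite_image[OF bC] by (auto simp: Yp_def)
      then have fr: "frontier (F ` Finite ` C) \<subseteq> F ` Y"
        using frontier_F[OF open_Finite_image[OF oC]] by blast
      let ?X = "Finite ` Q \<union> Doo"
      have "Finite (of_real R) \<in> Finite ` Q \<inter> Doo" using RQ R_gt_1 by (auto simp: Doo_def)
      then have X: "connected ?X"
        by (intro connected_Un connected_Finite_image Q connected_Doo) auto
      have "?X \<subseteq> F ` Finite ` C"
      proof (rule connected_subset_if_frontier_disjoint[OF X])
        have "Finite ` Q \<inter> F ` Y = {}" using Q(3) unfolding Zp_def by blast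
        then have "?X \<inter> F ` Y = {}" using disj Y(3) by blast
        then show "?X \<inter> frontier (F ` Finite ` C) = {}" using fr by blast
        have "Finite x \<in> F ` Finite ` C" using FG[OF x'(1)] Gg[OF x'(1,3)] x(2) yC by (metis imageI)
        then show "?X \<inter> F ` Finite ` C \<noteq> {}" using x'(2) by blast
      qed
      then have "Infinity \<in> F ` Finite ` C" using Infinity_in by blast
      then have "1 \<in> C" by (metis F_eq_Infinity_iff image_iff riemann_sphere.inject)
      then show False using \<open>1 \<notin> C\<close> by blast
    qed
    show "y \<in> A" using yQ yOm by (simp add: A_def)
  qed
  \<comment> \<open>The inner end with its holes filled. A level set of the distance to it bounds a
    neighbourhood of 1 inside \<open>Om\<close> and serves as the core
    \<open>\<beta>\<close>.\<close>
  define Zh where "Zh = - Q"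
  have Zh: "compact Zh" "Zh \<subseteq> Om" "1 \<in> Zh"
  proof -
    have "Zh \<subseteq> ball 0 R" using farQ by (auto simp: Zh_def not_le[symmetric])
    then have "bounded Zh" using bounded_subset bounded_ball by blast
    then show "compact Zh" using Q(1) by (auto simp: Zh_def compact_eq_bounded_closed)
  qed (use OmQ Q(3) Z1 in \<open>auto simp: Zh_def\<close>)
  obtain \<eta> where \<eta>: "\<eta> > 0" "(\<Union>x\<in>Zh. ball x \<eta>) \<subseteq> Om"
    using compact_subset_open_imp_ball_epsilon_subset[OF Zh(1) Om(1) Zh(2)] by metis
  define \<beta> where "\<beta> = {w. infdist w Zh = \<eta> / 2}"
  define N where "N = {w. infdist w Zh < \<eta> / 2}"
  have NOm: "w \<in> Om" if "infdist w Zh \<le> \<eta> / 2" for w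
  proof -
    have "Zh \<noteq> {}" using Zh(3) by blast
    then obtain x where x: "x \<in> Zh" "infdist w Zh = dist w x"
      using infdist_attains_inf[OF compact_imp_closed[OF Zh(1)], of w] by metis
    then have "w \<in> ball x \<eta>" using that \<eta>(1) by (simp add: dist_commute)
    then show ?thesis using \<eta>(2) x(1) by blast
  qed
  have "closed \<beta>" unfolding \<beta>_def by (intro closed_Collect_eq continuous_intros)
  moreover have \<beta>Om: "\<beta> \<subseteq> Om" using NOm by (auto simp: \<beta>_def)
  then have "bounded \<beta>" using OmR by (meson bounded_ball bounded_subset)
  ultimately have c\<beta>: "compact \<beta>" by (simp add: compact_eq_bounded_closed)
  have \<beta>A: "\<beta> \<subseteq> A"
  proof
    fix w assume w: "w \<in> \<beta>"
    then have "w \<notin> Zh" using \<eta>(1) by (auto simp: \<beta>_def)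
    then show "w \<in> A" using \<beta>Om w by (auto simp: A_def Zh_def)
  qed
  have "connected_component_set (- \<beta>) 1 \<subseteq> N"
  proof (rule connected_subset_if_frontier_disjoint)
    have N: "open N" unfolding N_def by (intro open_Collect_less continuous_intros)
    have "closure N \<subseteq> {w. infdist w Zh \<le> \<eta> / 2}"
      by (intro closure_minimal closed_Collect_le continuous_intros) (auto simp: N_def)
    then have "frontier N \<subseteq> \<beta>" using N by (auto simp: frontier_def interior_open N_def \<beta>_def)
    then show "connected_component_set (- \<beta>) 1 \<inter> frontier N = {}" using connected_component_subset by blast
    have "1 \<in> connected_component_set (- \<beta>) 1" using Zh(3) \<eta>(1) by (auto simp: \<beta>_def connected_component_refl_eq)
    moreover have "1 \<in> N" using Zh(3) \<eta>(1) by (auto simp: N_def)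
    ultimately show "connected_component_set (- \<beta>) 1 \<inter> N \<noteq> {}" by blast
  qed simp
  moreover have "N \<subseteq> Om" using NOm by (auto simp: N_def)
  ultimately have bd: "bounded (connected_component_set (- \<beta>) 1)" using OmR by (meson bounded_ball bounded_subset)
  have "1 \<notin> \<beta>" using \<beta>A A1 by blast
  then have nolog: "\<not> (\<exists>L. continuous_on \<beta> L \<and> (\<forall>z\<in>\<beta>. z - 1 = exp (L z)))"
    by (rule no_log_around_bounded_component[OF c\<beta> _ bd])
  have "open {z. Finite z \<in> F ` Voo}" by (intro open_Finite_vimage open_F open_Voo)
  moreover have "F Infinity \<in> F ` Voo" using Infinity_in by blast
  then have "1 \<in> {z. Finite z \<in> F ` Voo}" by simp
  ultimately obtain \<rho> where \<rho>: "\<rho> > 0" "ball 1 \<rho> \<subseteq> {z. Finite z \<in> F ` Voo}" using openE by blast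
  moreover have "F ` Voo \<subseteq> F ` Y" using Voo_subset_Doo Y(3) by blast
  ultimately have \<rho>Z: "ball 1 \<rho> \<subseteq> Zp" unfolding Zp_def by blast
  interpret end_swapping_map A g l 1 \<rho> \<beta>
  proof
    show "bounded A" using OmR by (auto simp: A_def intro: bounded_subset[OF bounded_ball])
    show "\<rho> \<le> cmod (z - 1)" if "z \<in> A" for z
    proof (rule ccontr)
      assume "\<not> ?thesis"
      then have "z \<in> Zp" using \<rho>Z by (auto simp: dist_norm norm_minus_commute)
      then show False using that Q(3) by (auto simp: A_def)
    qed
    show "g holomorphic_on A" by (rule holomorphic_on_subset[OF holg]) (use A1 in \<open>auto simp: A_def\<close>)
    show "inj_on g A" by (rule inj_on_inverseI[where g = f]) (use fg A1 in \<open>auto simp: A_def\<close>)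
    show "l holomorphic_on A" by (rule holomorphic_on_subset[OF l(1)]) (auto simp: A_def)
    show "(g z - 1) * (z - 1) = exp (l z)" if "z \<in> A" for z
      using l(2)[of z] that A1 by (auto simp: A_def g_def)
  qed (use openA coA \<rho>(1) gA c\<beta> \<beta>A nolog in auto)
  obtain m where m: "m > 0" "infinite {z \<in> A. (g ^^ m) z = z}" using many_periodic_points by blast
  have itA: "(g ^^ k) z \<in> A" if "z \<in> A" for k z by (rule funpow_in[OF gA that])
  \<comment> \<open>\<open>f\<close> undoes the branch step by step, so periodic points of
    \<open>g\<close> are periodic points of \<open>f\<close> whose orbits avoid 1.\<close>
  have cancel: "(f ^^ j) ((g ^^ (j + k)) z) = (g ^^ k) z" if "z \<in> A" for j k z
  proof (induction j)
    case (Suc j)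
    have "(g ^^ (j + k)) z \<in> Om" "(g ^^ (j + k)) z \<noteq> 1"
      using itA[OF that, of "j + k"] A1 unfolding A_def by (blast, metis)
    then have "f ((g ^^ (Suc j + k)) z) = (g ^^ (j + k)) z" using fg by simp
    then show ?case using Suc by (simp add: funpow_swap1)
  qed simp
  have "{z \<in> A. (g ^^ m) z = z} \<subseteq> {x. (f ^^ m) x = x \<and> (\<forall>j<m. (f ^^ j) x \<noteq> 1)}"
  proof safe
    fix z assume z: "z \<in> A" "(g ^^ m) z = z"
    show "(f ^^ m) z = z" using cancel[OF z(1), of m 0] z(2) by simp
    fix j assume "j < m" "(f ^^ j) z = 1"
    then have "(g ^^ (m - j)) z = 1" using cancel[OF z(1), of j "m - j"] z(2) by simp
    then show False using itA[OF z(1)] A1 by metis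
  qed
  then show False using finite_periodic_points[OF m(1)] m(2) finite_subset by blast
qed

section \<open>The basin and the connectedness of its complement\<close>

definition V :: "riemann_sphere set" where "V = Voo \<union> V1"
definition B :: "riemann_sphere set" where "B = {x. \<exists>n. (F ^^ n) x \<in> V}"
text \<open>The basin is split by parity into the two basins of the second iterate; \<open>F\<close>
  maps each into the other.\<close>

definition Boo :: "riemann_sphere set" where "Boo = {x. \<exists>n. (F ^^ (2 * n)) x \<in> Voo}"
definition B1 :: "riemann_sphere set" where "B1 = {x. \<exists>n. (F ^^ (2 * n)) x \<in> V1}"
definition K :: "complex set" where "K = {z. Finite z \<notin> B}"

lemma FV: "x \<in> Voo \<Longrightarrow> F x \<in> V1" "x \<in> V1 \<Longrightarrow> F x \<in> Voo"
  using F_Doo F_V1 Voo_subset_Doo by blast+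

lemma funpow_V: "x \<in> V \<Longrightarrow> (F ^^ n) x \<in> V"
  by (induction n) (auto simp: V_def FV)

lemma funpow_Voo: "x \<in> Voo \<Longrightarrow> (F ^^ (2 * n)) x \<in> Voo"
  and funpow_V1: "x \<in> V1 \<Longrightarrow> (F ^^ (2 * n)) x \<in> V1"
  by (induction n) (auto simp: FV)

lemma funpow_Infinity: "(F ^^ (2 * n)) Infinity = Infinity"
  by (induction n) auto

lemma open_V: "open V" by (simp add: V_def open_Un open_Voo open_V1)

lemma open_funpow_vimage: "open W \<Longrightarrow> open {x. (F ^^ n) x \<in> W}"
  using open_vimage[of W "F ^^ n"] continuous_funpow_F by (simp add: vimage_def)

lemma open_Boo: "open Boo" and open_B1: "open B1"
  unfolding Boo_def B1_def Collect_ex_eq using open_Voo open_V1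
  by (auto intro!: open_UN open_funpow_vimage simp del: UN_iff)

lemma F_in_B_iff: "F x \<in> B \<longleftrightarrow> x \<in> B"
proof
  assume "F x \<in> B"
  then obtain n where "(F ^^ n) (F x) \<in> V" by (auto simp: B_def)
  then have "(F ^^ Suc n) x \<in> V" by (simp add: funpow_swap1)
  then show "x \<in> B" unfolding B_def by blast
next
  assume "x \<in> B"
  then obtain n where "(F ^^ n) x \<in> V" by (auto simp: B_def)
  then have "(F ^^ n) (F x) \<in> V" using FV by (auto simp: V_def funpow_swap1[symmetric])
  then show "F x \<in> B" unfolding B_def by blast
qed

lemma F_Boo: "x \<in> Boo \<Longrightarrow> F x \<in> B1" and F_B1: "x \<in> B1 \<Longrightarrow> F x \<in> Boo"
  unfolding Boo_def B1_def using FV by (auto simp: funpow_swap1[symmetric])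

lemma Boo_B1_disjoint: "Boo \<inter> B1 = {}"
proof -
  have False if x: "(F ^^ (2 * n)) x \<in> Voo" "(F ^^ (2 * m)) x \<in> V1" for n m x
  proof -
    have "(F ^^ (2 * m)) ((F ^^ (2 * n)) x) \<in> Voo" by (rule funpow_Voo[OF x(1)])
    moreover have "(F ^^ (2 * n)) ((F ^^ (2 * m)) x) \<in> V1" by (rule funpow_V1[OF x(2)])
    moreover have "(F ^^ (2 * m)) ((F ^^ (2 * n)) x) = (F ^^ (2 * n)) ((F ^^ (2 * m)) x)"
      by (metis add.commute comp_apply funpow_add)
    ultimately show False using Voo_V1_disjoint by auto
  qed
  then show ?thesis by (auto simp: Boo_def B1_def)
qed

lemma B_eq: "B = Boo \<union> B1"
proof (intro equalityI subsetI)
  fix x assume "x \<in> B"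
  then obtain n where n: "(F ^^ n) x \<in> V" by (auto simp: B_def)
  have "\<exists>k. (F ^^ (2 * k)) x \<in> V"
  proof (cases "even n")
    case True
    then show ?thesis using n by (auto elim: evenE)
  next
    case False
    then obtain k where "n = 2 * k + 1" by (auto elim: oddE)
    moreover have "(F ^^ Suc n) x \<in> V" using n FV by (auto simp: V_def)
    ultimately have "(F ^^ (2 * Suc k)) x \<in> V" by simp
    then show ?thesis by blast
  qed
  then show "x \<in> Boo \<union> B1" by (auto simp: Boo_def B1_def V_def)
qed (auto simp: Boo_def B1_def B_def V_def)

lemma Doo_subset_Boo: "Doo \<subseteq> Boo"
proof
  fix x assume "x \<in> Doo"
  then have "(F ^^ (2 * 1)) x \<in> Voo" using F_Doo F_V1 by (auto simp: numeral_2_eq_2)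
  then show "x \<in> Boo" unfolding Boo_def by blast
qed

text \<open>Such a \<open>P\<close> lies in \<open>Boo\<close>, and compactness gives one
  \<open>N\<close> for all its points. The union \<open>Y\<close> of the even images of
  \<open>P\<close> up to index \<open>2 * N\<close> is then mapped into itself by the second
  iterate, while its image under \<open>F\<close> lies in \<open>B1\<close>. So \<open>Y\<close> is
  a forbidden continuum; its condition \<open>branch\<close> holds since a point of \<open>C\<close>
  in the image of \<open>Y\<close> would be mapped by \<open>F\<close> into
  \<open>Y\<close>.\<close>

lemma no_basin_continuum_0_Infinity:
  assumes P: "closed P" "connected P" "Doo \<subseteq> P" "P \<subseteq> B" "Finite 0 \<in> P"
  shows False
proof -
  have PB: "P \<subseteq> Boo"
  proof (rule ccontr)
    assume "\<not> P \<subseteq> Boo"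
    then have "B1 \<inter> P \<noteq> {}" "Boo \<inter> P \<noteq> {}" "P \<subseteq> Boo \<union> B1" "Boo \<inter> B1 \<inter> P = {}"
      using P(3,4) B_eq Doo_subset_Boo Infinity_in Boo_B1_disjoint by blast+
    then show False using P(2) open_Boo open_B1 unfolding connected_def by meson
  qed
  have "\<exists>N. \<forall>x\<in>P. (F ^^ (2 * N)) x \<in> Voo"
  proof -
    let ?W = "\<lambda>n. {x. (F ^^ (2 * n)) x \<in> Voo}"
    have "P \<subseteq> \<Union> (range ?W)" using PB by (auto simp: Boo_def)
    moreover have "\<And>n. n \<in> UNIV \<Longrightarrow> open (?W n)" by (intro open_funpow_vimage open_Voo)
    ultimately obtain C where C: "finite C" "P \<subseteq> \<Union> (?W ` C)"
      using compactE_image[OF closed_imp_compact_sphere[OF P(1)], of UNIV ?W] by auto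
    obtain N where N: "\<And>n. n \<in> C \<Longrightarrow> n \<le> N" using C(1) finite_nat_set_iff_bounded_le by auto
    have "(F ^^ (2 * N)) x \<in> Voo" if "x \<in> P" for x
    proof -
      obtain n where n: "n \<in> C" "(F ^^ (2 * n)) x \<in> Voo" using subsetD[OF C(2) \<open>x \<in> P\<close>] by auto
      have "(F ^^ (2 * (N - n))) ((F ^^ (2 * n)) x) \<in> Voo" by (rule funpow_Voo[OF n(2)])
      moreover have "(F ^^ (2 * (N - n))) ((F ^^ (2 * n)) x) = (F ^^ (2 * (N - n) + 2 * n)) x" by (simp add: funpow_add)
      moreover have "2 * (N - n) + 2 * n = 2 * N" using N[OF n(1)] by simp
      ultimately show ?thesis by simp
    qed
    then show ?thesis by blast
  qed
  then obtain N where N: "\<And>x. x \<in> P \<Longrightarrow> (F ^^ (2 * N)) x \<in> Voo" by blast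
  define Y where "Y = (\<Union>j\<le>N. (F ^^ (2 * j)) ` P)"
  have infP: "Infinity \<in> P" using P(3) Infinity_in by blast
  have PY: "P \<subseteq> Y" unfolding Y_def by (force intro: bexI[of _ 0])
  have "closed ((F ^^ (2 * j)) ` P)" for j
    by (rule compact_imp_closed[OF compact_continuous_image[OF continuous_funpow_F closed_imp_compact_sphere[OF P(1)]]])
  then have clY: "closed Y" unfolding Y_def by (intro closed_UN) auto
  have coY: "connected Y" unfolding Y_def
  proof (rule connected_Union)
    show "\<And>S. S \<in> (\<lambda>j. (F ^^ (2 * j)) ` P) ` {..N} \<Longrightarrow> connected S"
      using P(2) by (auto intro!: connected_continuous_image continuous_funpow_F)
    have "Infinity \<in> (F ^^ (2 * j)) ` P" for j using infP funpow_Infinity[of j] by (metis imageI)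
    then show "\<Inter> ((\<lambda>j. (F ^^ (2 * j)) ` P) ` {..N}) \<noteq> {}" by blast
  qed
  have "(F ^^ (2 * j)) x \<in> Boo" if "x \<in> Boo" for j x
    by (induction j) (use that F_Boo F_B1 in auto)
  then have "Y \<subseteq> Boo" using PB by (auto simp: Y_def)
  then have disj: "F ` Y \<inter> Y = {}" using F_Boo Boo_B1_disjoint by blast
  have FFY: "F (F x) \<in> Y" if "x \<in> Y" for x
  proof -
    obtain j p where jp: "j \<le> N" "p \<in> P" "x = (F ^^ (2 * j)) p" using \<open>x \<in> Y\<close> by (auto simp: Y_def)
    show ?thesis
    proof (cases "j = N")
      case True
      then have "F (F x) \<in> Voo" using N[OF jp(2)] jp(3) FV by auto
      then show ?thesis using Voo_subset_Doo P(3) PY by blast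
    next
      case False
      then have "Suc j \<le> N" using jp(1) by simp
      moreover have "F (F x) = (F ^^ (2 * Suc j)) p" using jp(3) by simp
      ultimately show ?thesis unfolding Y_def using jp(2) by blast
    qed
  qed
  show False
  proof (rule no_swapped_continuum[OF clY coY _ _ disj])
    show "C \<inter> F ` Y = {}" if "F ` C \<inter> Y = {}" for C using that FFY by blast
  qed (use P PY in auto)
qed

definition Kn :: "nat \<Rightarrow> complex set" where "Kn n = {z. (F ^^ n) (Finite z) \<notin> V}"

lemma Kn_image: "Finite ` Kn n = {x. (F ^^ n) x \<notin> V}"
proof -
  have "Infinity \<in> V" using Infinity_in by (simp add: V_def)
  then have "(F ^^ n) Infinity \<in> V" by (rule funpow_V)
  then have "x \<in> Finite ` Kn n \<longleftrightarrow> (F ^^ n) x \<notin> V" for x by (cases x) (auto simp: Kn_def)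
  then show ?thesis by blast
qed

lemma closed_Kn_image: "closed (Finite ` Kn n)"
  using open_funpow_vimage[OF open_V, of n] unfolding Kn_image closed_def by (simp add: Collect_neg_eq[symmetric])

lemma Kn_vimage: "{z. Finite z \<in> Finite ` Kn n} = Kn n" by auto

lemma compact_Kn: "compact (Kn n)"
  using compact_Finite_vimage[OF closed_Kn_image, of n] unfolding Kn_vimage by auto

text \<open>Each step takes the preimage of a continuum. If that continuum neither contains 0 nor
  encloses it, a path in its complement, hence in the basin, joins 0 to the neighbourhood of
  \<infinity>, which \<open>no_basin_continuum_0_Infinity\<close> forbids.\<close>

lemma connected_Kn_image: "connected (Finite ` Kn n)"
proof (induction n)
  case 0
  have "Kn 0 = cball 0 R - ball 1 \<epsilon>" by (auto simp: Kn_def V_def Voo_def V1_def)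
  moreover have "cball 1 \<epsilon> \<subseteq> cball (0::complex) R"
  proof
    fix z :: complex assume "z \<in> cball 1 \<epsilon>"
    then show "z \<in> cball 0 R" using R norm_triangle_ineq2[of z 1] by (simp add: dist_norm norm_minus_commute)
  qed
  then have "connected (cball (0::complex) R - ball 1 \<epsilon>)" by (intro connected_diff_ball) auto
  ultimately show ?case using connected_Finite_image by metis
next
  case (Suc n)
  have e: "Finite ` Kn (Suc n) = F -` (Finite ` Kn n)" unfolding Kn_image by (simp add: funpow_swap1 vimage_def)
  have coK: "connected (Kn n)" using connected_Finite_vimage[OF Suc] unfolding Kn_vimage by auto
  show ?case
  proof (cases "0 \<in> Kn n")
    case True
    then show ?thesis unfolding e using F_eq_0
      by (intro connected_preimage_critical[OF closed_Kn_image Suc, of "Finite 0" "Finite (1 - lam)"]) auto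
  next
    case False
    show ?thesis
    proof (cases "bounded (connected_component_set (- Kn n) 0)")
      case True
      then show ?thesis unfolding e by (intro connected_preimage_annular compact_Kn coK False)
    next
      case unb: False
      let ?D = "connected_component_set (- Kn n) 0"
      have "open ?D" by (intro open_connected_component) (simp add: compact_Kn compact_imp_closed open_Compl)
      then have "path_connected ?D" by (simp add: connected_open_path_connected)
      moreover obtain w where w: "w \<in> ?D" "R \<le> cmod w" using unb unfolding bounded_iff by (meson linear)
      moreover have "0 \<in> ?D" using False by (simp add: connected_component_refl_eq)
      ultimately obtain \<gamma> where \<gamma>: "path \<gamma>" "path_image \<gamma> \<subseteq> ?D" "pathstart \<gamma> = 0" "pathfinish \<gamma> = w"
        unfolding path_connected_def by metis
      let ?P = "Finite ` path_image \<gamma> \<union> Doo"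
      have gw: "0 \<in> path_image \<gamma>" "w \<in> path_image \<gamma>" using \<gamma>(3,4) pathstart_in_path_image pathfinish_in_path_image by metis+
      have "False"
      proof (rule no_basin_continuum_0_Infinity[of ?P])
        show "closed ?P" using \<gamma>(1) closed_Doo
          by (intro closed_Un compact_imp_closed[OF compact_continuous_image] continuous_on_Finite compact_path_image)
        have "Finite w \<in> Finite ` path_image \<gamma> \<inter> Doo" using gw w(2) by (auto simp: Doo_def)
        then show "connected ?P"
          by (intro connected_Un connected_Finite_image connected_path_image \<gamma>(1) connected_Doo) auto
        have "path_image \<gamma> \<subseteq> - Kn n" using \<gamma>(2) connected_component_subset by blast
        then have "Finite ` path_image \<gamma> \<subseteq> B" by (auto simp: Kn_def B_def)
        then show "?P \<subseteq> B" using Doo_subset_Boo B_eq by blast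
      qed (use gw in auto)
      then show ?thesis ..
    qed
  qed
qed

lemma K_eq: "K = \<Inter> (range Kn)"
  by (auto simp: K_def Kn_def B_def)

lemma compact_K: "compact K"
  unfolding K_eq using compact_Kn by (intro compact_Inter) auto

lemma connected_K: "connected K"
  unfolding K_eq
proof (rule connected_nest)
  show "compact (Kn n)" for n by (rule compact_Kn)
  show "connected (Kn n)" for n using connected_Finite_vimage[OF connected_Kn_image[of n]] unfolding Kn_vimage by auto
  show "Kn n \<subseteq> Kn m" if "m \<le> n" for m n
  proof -
    have "(F ^^ n) x \<in> V" if "(F ^^ m) x \<in> V" for x
    proof -
      have "(F ^^ n) x = (F ^^ (n - m)) ((F ^^ m) x)"
        using \<open>m \<le> n\<close> by (metis comp_apply funpow_add le_add_diff_inverse2)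
      then show ?thesis using funpow_V[OF that] by simp
    qed
    then show ?thesis by (auto simp: Kn_def)
  qed
qed

section \<open>The Julia set as the frontier of \<open>K\<close>\<close>

lemma funpow_FF: "(F \<circ> F) ^^ n = F ^^ (2 * n)"
  by (induction n) (simp_all add: o_assoc)

lemma K_props: "z \<in> K \<Longrightarrow> z \<noteq> 1" "z \<in> K \<Longrightarrow> f z \<in> K" "z \<in> K \<Longrightarrow> cmod z \<le> R"
proof -
  assume z: "z \<in> K"
  have zV: "Finite z \<notin> V" using z unfolding K_def B_def by (auto dest: spec[of _ 0])
  show "z \<noteq> 1" "cmod z \<le> R" using zV Infinity_in by (auto simp: V_def Voo_def)
  then have "F (Finite z) = Finite (f z)" by simp
  then show "f z \<in> K" using z F_in_B_iff[of "Finite z"] by (simp add: K_def)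
qed

lemma funpow_f_K: "z \<in> K \<Longrightarrow> (f ^^ n) z \<in> K"
  by (induction n) (auto simp: K_props)

lemma funpow_F_K: "z \<in> K \<Longrightarrow> (F ^^ n) (Finite z) = Finite ((f ^^ n) z)"
  by (induction n) (auto simp: K_props funpow_f_K)

lemma F_Finite_in_K: "F (Finite z) = Finite w \<Longrightarrow> w \<in> K \<Longrightarrow> z \<in> K"
  using F_in_B_iff[of "Finite z"] by (simp add: K_def)

lemma Finite_K: "Finite ` K = - B"
proof -
  have "Infinity \<in> B" using Infinity_in Doo_subset_Boo B_eq by blast
  then have "x \<in> Finite ` K \<longleftrightarrow> x \<notin> B" for x by (cases x) (auto simp: K_def)
  then show ?thesis by blast
qed

lemma f_interior_K: "f ` interior K \<subseteq> interior K"
proof -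
  let ?W = "{z. Finite z \<in> F ` Finite ` interior K}"
  have "open ?W" by (intro open_Finite_vimage open_F open_Finite_image) simp
  moreover have "?W \<subseteq> K"
  proof safe
    fix z w assume "Finite z = F (Finite w)" "w \<in> interior K"
    moreover have "w \<in> K" using calculation(2) interior_subset by blast
    ultimately show "z \<in> K" using K_props by auto
  qed
  ultimately have "?W \<subseteq> interior K" by (rule interior_maximal[rotated])
  moreover have "f ` interior K \<subseteq> ?W"
  proof
    fix y assume "y \<in> f ` interior K"
    then obtain w where w: "w \<in> interior K" "y = f w" by blast
    then have "F (Finite w) = Finite y" using K_props interior_subset by (metis F_Finite subsetD)
    then show "y \<in> ?W" using w(1) by (metis (mono_tags, lifting) imageI mem_Collect_eq)
  qed
  ultimately show ?thesis by blast
qed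

lemma holomorphic_f_iterates: "(f ^^ n) holomorphic_on interior K"
proof (rule holomorphic_on_funpow[OF _ f_interior_K])
  have "1 \<notin> interior K" using K_props(1) interior_subset by blast
  then show "f holomorphic_on interior K" unfolding f_def[abs_def] by (intro holomorphic_intros) auto
qed

lemma montel_iterates:
  fixes m :: "nat \<Rightarrow> nat"
  obtains g r where "g holomorphic_on interior K" "strict_mono (r :: nat \<Rightarrow> nat)"
    "\<And>z. z \<in> interior K \<Longrightarrow> (\<lambda>k. (f ^^ m (r k)) z) \<longlonglongrightarrow> g z"
    "\<And>Q. \<lbrakk>compact Q; Q \<subseteq> interior K\<rbrakk> \<Longrightarrow> uniform_limit Q (\<lambda>k. f ^^ m (r k)) g sequentially"
proof -
  obtain g r where gr: "g holomorphic_on interior K" "strict_mono (r :: nat \<Rightarrow> nat)"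
    "\<And>z. z \<in> interior K \<Longrightarrow> (\<lambda>k. (f ^^ m (r k)) z) \<longlonglongrightarrow> g z"
    "\<And>Q. \<lbrakk>compact Q; Q \<subseteq> interior K\<rbrakk> \<Longrightarrow> uniform_limit Q ((\<lambda>k. f ^^ m k) \<circ> r) g sequentially"
  proof (rule Montel[of "interior K" "range (\<lambda>n. f ^^ n)" "\<lambda>k. f ^^ m k"])
    show "\<exists>B. \<forall>h\<in>range (\<lambda>n. f ^^ n). \<forall>z\<in>Q. cmod (h z) \<le> B" if "Q \<subseteq> interior K" for Q
      using that interior_subset[of K] by (intro exI[of _ R]) (auto intro!: K_props funpow_f_K)
  qed (auto simp: holomorphic_f_iterates)
  show ?thesis by (rule that[OF gr(1,2,3)]) (use gr(4) in \<open>auto simp: o_def\<close>)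
qed

lemma far_orbit: "x \<in> Voo \<Longrightarrow> dist ((F ^^ (2 * k)) x) Infinity \<le> 2 / 2 ^ k"
proof -
  assume x: "x \<in> Voo"
  have "(F ^^ (2 * k)) x = Infinity \<or> (\<exists>z. (F ^^ (2 * k)) x = Finite z \<and> R \<le> cmod z \<and> 2 ^ k \<le> cmod z)"
  proof (induction k)
    case 0
    show ?case using x R_gt_1 by (auto simp: Voo_def)
  next
    case (Suc k)
    show ?case
    proof (cases "(F ^^ (2 * k)) x")
      case Infinity
      then show ?thesis by simp
    next
      case (Finite z)
      then have z: "R \<le> cmod z" "2 ^ k \<le> cmod z" using Suc by auto
      then have "z \<noteq> 1" using R_gt_1 by auto
      then have "(F ^^ (2 * Suc k)) x = F (Finite (f z))" using Finite by simp
      moreover have "R \<le> cmod (f (f z)) \<and> 2 ^ Suc k \<le> cmod (f (f z))" if "f z \<noteq> 1"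
        using far2[OF z(1) that] z R_gt_1 by simp
      ultimately show ?thesis by (cases "f z = 1") auto
    qed
  qed
  then show ?thesis
  proof
    assume "\<exists>z. (F ^^ (2 * k)) x = Finite z \<and> R \<le> cmod z \<and> 2 ^ k \<le> cmod z"
    then obtain z where z: "(F ^^ (2 * k)) x = Finite z" "2 ^ k \<le> cmod z" by blast
    have p: "(0::real) < 2 ^ k" by simp
    have "2 ^ k \<le> sqrt (1 + (cmod z)\<^sup>2)" using z(2) real_le_rsqrt[of "cmod z" "1 + (cmod z)\<^sup>2"] by simp
    then show ?thesis unfolding z(1) dist_Finite_Infinity using p by (intro divide_left_mono mult_pos_pos order_less_le_trans[OF p]) auto
  qed simp
qed

lemma basin_uniform_limit:
  assumes "x \<in> B"
  obtains W c where "open W" "x \<in> W" "c = Infinity \<or> c = Finite 1"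
    "\<And>e. e > 0 \<Longrightarrow> \<exists>N. \<forall>n\<ge>N. \<forall>y\<in>W. dist ((F ^^ (2 * n)) y) c < e"
proof -
  have ev: "\<exists>N. \<forall>n\<ge>N. \<forall>y\<in>Voo. dist ((F ^^ (2 * n)) y) Infinity < e" if "e > 0" for e
  proof -
    obtain N where N: "(1 / 2) ^ N < e / 2" using real_arch_pow_inv[of "e / 2" "1 / 2"] \<open>e > 0\<close> by auto
    have "dist ((F ^^ (2 * n)) y) Infinity < e" if "n \<ge> N" "y \<in> Voo" for n y
    proof -
      have "(1 / 2 :: real) ^ n \<le> (1 / 2) ^ N" using \<open>n \<ge> N\<close> by (intro power_decreasing) auto
      then have "2 / 2 ^ n < e" using N by (simp add: power_divide)
      then show ?thesis using far_orbit[OF \<open>y \<in> Voo\<close>, of n] by linarith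
    qed
    then show ?thesis by blast
  qed
  consider n0 where "(F ^^ (2 * n0)) x \<in> Voo" | n0 where "(F ^^ (2 * n0)) x \<in> V1"
    using assms B_eq by (auto simp: Boo_def B1_def)
  then show ?thesis
  proof cases
    case 1
    show ?thesis
    proof (rule that[of "{y. (F ^^ (2 * n0)) y \<in> Voo}" Infinity])
      fix e :: real assume "e > 0"
      then obtain N where N: "\<And>n y. n \<ge> N \<Longrightarrow> y \<in> Voo \<Longrightarrow> dist ((F ^^ (2 * n)) y) Infinity < e" using ev by blast
      have "dist ((F ^^ (2 * n)) y) Infinity < e" if "n \<ge> N + n0" "(F ^^ (2 * n0)) y \<in> Voo" for n y
      proof -
        have "2 * n = 2 * (n - n0) + 2 * n0" using that(1) by simp
        then have "(F ^^ (2 * n)) y = (F ^^ (2 * (n - n0))) ((F ^^ (2 * n0)) y)"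
          by (metis comp_apply funpow_add)
        then show ?thesis using N[of "n - n0"] that by simp
      qed
      then show "\<exists>N. \<forall>n\<ge>N. \<forall>y\<in>{y. (F ^^ (2 * n0)) y \<in> Voo}. dist ((F ^^ (2 * n)) y) Infinity < e" by blast
    qed (use 1 open_Voo in \<open>auto intro: open_funpow_vimage\<close>)
  next
    case 2
    show ?thesis
    proof (rule that[of "{y. (F ^^ (2 * n0)) y \<in> V1}" "Finite 1"])
      fix e :: real assume "e > 0"
      have "isCont F Infinity" by (rule isCont_F)
      then obtain \<delta> where \<delta>: "\<delta> > 0" "\<And>w. dist w Infinity < \<delta> \<Longrightarrow> dist (F w) (Finite 1) < e"
        unfolding continuous_at_eps_delta F_Infinity using \<open>e > 0\<close> by blast
      then obtain N where N: "\<And>n y. n \<ge> N \<Longrightarrow> y \<in> Voo \<Longrightarrow> dist ((F ^^ (2 * n)) y) Infinity < \<delta>" using ev by blast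
      \<comment> \<open>One extra step leads from \<open>V1\<close> to \<open>Voo\<close>, and a
        last one from near \<infinity> to near 1. Together they account for the
        \<open>Suc\<close>.\<close>
      have "dist ((F ^^ (2 * n)) y) (Finite 1) < e" if "n \<ge> N + Suc n0" "(F ^^ (2 * n0)) y \<in> V1" for n y
      proof -
        define k where "k = n - Suc n0"
        have k: "n = k + Suc n0" "k \<ge> N" using that(1) by (auto simp: k_def)
        have "2 * n = Suc (2 * k + Suc (2 * n0))" using k by simp
        then have "(F ^^ (2 * n)) y = F ((F ^^ (2 * k)) (F ((F ^^ (2 * n0)) y)))"
          by (metis comp_apply funpow.simps(2) funpow_add)
        then show ?thesis using \<delta>(2)[OF N[OF k(2) FV(2)[OF that(2)]]] by simp
      qed
      then show "\<exists>N. \<forall>n\<ge>N. \<forall>y\<in>{y. (F ^^ (2 * n0)) y \<in> V1}. dist ((F ^^ (2 * n)) y) (Finite 1) < e" by blast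
    qed (use 2 open_V1 in \<open>auto intro: open_funpow_vimage\<close>)
  qed
qed

lemma basin_subset_fatou: "B \<subseteq> fatou_set (F \<circ> F)"
proof
  fix x assume "x \<in> B"
  then obtain W c where W: "open W" "x \<in> W"
    "\<And>e. e > 0 \<Longrightarrow> \<exists>N. \<forall>n\<ge>N. \<forall>y\<in>W. dist ((F ^^ (2 * n)) y) c < e"
    using basin_uniform_limit by metis
  have "normal_family_on W (range (\<lambda>n. F ^^ (2 * n)))"
  proof (rule normal_family_onI)
    fix m :: "nat \<Rightarrow> nat"
    show "(\<exists>g. \<forall>Q. compact Q \<and> Q \<subseteq> W \<longrightarrow> uniform_limit Q (\<lambda>k. F ^^ (2 * m k)) g sequentially) \<or>
     (\<exists>r g. strict_mono (r :: nat \<Rightarrow> nat) \<and> (\<forall>Q. compact Q \<and> Q \<subseteq> W \<longrightarrow> uniform_limit Q (\<lambda>k. F ^^ (2 * m (r k))) g sequentially))"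
    proof (cases rule: subseq_const_or_at_top[of m])
      case (1 r c)
      then have "uniform_limit Q (\<lambda>k. F ^^ (2 * m (r k))) (F ^^ (2 * c)) sequentially" for Q
        by (simp add: uniform_limit_const)
      then show ?thesis using 1(1) by blast
    next
      case 2
      have "uniform_limit Q (\<lambda>k. F ^^ (2 * m k)) (\<lambda>_. c) sequentially" if "Q \<subseteq> W" for Q
      proof (rule uniform_limitI)
        fix e :: real assume "e > 0"
        then obtain N where N: "\<And>n y. n \<ge> N \<Longrightarrow> y \<in> W \<Longrightarrow> dist ((F ^^ (2 * n)) y) c < e" using W(3) by blast
        have "\<forall>\<^sub>F k in sequentially. N \<le> m k" using 2 unfolding filterlim_at_top by blast
        then show "\<forall>\<^sub>F k in sequentially. \<forall>y\<in>Q. dist ((F ^^ (2 * m k)) y) c < e"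
          by eventually_elim (use N that in blast)
      qed
      then show ?thesis by blast
    qed
  qed
  then show "x \<in> fatou_set (F \<circ> F)" using W(1,2) unfolding fatou_set_def funpow_FF by blast
qed

lemma interior_K_subset_fatou: "Finite ` interior K \<subseteq> fatou_set (F \<circ> F)"
proof -
  let ?W = "Finite ` interior K"
  have "normal_family_on ?W (range (\<lambda>n. F ^^ (2 * n)))"
  proof (rule normal_family_onI)
    fix m :: "nat \<Rightarrow> nat"
    obtain g r where g: "strict_mono (r :: nat \<Rightarrow> nat)"
      "\<And>Q. \<lbrakk>compact Q; Q \<subseteq> interior K\<rbrakk> \<Longrightarrow> uniform_limit Q (\<lambda>k. f ^^ (2 * m (r k))) g sequentially"
      using montel_iterates[of "\<lambda>k. 2 * m k"] by metis
    have "uniform_limit Q (\<lambda>k. F ^^ (2 * m (r k))) (\<lambda>x. Finite (g (toC x))) sequentially" if Q: "compact Q" "Q \<subseteq> ?W" for Q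
    proof (rule uniform_limitI)
      fix e :: real assume "e > 0"
      let ?Q = "{z. Finite z \<in> Q}"
      have "compact ?Q" using Q compact_imp_closed by (intro compact_Finite_vimage) auto
      moreover have sub: "?Q \<subseteq> interior K" using Q(2) by auto
      ultimately have "uniform_limit ?Q (\<lambda>k. f ^^ (2 * m (r k))) g sequentially" by (rule g(2))
      then have "\<forall>\<^sub>F k in sequentially. \<forall>z\<in>?Q. dist ((f ^^ (2 * m (r k))) z) (g z) < e / 2"
        using \<open>e > 0\<close> by (intro uniform_limitD) auto
      then show "\<forall>\<^sub>F k in sequentially. \<forall>x\<in>Q. dist ((F ^^ (2 * m (r k))) x) (Finite (g (toC x))) < e"
      proof eventually_elim
        case (elim k)
        show ?case
        proof
          fix x assume x: "x \<in> Q"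
          then obtain z where z: "x = Finite z" "z \<in> K" using Q(2) interior_subset by blast
          have "dist ((f ^^ (2 * m (r k))) z) (g z) < e / 2" using elim x z(1) by blast
          then show "dist ((F ^^ (2 * m (r k))) x) (Finite (g (toC x))) < e"
            using dist_Finite_le[of "(f ^^ (2 * m (r k))) z" "g z"] by (simp add: z funpow_F_K dist_norm)
        qed
      qed
    qed
    then show "(\<exists>g. \<forall>Q. compact Q \<and> Q \<subseteq> ?W \<longrightarrow> uniform_limit Q (\<lambda>k. F ^^ (2 * m k)) g sequentially) \<or>
     (\<exists>r g. strict_mono (r :: nat \<Rightarrow> nat) \<and> (\<forall>Q. compact Q \<and> Q \<subseteq> ?W \<longrightarrow> uniform_limit Q (\<lambda>k. F ^^ (2 * m (r k))) g sequentially))"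
      using g(1) by blast
  qed
  moreover have "open ?W" by (intro open_Finite_image) simp
  ultimately show ?thesis unfolding fatou_set_def funpow_FF by blast
qed

text \<open>A limit of iterates is continuous and takes only the values 1 and \<infinity> at nearby
  basin points, hence also at \<open>z0\<close>. But \<open>z0\<close> is in \<open>K\<close>, so
  its orbit stays off the open set \<open>V\<close>, which contains both values.\<close>

lemma frontier_K_julia:
  assumes "z0 \<in> frontier K"
  shows "Finite z0 \<notin> fatou_set (F \<circ> F)"
proof
  assume "Finite z0 \<in> fatou_set (F \<circ> F)"
  then obtain W where W: "open W" "Finite z0 \<in> W" "normal_family_on W (range (\<lambda>n. F ^^ (2 * n)))"
    unfolding fatou_set_def funpow_FF by blast
  have "range (\<lambda>n. F ^^ (2 * n)) \<subseteq> range (\<lambda>n. F ^^ (2 * n))" by (rule order_refl)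
  with W(3) obtain r g where g: "strict_mono (r :: nat \<Rightarrow> nat)"
    "\<forall>Q. compact Q \<and> Q \<subseteq> W \<longrightarrow> uniform_limit Q ((\<lambda>n. F ^^ (2 * n)) \<circ> r) g sequentially"
    unfolding normal_family_on_def by meson
  obtain e where e: "e > 0" "cball z0 e \<subseteq> {z. Finite z \<in> W}"
    using open_Finite_vimage[OF W(1)] W(2) open_contains_cball by blast
  let ?Q = "Finite ` cball z0 e"
  have "compact ?Q" by (intro compact_continuous_image continuous_on_Finite) simp
  moreover have "?Q \<subseteq> W" using e(2) by blast
  ultimately have ul: "uniform_limit ?Q (\<lambda>k. F ^^ (2 * r k)) g sequentially"
    using g(2)[rule_format, of ?Q] by (simp add: o_def)
  have lim: "(\<lambda>k. (F ^^ (2 * r k)) (Finite z)) \<longlonglongrightarrow> g (Finite z)" if "z \<in> cball z0 e" for z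
    using tendsto_uniform_limitI[OF ul] that by blast
  have "continuous_on ?Q g"
    by (rule uniform_limit_theorem[OF _ ul]) (auto simp: continuous_funpow_F)
  then have cont: "continuous_on (cball z0 e) (\<lambda>z. g (Finite z))"
    by (rule continuous_on_compose2[OF _ continuous_on_Finite order_refl])
  let ?S = "cball z0 e \<inter> (\<lambda>z. g (Finite z)) -` {Infinity, Finite 1}"
  have "closed ?S" by (rule continuous_closed_preimage[OF cont]) auto
  moreover have "ball z0 e \<inter> - K \<subseteq> ?S"
  proof
    fix b assume b: "b \<in> ball z0 e \<inter> - K"
    then have "Finite b \<in> B" by (simp add: K_def)
    then obtain U c where U: "Finite b \<in> U" "c = Infinity \<or> c = Finite 1"
      "\<And>e. e > 0 \<Longrightarrow> \<exists>N. \<forall>n\<ge>N. \<forall>y\<in>U. dist ((F ^^ (2 * n)) y) c < e"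
      using basin_uniform_limit by metis
    have "(\<lambda>n. (F ^^ (2 * n)) (Finite b)) \<longlonglongrightarrow> c" unfolding lim_sequentially using U(1,3) by meson
    then have "(\<lambda>k. (F ^^ (2 * r k)) (Finite b)) \<longlonglongrightarrow> c"
      using LIMSEQ_subseq_LIMSEQ[OF _ g(1)] by (simp add: o_def)
    moreover have "b \<in> cball z0 e" using b by auto
    ultimately have "g (Finite b) = c" using lim LIMSEQ_unique by blast
    then show "b \<in> ?S" using U(2) \<open>b \<in> cball z0 e\<close> by auto
  qed
  ultimately have "closure (ball z0 e \<inter> - K) \<subseteq> ?S" by (rule closure_minimal[rotated])
  moreover have "z0 \<in> closure (ball z0 e \<inter> - K)"
  proof -
    have "z0 \<in> closure (- K)" using assms by (simp add: frontier_closures)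
    then show ?thesis using open_Int_closure_subset[of "ball z0 e" "- K"] e(1) by auto
  qed
  ultimately have "g (Finite z0) \<in> V" using Infinity_in by (auto simp: V_def)
  moreover have "g (Finite z0) \<in> - V"
  proof (rule Lim_in_closed_set[OF _ _ _ lim])
    have "z0 \<in> K" using assms compact_imp_closed[OF compact_K] frontier_subset_closed by blast
    then show "\<forall>\<^sub>F k in sequentially. (F ^^ (2 * r k)) (Finite z0) \<in> - V"
      by (auto simp: K_def B_def)
  qed (use open_V e(1) in auto)
  ultimately show False by blast
qed

lemma julia_set_eq: "julia_set (U_map d lam) = Finite ` frontier K"
proof -
  have "x \<in> julia_set (F \<circ> F) \<longleftrightarrow> x \<in> Finite ` frontier K" for x
  proof (cases "x \<in> B")
    case True
    have "x \<notin> Finite ` frontier K"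
      using True Finite_K frontier_subset_closed[OF compact_imp_closed[OF compact_K]] by blast
    then show ?thesis using True basin_subset_fatou by (auto simp: julia_set_def)
  next
    case False
    then obtain z where z: "x = Finite z" "z \<in> K" using Finite_K by blast
    have "z \<in> frontier K \<longleftrightarrow> z \<notin> interior K" using z(2) closure_subset by (auto simp: frontier_def)
    then show ?thesis
      using interior_K_subset_fatou frontier_K_julia[of z] unfolding julia_set_def z(1) by auto
  qed
  then show ?thesis unfolding U_map_eq by blast
qed

section \<open>Components of the interior of \<open>K\<close> that separate 1 from infinity\<close>

abbreviation cc :: "complex \<Rightarrow> complex set" where
  "cc x \<equiv> connected_component_set (interior K) x"

lemma cc_subset: "cc x \<subseteq> interior K" "cc x \<subseteq> K"
  using connected_component_subset interior_subset by blast+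

lemma cc_self: "x \<in> interior K \<Longrightarrow> x \<in> cc x"
  by (simp add: connected_component_refl_eq)

lemma cc_eq: "y \<in> cc x \<Longrightarrow> cc y = cc x"
  by (metis connected_component_eq)

lemma open_cc: "open (cc x)"
  by (intro open_connected_component open_interior)

lemma continuous_f_iterates: "continuous_on (interior K) (f ^^ n)"
  using holomorphic_f_iterates holomorphic_on_imp_continuous_on by blast

lemma funpow_f_interior: "x \<in> interior K \<Longrightarrow> (f ^^ n) x \<in> interior K"
  by (rule funpow_in[OF f_interior_K])

lemma f_iterate_cc:
  assumes "x \<in> interior K"
  shows "(f ^^ n) ` cc x \<subseteq> cc ((f ^^ n) x)"
proof (rule connected_component_maximal)
  show "(f ^^ n) x \<in> (f ^^ n) ` cc x" using cc_self[OF assms] by blast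
  show "connected ((f ^^ n) ` cc x)"
    by (intro connected_continuous_image continuous_on_subset[OF continuous_f_iterates] cc_subset) simp
  show "(f ^^ n) ` cc x \<subseteq> interior K" using cc_subset funpow_f_interior by blast
qed

lemma f_cc: "x \<in> interior K \<Longrightarrow> f ` cc x \<subseteq> cc (f x)"
  using f_iterate_cc[of x 1] by simp

lemma preimage_interior_K:
  assumes "F (Finite z) = Finite y" "y \<in> interior K"
  shows "z \<in> interior K"
proof -
  let ?W = "{z. F (Finite z) \<in> Finite ` interior K}"
  have "open (F -` (Finite ` interior K))"
    using isCont_F by (intro continuous_open_vimage open_Finite_image) auto
  then have "open ?W" using open_Finite_vimage by fastforce
  moreover have "?W \<subseteq> K"
  proof
    fix w assume "w \<in> ?W"
    then obtain u where "F (Finite w) = Finite u" "u \<in> interior K" by auto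
    then show "w \<in> K" using F_Finite_in_K interior_subset by blast
  qed
  ultimately have "?W \<subseteq> interior K" by (rule interior_maximal[rotated])
  then show ?thesis using assms by auto
qed

lemma K_norm: "z \<in> K \<Longrightarrow> cmod z < R"
proof (rule ccontr)
  assume z: "z \<in> K" "\<not> cmod z < R"
  then have "Finite z \<in> B" using Doo_subset_Boo B_eq by (auto simp: Doo_def)
  then show False using z(1) by (simp add: K_def)
qed

text \<open>Separation of 1 from \<infinity> is witnessed by an open set with frontier in
  \<open>\<beta>\<close>, because this form passes forward under the open map \<open>F\<close>, by
  \<open>frontier_F\<close>.\<close>

definition sep :: "complex set \<Rightarrow> bool" where
  "sep \<beta> \<longleftrightarrow> (\<exists>S. open S \<and> Infinity \<in> S \<and> Finite 1 \<notin> S \<and> frontier S \<subseteq> Finite ` \<beta>)"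

text \<open>\<open>- closure S\<close> is the witness on the other side. The change of side is due
  to \<open>F\<close> interchanging the two points.\<close>

lemma sepI_inside:
  assumes "open S" "Finite 1 \<in> S" "Infinity \<notin> S" "frontier S \<subseteq> Finite ` \<beta>"
  shows "sep \<beta>"
  unfolding sep_def
proof (intro exI conjI)
  show "open (- closure S)" by (intro open_Compl closed_closure)
  show "Infinity \<in> - closure S" using assms by (auto simp: closure_Un_frontier)
  show "Finite 1 \<notin> - closure S" using assms(2) closure_subset by blast
  show "frontier (- closure S) \<subseteq> Finite ` \<beta>" using assms(4) frontier_Compl_closure_subset by blast
qed

lemma F_image_K: "\<beta> \<subseteq> K \<Longrightarrow> (F ^^ n) ` Finite ` \<beta> = Finite ` (f ^^ n) ` \<beta>"
proof -
  assume \<beta>: "\<beta> \<subseteq> K"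
  have "(F ^^ n) ` Finite ` \<beta> = (\<lambda>z. (F ^^ n) (Finite z)) ` \<beta>" by (simp add: image_image)
  also have "\<dots> = (\<lambda>z. Finite ((f ^^ n) z)) ` \<beta>" by (rule image_cong) (use \<beta> funpow_F_K in auto)
  finally show ?thesis by (simp add: image_image)
qed

text \<open>The image of the side of \<infinity> contains 1, the value at \<infinity>, and omits
  \<infinity>, which is taken only at 1. So the image of \<open>\<beta>\<close> separates again,
  with the sides exchanged.\<close>

lemma sep_image:
  assumes "sep \<beta>" "\<beta> \<subseteq> K"
  shows "sep (f ` \<beta>)"
proof -
  obtain S where S: "open S" "Infinity \<in> S" "Finite 1 \<notin> S" "frontier S \<subseteq> Finite ` \<beta>"
    using assms(1) unfolding sep_def by blast
  show ?thesis
  proof (rule sepI_inside)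
    show "open (F ` S)" by (rule open_F[OF S(1)])
    show "Finite 1 \<in> F ` S" using S(2) F_Infinity by (metis imageI)
    show "Infinity \<notin> F ` S" using S(3) F_eq_Infinity_iff by (metis imageE)
    have "frontier (F ` S) \<subseteq> F ` Finite ` \<beta>" using frontier_F[OF S(1)] S(4) by blast
    then show "frontier (F ` S) \<subseteq> Finite ` f ` \<beta>" using F_image_K[OF assms(2), of 1] by simp
  qed
qed

lemma sep_iterate: "sep \<beta> \<Longrightarrow> \<beta> \<subseteq> K \<Longrightarrow> sep ((f ^^ n) ` \<beta>)"
proof (induction n)
  case (Suc n)
  have "(f ^^ n) ` \<beta> \<subseteq> K" using Suc.prems(2) funpow_f_K by blast
  then have "sep (f ` (f ^^ n) ` \<beta>)" using Suc by (intro sep_image) auto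
  then show ?case by (simp add: image_comp)
qed simp

text \<open>The complement of the disc is connected through \<infinity> and contains 1, so a
  frontier inside the disc cannot cut it.\<close>

lemma sep_not_in_ball:
  assumes "e > 0" "e \<le> cmod (w - 1)"
  shows "\<not> sep (ball w e)"
proof
  assume "sep (ball w e)"
  then obtain S where S: "open S" "Infinity \<in> S" "Finite 1 \<notin> S" "frontier S \<subseteq> Finite ` ball w e"
    unfolding sep_def by blast
  \<comment> \<open>Beyond modulus \<open>\<rho>\<close> everything lies off the disc, so the cap
    \<open>D\<close> around \<infinity> can be attached to its finite complement.\<close>
  define \<rho> where "\<rho> = cmod w + e + 1"
  have \<rho>: "\<rho> > 0" using assms(1) by (simp add: \<rho>_def add_nonneg_pos)
  define D where "D = recip ` cball 0 (1 / \<rho>)"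
  let ?C = "Finite ` (- ball w e)"
  have Dfin: "\<rho> \<le> cmod z" if "Finite z \<in> D" for z
  proof -
    have "z \<noteq> 0" "cmod (1 / z) \<le> 1 / \<rho>" using that by (auto simp: D_def Finite_in_recip_image)
    then show ?thesis using \<rho> by (simp add: norm_divide field_simps)
  qed
  have out: "z \<notin> ball w e" if "\<rho> \<le> cmod z" for z
    using that norm_triangle_ineq2[of z w] by (auto simp: \<rho>_def dist_norm norm_minus_commute)
  have "Finite (of_real \<rho>) \<in> D" using \<rho> by (simp add: D_def Finite_in_recip_image norm_divide)
  moreover have "Finite (of_real \<rho>) \<in> ?C" using out[of "of_real \<rho>"] \<rho> by auto
  moreover have "connected D" unfolding D_def
    by (intro connected_continuous_image continuous_on_recip) simp
  ultimately have "connected (?C \<union> D)"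
    by (intro connected_Un connected_Finite_image connected_complement_bounded_convex) auto
  moreover have "(?C \<union> D) \<inter> frontier S = {}"
  proof -
    have "D \<inter> Finite ` ball w e = {}" using Dfin out by blast
    moreover have "?C \<inter> Finite ` ball w e = {}" by auto
    ultimately show ?thesis using S(4) by blast
  qed
  moreover have "Infinity \<in> D" using \<rho> unfolding D_def by (intro image_eqI[of _ _ 0]) auto
  ultimately have "?C \<union> D \<subseteq> S" using S(2) by (intro connected_subset_if_frontier_disjoint) auto
  moreover have "Finite 1 \<in> ?C" using assms(2) by (auto simp: dist_norm)
  ultimately show False using S(3) by blast
qed

lemma sep_mono: "sep \<beta> \<Longrightarrow> \<beta> \<subseteq> \<beta>' \<Longrightarrow> sep \<beta>'"
  unfolding sep_def by (meson image_mono subset_trans)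

lemma sep_nonempty: "sep \<beta> \<Longrightarrow> \<beta> \<noteq> {}"
  using sep_mono[of "{}" "ball 2 1"] sep_not_in_ball[of 1 2] by auto

text \<open>Uniform closeness to a constant \<open>w\<close> would put an image of
  \<open>\<beta>\<close> into the disc about \<open>w\<close> that reaches up to 1, and such a disc
  contains no separating set. That \<open>w\<close> is not 1 follows from its lying in the closed
  set \<open>K\<close>.\<close>

lemma no_constant_limit:
  assumes \<beta>: "\<beta> \<subseteq> K" and sepn: "\<And>n. sep ((f ^^ n) ` \<beta>)"
    and ul: "uniform_limit \<beta> (\<lambda>k. f ^^ (m k)) h sequentially" and h: "\<And>z. z \<in> \<beta> \<Longrightarrow> h z = w"
  shows False
proof -
  obtain b where b: "b \<in> \<beta>" using sep_nonempty[OF sepn[of 0]] by auto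
  have "(\<lambda>k. (f ^^ m k) b) \<longlonglongrightarrow> w" using tendsto_uniform_limitI[OF ul b] h[OF b] by simp
  then have "w \<in> K"
    by (rule Lim_in_closed_set[OF compact_imp_closed[OF compact_K], rotated 2]) (use b \<beta> funpow_f_K in auto)
  then have w1: "cmod (w - 1) > 0" using K_props(1) by auto
  have "\<forall>\<^sub>F k in sequentially. \<forall>z\<in>\<beta>. dist ((f ^^ m k) z) (h z) < cmod (w - 1)"
    by (rule uniform_limitD[OF ul w1])
  then obtain k where k: "\<forall>z\<in>\<beta>. dist ((f ^^ m k) z) (h z) < cmod (w - 1)"
    using eventually_happens'[OF sequentially_bot] by blast
  have "(f ^^ m k) ` \<beta> \<subseteq> ball w (cmod (w - 1))"
  proof
    fix y assume "y \<in> (f ^^ m k) ` \<beta>"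
    then obtain z where z: "z \<in> \<beta>" "y = (f ^^ m k) z" by blast
    then have "dist y w < cmod (w - 1)" using k h by fastforce
    then show "y \<in> ball w (cmod (w - 1))" by (simp add: dist_commute)
  qed
  then have "sep (ball w (cmod (w - 1)))" by (rule sep_mono[OF sepn])
  then show False using sep_not_in_ball[OF w1] by simp
qed

text \<open>By Hurwitz a value of the nonconstant limit cannot be omitted by all late iterates. The
  shift by \<open>N\<close> makes the index arbitrarily large.\<close>

lemma limit_value_attained:
  assumes x: "x \<in> interior K" and \<beta>: "compact \<beta>" "\<beta> \<subseteq> cc x" and sepn: "\<And>n. sep ((f ^^ n) ` \<beta>)"
    and h: "h holomorphic_on interior K"
      "\<And>Q. \<lbrakk>compact Q; Q \<subseteq> interior K\<rbrakk> \<Longrightarrow> uniform_limit Q (\<lambda>k. f ^^ m k) h sequentially"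
  shows "\<not> h constant_on cc x" "z0 \<in> cc x \<Longrightarrow> \<exists>k\<ge>N. h z0 \<in> (f ^^ m k) ` cc x"
proof -
  have \<beta>K: "\<beta> \<subseteq> K" "\<beta> \<subseteq> interior K" using \<beta>(2) cc_subset by blast+
  show nc: "\<not> h constant_on cc x"
    using no_constant_limit[OF \<beta>K(1) sepn h(2)[OF \<beta>(1) \<beta>K(2)]] \<beta>(2) unfolding constant_on_def by blast
  show "\<exists>k\<ge>N. h z0 \<in> (f ^^ m k) ` cc x" if z0: "z0 \<in> cc x"
  proof (rule ccontr)
    assume no: "\<not> ?thesis"
    have "h z0 - h z0 \<noteq> 0"
    proof (rule Hurwitz_no_zeros[where \<F> = "\<lambda>n z. (f ^^ m (n + N)) z - h z0" and S = "cc x" and g = "\<lambda>z. h z - h z0"])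
      show "uniform_limit Q (\<lambda>n z. (f ^^ m (n + N)) z - h z0) (\<lambda>z. h z - h z0) sequentially"
        if "compact Q" "Q \<subseteq> cc x" for Q
      proof -
        have "uniform_limit Q (\<lambda>k. f ^^ m k) h sequentially" using that cc_subset(1) by (intro h(2)) blast+
        then have "uniform_limit Q (\<lambda>n. f ^^ m (n + N)) h sequentially"
          by (rule filterlim_compose[OF _ filterlim_add_const_nat_at_top])
        then show ?thesis by (intro uniform_limit_intros)
      qed
      show "\<not> (\<lambda>z. h z - h z0) constant_on cc x"
        using nc by (simp add: constant_on_def) (metis diff_add_cancel)
      show "(f ^^ m (n + N)) z - h z0 \<noteq> 0" if "z \<in> cc x" for n z
      proof
        assume "(f ^^ m (n + N)) z - h z0 = 0"
        then have "h z0 = (f ^^ m (n + N)) z" by simp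
        then have "h z0 \<in> (f ^^ m (n + N)) ` cc x" using that by blast
        moreover have "n + N \<ge> N" by simp
        ultimately show False using no by blast
      qed
      show "(\<lambda>z. (f ^^ m (n + N)) z - h z0) holomorphic_on cc x" for n
        by (intro holomorphic_intros holomorphic_on_subset[OF holomorphic_f_iterates] cc_subset)
      show "(\<lambda>z. h z - h z0) holomorphic_on cc x"
        by (intro holomorphic_intros holomorphic_on_subset[OF h(1)] cc_subset)
    qed (use z0 open_cc in auto)
    then show False by simp
  qed
qed

text \<open>The value \<open>h x\<close> is attained on the images of \<open>cc x\<close> under two
  different iterates, so the components containing these images coincide. Components carrying a
  separating set therefore do not wander.\<close>

lemma periodic_component:
  assumes x: "x \<in> interior K" and \<beta>: "compact \<beta>" "\<beta> \<subseteq> cc x" "sep \<beta>"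
  obtains x1 p \<beta>1 where "x1 \<in> interior K" "p > 0" "(f ^^ p) x1 \<in> cc x1"
    "compact \<beta>1" "\<beta>1 \<subseteq> cc x1" "sep \<beta>1"
proof -
  have \<beta>K: "\<beta> \<subseteq> K" using \<beta>(2) cc_subset by blast
  have sepn: "sep ((f ^^ n) ` \<beta>)" for n by (rule sep_iterate[OF \<beta>(3) \<beta>K])
  obtain h r where h: "h holomorphic_on interior K" "strict_mono (r :: nat \<Rightarrow> nat)"
    "\<And>Q. \<lbrakk>compact Q; Q \<subseteq> interior K\<rbrakk> \<Longrightarrow> uniform_limit Q (\<lambda>k. f ^^ r k) h sequentially"
    using montel_iterates[of "\<lambda>k. k"] by metis
  note att = limit_value_attained(2)[OF x \<beta>(1,2) sepn h(1,3) cc_self[OF x]]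
  obtain k where k: "h x \<in> (f ^^ r k) ` cc x" using att[of 0] by blast
  obtain l where l: "l \<ge> Suc k" "h x \<in> (f ^^ r l) ` cc x" using att[of "Suc k"] by blast
  have lt: "r k < r l" using h(2) l(1) by (simp add: strict_mono_less)
  let ?x1 = "(f ^^ r k) x"
  have x1: "?x1 \<in> interior K" by (rule funpow_f_interior[OF x])
  have "h x \<in> cc ?x1" "h x \<in> cc ((f ^^ r l) x)" using k l(2) f_iterate_cc[OF x] by blast+
  then have e: "cc ((f ^^ r l) x) = cc ?x1" using cc_eq by metis
  have "(f ^^ r l) x = (f ^^ (r l - r k)) ?x1" using lt by (metis comp_apply funpow_add le_add_diff_inverse2 less_imp_le)
  then have ret: "(f ^^ (r l - r k)) ?x1 \<in> cc ?x1" using e cc_self[OF funpow_f_interior[OF x], of "r l"] by simp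
  show ?thesis
  proof (rule that[OF x1 _ ret _ _ sepn[of "r k"]])
    show "compact ((f ^^ r k) ` \<beta>)"
      by (intro compact_continuous_image continuous_on_subset[OF continuous_f_iterates] \<beta>(1)) (use \<beta>(2) cc_subset in blast)
    show "(f ^^ r k) ` \<beta> \<subseteq> cc ?x1" using \<beta>(2) f_iterate_cc[OF x, of "r k"] by blast
  qed (use lt in simp)
qed

text \<open>Let \<open>\<psi>\<close> be a limit of return iterates and \<open>\<eta>\<close> a
  limit of the iterates leading from one of these to the next. Then \<open>\<eta>\<close> fixes all
  values of the nonconstant \<open>\<psi>\<close>, hence is the identity. So positive iterates of
  \<open>f\<close> converge to the identity, and \<open>f a = f b\<close> forces
  \<open>a = b\<close>.\<close>

lemma injective_on_periodic_component:
  assumes x: "x \<in> interior K" and p: "p > 0" "(f ^^ p) x \<in> cc x" and \<beta>: "compact \<beta>" "\<beta> \<subseteq> cc x" "sep \<beta>"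
  shows "inj_on f (cc x)"
proof -
  let ?o = "cc x"
  have \<beta>K: "\<beta> \<subseteq> K" using \<beta>(2) cc_subset by blast
  have sepn: "sep ((f ^^ n) ` \<beta>)" for n by (rule sep_iterate[OF \<beta>(3) \<beta>K])
  have "(f ^^ p) ` ?o \<subseteq> ?o" using f_iterate_cc[OF x, of p] cc_eq[OF p(2)] by simp
  then have G: "(f ^^ (p * j)) z \<in> ?o" if "z \<in> ?o" for j z
    using funpow_in[of "f ^^ p" ?o z j] that by (simp add: funpow_mult mult.commute)
  obtain \<psi> r where \<psi>: "\<psi> holomorphic_on interior K" "strict_mono (r :: nat \<Rightarrow> nat)"
    "\<And>z. z \<in> interior K \<Longrightarrow> (\<lambda>k. (f ^^ (p * r k)) z) \<longlonglongrightarrow> \<psi> z"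
    "\<And>Q. \<lbrakk>compact Q; Q \<subseteq> interior K\<rbrakk> \<Longrightarrow> uniform_limit Q (\<lambda>k. f ^^ (p * r k)) \<psi> sequentially"
    using montel_iterates[of "\<lambda>k. p * k"] by metis
  have \<psi>nc: "\<not> \<psi> constant_on ?o"
    by (rule limit_value_attained(1)[OF x \<beta>(1,2) sepn \<psi>(1)]) (rule \<psi>(4))
  have \<psi>o: "\<psi> z \<in> ?o" if "z \<in> ?o" for z
  proof -
    have "\<exists>k\<ge>0. \<psi> z \<in> (f ^^ (p * r k)) ` ?o"
      by (rule limit_value_attained(2)[OF x \<beta>(1,2) sepn \<psi>(1) _ that]) (rule \<psi>(4))
    then obtain k where "\<psi> z \<in> (f ^^ (p * r k)) ` ?o" by blast
    then obtain w where "w \<in> ?o" "\<psi> z = (f ^^ (p * r k)) w" by (elim imageE)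
    then show ?thesis using G[of w "r k"] by simp
  qed
  define e where "e = (\<lambda>k. p * (r (Suc k) - r k))"
  obtain \<eta> s where \<eta>: "\<eta> holomorphic_on interior K" "strict_mono (s :: nat \<Rightarrow> nat)"
    "\<And>z. z \<in> interior K \<Longrightarrow> (\<lambda>k. (f ^^ e (s k)) z) \<longlonglongrightarrow> \<eta> z"
    "\<And>Q. \<lbrakk>compact Q; Q \<subseteq> interior K\<rbrakk> \<Longrightarrow> uniform_limit Q (\<lambda>k. f ^^ e (s k)) \<eta> sequentially"
    using montel_iterates[of e] by metis
  have rlt: "r k < r (Suc k)" for k using \<psi>(2) by (simp add: strict_mono_def)
  have fix\<psi>: "\<eta> (\<psi> z) = \<psi> z" if z: "z \<in> ?o" for z
  proof (rule LIMSEQ_unique)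
    have zI: "z \<in> interior K" "\<psi> z \<in> interior K" using z \<psi>o cc_subset by blast+
    obtain \<rho> where \<rho>: "\<rho> > 0" "cball (\<psi> z) \<rho> \<subseteq> interior K"
      using zI(2) open_contains_cball open_interior by blast
    show "(\<lambda>k. (f ^^ e (s k)) ((f ^^ (p * r (s k))) z)) \<longlonglongrightarrow> \<eta> (\<psi> z)"
    proof (rule tendsto_uniform_limit_moving[OF \<eta>(4)[OF compact_cball \<rho>(2)] \<rho>(1)])
      show "(\<lambda>k. (f ^^ (p * r (s k))) z) \<longlonglongrightarrow> \<psi> z"
        using LIMSEQ_subseq_LIMSEQ[OF \<psi>(3)[OF zI(1)] \<eta>(2)] by (simp add: o_def)
      show "isCont \<eta> (\<psi> z)"
        using holomorphic_on_imp_continuous_on[OF \<eta>(1)] zI(2) continuous_on_eq_continuous_at[OF open_interior] by blast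
    qed
    have "(f ^^ e (s k)) ((f ^^ (p * r (s k))) z) = (f ^^ (p * r (Suc (s k)))) z" for k
    proof -
      have "e (s k) + p * r (s k) = p * r (Suc (s k))"
        unfolding e_def using rlt[of "s k"] by (simp add: distrib_left[symmetric])
      then show ?thesis by (metis comp_apply funpow_add)
    qed
    moreover have "strict_mono (\<lambda>k. Suc (s k))" using \<eta>(2) by (simp add: strict_mono_def)
    then have "(\<lambda>k. (f ^^ (p * r (Suc (s k)))) z) \<longlonglongrightarrow> \<psi> z"
      using LIMSEQ_subseq_LIMSEQ[OF \<psi>(3)[OF zI(1)]] by (simp add: o_def)
    ultimately show "(\<lambda>k. (f ^^ e (s k)) ((f ^^ (p * r (s k))) z)) \<longlonglongrightarrow> \<psi> z" by simp
  qed
  have o\<psi>: "open (\<psi> ` ?o)"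
    by (rule open_mapping_thm[OF holomorphic_on_subset[OF \<psi>(1) cc_subset(1)] open_cc _ open_cc order_refl \<psi>nc]) simp
  have id: "\<eta> z = z" if "z \<in> ?o" for z
  proof (rule analytic_continuation_open[of "\<psi> ` ?o" ?o \<eta> "\<lambda>z. z"])
    show "\<psi> ` ?o \<noteq> {}" using cc_self[OF x] by blast
    show "\<psi> ` ?o \<subseteq> ?o" using \<psi>o by blast
    show "\<eta> holomorphic_on ?o" by (rule holomorphic_on_subset[OF \<eta>(1) cc_subset(1)])
  qed (use o\<psi> open_cc fix\<psi> that in auto)
  show ?thesis
  proof (rule inj_onI)
    fix a b assume ab: "a \<in> ?o" "b \<in> ?o" "f a = f b"
    have "(f ^^ e (s k)) a = (f ^^ e (s k)) b" for k
    proof -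
      obtain j where "e (s k) = Suc j" unfolding e_def using rlt[of "s k"] p(1)
        by (metis gr0_conv_Suc nat_0_less_mult_iff zero_less_diff)
      then show ?thesis using ab(3) by (simp add: funpow_swap1)
    qed
    moreover have "(\<lambda>k. (f ^^ e (s k)) a) \<longlonglongrightarrow> a" "(\<lambda>k. (f ^^ e (s k)) b) \<longlonglongrightarrow> b"
      using \<eta>(3)[of a] \<eta>(3)[of b] id ab(1,2) cc_subset(1) by (auto simp: subset_iff)
    ultimately show "a = b" using LIMSEQ_unique by fastforce
  qed
qed

text \<open>A suitable component \<open>\<beta>\<close> of the frontier of an open set splitting the
  frontier of \<open>K\<close> lies in the interior of \<open>K\<close>, since the connected
  \<open>K\<close> must meet it. It need not separate 1 from \<infinity>, but it encloses basin
  points. One step before the image of the enclosed region first contains \<infinity>, that image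
  contains 1, and its frontier lies in an image of \<open>\<beta>\<close>.\<close>

lemma disconnected_frontier_sep:
  assumes "\<not> connected (frontier K)"
  obtains x \<beta> where "x \<in> interior K" "compact \<beta>" "\<beta> \<subseteq> cc x" "sep \<beta>"
proof -
  have clK: "closed K" by (rule compact_imp_closed[OF compact_K])
  obtain J1 J2 where J: "closed J1" "closed J2" "J1 \<noteq> {}" "J2 \<noteq> {}" "J1 \<union> J2 = frontier K" "J1 \<inter> J2 = {}"
    using assms[unfolded connected_closed_set[OF frontier_closed]] by (simp only: not_not) (elim exE conjE)
  obtain x y where xy: "x \<in> J1" "y \<in> J2" using J by blast
  obtain S where S: "open S" "J1 \<subseteq> S" "S \<inter> J2 = {}" "frontier S \<inter> (J1 \<union> J2) = {}"
    by (rule separate_closed_by_open[OF J(1,2,6,3,4)])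
  have disj: "frontier S \<inter> frontier K = {}" using S(4) J(5) by simp
  have "x \<in> S" "y \<notin> S" using S(2,3) xy by auto
  then have "\<not> connected_component (- frontier S) x y"
    unfolding connected_component_def using connected_Int_frontier[of _ S] by blast
  then obtain \<beta> where \<beta>: "\<beta> \<in> components (frontier S)" "\<not> connected_component (- \<beta>) x y"
    using separation_by_component_closed_pointwise[OF frontier_closed] by blast
  have c\<beta>: "connected \<beta>" "\<beta> \<subseteq> frontier S" "closed \<beta>"
    using \<beta>(1) in_components_connected in_components_subset closed_components[OF frontier_closed] by blast+
  have frK: "frontier K \<subseteq> K" by (rule frontier_subset_closed[OF clK])
  have xyK: "x \<in> frontier K" "y \<in> frontier K" using xy J(5) by auto
  have "\<beta> \<inter> K \<noteq> {}"
  proof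
    assume "\<beta> \<inter> K = {}"
    then have "K \<subseteq> - \<beta>" by blast
    then have "connected_component (- \<beta>) x y"
      using connected_K xyK frK unfolding connected_component_def by blast
    then show False using \<beta>(2) by blast
  qed
  then have "\<beta> \<subseteq> K" using c\<beta> disj by (intro connected_subset_if_frontier_disjoint) auto
  then have \<beta>I: "\<beta> \<subseteq> interior K" using c\<beta>(2) disj clK by (auto simp: frontier_def)
  then have cp\<beta>: "compact \<beta>" using c\<beta>(3) compact_K \<open>\<beta> \<subseteq> K\<close> by (metis compact_Int_closed inf.absorb_iff2)
  obtain x0 where x0: "x0 \<in> \<beta>" using \<open>\<beta> \<inter> K \<noteq> {}\<close> by blast
  have \<beta>cc: "\<beta> \<subseteq> cc x0" by (rule connected_component_maximal[OF x0 c\<beta>(1) \<beta>I])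
  \<comment> \<open>Two points separated by \<open>\<beta>\<close> cannot both be joined to the far
    region.\<close>
  have "\<exists>v\<in>{x, y}. \<not> connected_component (- \<beta>) v (of_real R)"
    using \<beta>(2) connected_component_trans connected_component_sym by blast
  then obtain v where v: "v \<in> frontier K" "\<not> connected_component (- \<beta>) v (of_real R)" using xyK by blast
  define S0 where "S0 = connected_component_set (- \<beta>) v"
  have v\<beta>: "v \<notin> \<beta>" using v(1) disj c\<beta>(2) by blast
  have vS: "v \<in> S0" using v\<beta> by (simp add: S0_def connected_component_refl_eq)
  have oS0: "open S0" unfolding S0_def by (intro open_connected_component) (use c\<beta>(3) in auto)
  have frS0: "frontier S0 \<subseteq> \<beta>"
    by (rule frontier_of_components_closed_complement[OF c\<beta>(3)]) (use v\<beta> in \<open>auto simp: S0_def intro: componentsI\<close>)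
  have "S0 \<subseteq> ball 0 R"
  proof (rule ccontr)
    assume "\<not> ?thesis"
    then obtain z where z: "z \<in> S0" "R \<le> cmod z" by force
    have "{z. R \<le> cmod z} \<subseteq> S0" unfolding S0_def
      by (rule connected_subset_component[OF connected_far, where p = z])
        (use z \<open>\<beta> \<subseteq> K\<close> K_norm in \<open>auto simp: S0_def not_less[symmetric]\<close>)
    then have "of_real R \<in> S0" using R_gt_1 by auto
    then show False using v(2) by (simp add: S0_def)
  qed
  then have bS0: "bounded S0" using bounded_subset bounded_ball by blast
  have "v \<in> closure (- K)" using v(1) by (simp add: frontier_closures)
  then obtain b where b: "b \<in> S0" "b \<notin> K" using oS0 vS by (metis ComplD disjoint_iff open_Int_closure_eq_empty)
  let ?S = "Finite ` S0"
  have oS': "open ?S" by (rule open_Finite_image[OF oS0])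
  have fr': "frontier ?S \<subseteq> Finite ` \<beta>" using frontier_Finite_image[OF bS0] frS0 by blast
  have frn: "frontier ((F ^^ n) ` ?S) \<subseteq> Finite ` (f ^^ n) ` \<beta>" for n
    using order_trans[OF frontier_funpow_F[OF oS'] image_mono[OF fr']] unfolding F_image_K[OF \<open>\<beta> \<subseteq> K\<close>] .
  have "\<exists>n. Infinity \<in> (F ^^ n) ` ?S"
  proof -
    have "Finite b \<in> B" using b(2) by (simp add: K_def)
    then obtain n0 where "(F ^^ n0) (Finite b) \<in> V" by (auto simp: B_def)
    then have "(F ^^ n0) (Finite b) \<in> Voo \<or> (F ^^ Suc n0) (Finite b) \<in> Voo" using FV by (auto simp: V_def)
    then obtain n where n: "(F ^^ n) (Finite b) \<in> Voo" by blast
    have "Voo \<subseteq> B" using Voo_subset_Doo Doo_subset_Boo B_eq by blast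
    then have "Voo \<inter> Finite ` K = {}" using Finite_K by blast
    moreover have "(f ^^ n) ` \<beta> \<subseteq> K" using \<open>\<beta> \<subseteq> K\<close> funpow_f_K by auto
    then have "frontier ((F ^^ n) ` ?S) \<subseteq> Finite ` K" using order_trans[OF frn image_mono] by simp
    ultimately have "Voo \<inter> frontier ((F ^^ n) ` ?S) = {}" by (metis Int_mono bot.extremum_uniqueI order_refl)
    then have "Voo \<subseteq> (F ^^ n) ` ?S"
      using n b(1) by (intro connected_subset_if_frontier_disjoint connected_Voo) auto
    then show ?thesis using Infinity_in by blast
  qed
  then obtain n where n: "Infinity \<in> (F ^^ n) ` ?S" "\<And>m. m < n \<Longrightarrow> Infinity \<notin> (F ^^ m) ` ?S"
    using exists_least_iff[of "\<lambda>n. Infinity \<in> (F ^^ n) ` ?S"] by blast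
  have "n \<noteq> 0" using n(1) by (intro notI) auto
  then obtain m where m: "n = Suc m" using not0_implies_Suc by blast
  have "Infinity \<in> F ` (F ^^ m) ` ?S" using n(1) unfolding m by (simp add: image_comp)
  then have 1: "Finite 1 \<in> (F ^^ m) ` ?S" by (metis F_eq_Infinity_iff imageE)
  have sp: "sep ((f ^^ m) ` \<beta>)"
    by (rule sepI_inside[OF open_funpow_F[OF oS'] 1 _ frn]) (use n(2) m in simp)
  have x0I: "x0 \<in> interior K" using x0 \<beta>I by blast
  show ?thesis
  proof (rule that[OF funpow_f_interior[OF x0I, of m] _ _ sp])
    show "compact ((f ^^ m) ` \<beta>)"
      by (intro compact_continuous_image continuous_on_subset[OF continuous_f_iterates \<beta>I] cp\<beta>)
    show "(f ^^ m) ` \<beta> \<subseteq> cc ((f ^^ m) x0)" using \<beta>cc f_iterate_cc[OF x0I, of m] by blast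
  qed
qed

section \<open>The side of infinity of a component\<close>

definition outer :: "complex set \<Rightarrow> complex set" where
  "outer O' = connected_component_set (- O') (of_real R)"

text \<open>For \<open>O'\<close> inside \<open>K\<close> this is the component of \<infinity> in
  the complement of \<open>O'\<close> on the sphere; see
  \<open>outer_sphere_maximal\<close>.\<close>

definition outer_sphere :: "complex set \<Rightarrow> riemann_sphere set" where
  "outer_sphere O' = Finite ` outer O' \<union> Doo"

lemma outer_far:
  assumes "O' \<subseteq> K"
  shows "{z. R \<le> cmod z} \<subseteq> outer O'" "of_real R \<in> outer O'" "outer O' \<subseteq> - O'"
proof -
  have far: "{z. R \<le> cmod z} \<subseteq> - O'" using assms K_norm by (auto simp: not_less[symmetric])
  moreover have R: "complex_of_real R \<in> {z. R \<le> cmod z}" using R_gt_1 by simp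
  ultimately have "complex_of_real R \<in> - O'" by (rule subsetD)
  then show R': "of_real R \<in> outer O'" by (simp add: outer_def connected_component_refl_eq)
  show "{z. R \<le> cmod z} \<subseteq> outer O'" unfolding outer_def
    by (rule connected_subset_component[OF connected_far far R]) (use R' in \<open>simp add: outer_def\<close>)
  show "outer O' \<subseteq> - O'" unfolding outer_def by (rule connected_component_subset)
qed

lemma outer_component: "O' \<subseteq> K \<Longrightarrow> outer O' \<in> components (- O')"
  using outer_far(2,3)[of O'] unfolding outer_def by (auto intro: componentsI)

lemma closed_outer: "open O' \<Longrightarrow> O' \<subseteq> K \<Longrightarrow> closed (outer O')"
  using closed_components[OF closed_Compl outer_component] by simp

lemma outer_sphere_iff:
  assumes "O' \<subseteq> K"
  shows "Finite z \<in> outer_sphere O' \<longleftrightarrow> z \<in> outer O'" "Infinity \<in> outer_sphere O'"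
  using outer_far(1)[OF assms] by (auto simp: outer_sphere_def Doo_def)

lemma closed_outer_sphere:
  assumes "open O'" "O' \<subseteq> K"
  shows "closed (outer_sphere O')"
proof -
  have "- outer_sphere O' = Finite ` (- outer O')"
  proof -
    have "x \<in> - outer_sphere O' \<longleftrightarrow> x \<in> Finite ` (- outer O')" for x
      by (cases x) (auto simp: outer_sphere_iff[OF assms(2)])
    then show ?thesis by blast
  qed
  moreover have "open (Finite ` (- outer O'))" using closed_outer[OF assms] by (intro open_Finite_image open_Compl)
  ultimately show ?thesis by (simp add: closed_def)
qed

lemma connected_outer_sphere:
  assumes "O' \<subseteq> K"
  shows "connected (outer_sphere O')"
proof -
  have "Finite (of_real R) \<in> Finite ` outer O' \<inter> Doo"
    using outer_far(2)[OF assms] R_gt_1 by (auto simp: Doo_def)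
  moreover have "connected (outer O')" by (simp add: outer_def)
  ultimately show ?thesis unfolding outer_sphere_def
    by (intro connected_Un connected_Finite_image connected_Doo) auto
qed

lemma outer_sphere_disjoint: "O' \<subseteq> K \<Longrightarrow> outer_sphere O' \<inter> Finite ` O' = {}"
  using outer_sphere_iff outer_far(3) by blast

lemma outer_sphere_maximal:
  assumes O': "O' \<subseteq> K" and C: "connected C" "Infinity \<in> C" "C \<inter> Finite ` O' = {}"
  shows "C \<subseteq> outer_sphere O'"
proof -
  let ?T = "C \<union> Doo"
  have "connected ?T" using C(1,2) Infinity_in by (intro connected_Un connected_Doo) auto
  then have 1: "connected {z. Finite z \<in> ?T}" by (rule connected_finite_part) simp
  have "Doo \<inter> Finite ` O' = {}" using Doo_subset_Boo B_eq Finite_K O' by blast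
  then have 2: "{z. Finite z \<in> ?T} \<subseteq> - O'" using C(3) by blast
  have "of_real R \<in> {z. Finite z \<in> ?T}" using R_gt_1 by (auto simp: Doo_def)
  then have "{z. Finite z \<in> ?T} \<subseteq> outer O'"
    unfolding outer_def using connected_component_maximal[OF _ 1 2] by blast
  then have "x \<in> outer_sphere O'" if "x \<in> C" for x
    using that outer_sphere_iff[OF O'] by (cases x) auto
  then show ?thesis by blast
qed

lemma sep_outer:
  assumes O': "O' \<subseteq> K" and "sep \<beta>" "\<beta> \<subseteq> O'"
  obtains S where "open S" "outer_sphere O' \<subseteq> S" "Finite 1 \<notin> S" "frontier S \<subseteq> Finite ` O'"
proof -
  obtain S where S: "open S" "Infinity \<in> S" "Finite 1 \<notin> S" "frontier S \<subseteq> Finite ` \<beta>"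
    using assms(2) unfolding sep_def by blast
  have fr: "frontier S \<subseteq> Finite ` O'" using S(4) assms(3) by blast
  have "outer_sphere O' \<inter> frontier S = {}" using outer_sphere_disjoint[OF O'] fr by blast
  moreover have "outer_sphere O' \<inter> S \<noteq> {}" using outer_sphere_iff(2)[OF O'] S(2) by blast
  ultimately have "outer_sphere O' \<subseteq> S"
    by (rule connected_subset_if_frontier_disjoint[OF connected_outer_sphere[OF O']])
  then show ?thesis using that S fr by blast
qed

text \<open>The open set from \<open>sep_outer\<close> contains the side of \<infinity> but not 1,
  and its frontier lies in \<open>O'\<close>, which \<open>Z\<close> avoids.\<close>

lemma outer_sphere_avoids:
  assumes O': "O' \<subseteq> K" and "sep \<beta>" "\<beta> \<subseteq> O'" and Z: "connected Z" "Finite 1 \<in> Z" "Z \<inter> Finite ` O' = {}"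
  shows "Z \<inter> outer_sphere O' = {}"
proof -
  obtain S where S: "open S" "outer_sphere O' \<subseteq> S" "Finite 1 \<notin> S" "frontier S \<subseteq> Finite ` O'"
    using sep_outer[OF assms(1-3)] by blast
  have "Z \<inter> S = {}"
  proof (rule ccontr)
    assume "Z \<inter> S \<noteq> {}"
    moreover have "Z \<inter> frontier S = {}" using Z(3) S(4) by blast
    ultimately have "Z \<subseteq> S" by (intro connected_subset_if_frontier_disjoint[OF Z(1)])
    then show False using Z(2) S(3) by blast
  qed
  then show ?thesis using S(2) by blast
qed

lemma one_notin_outer: "O' \<subseteq> K \<Longrightarrow> sep \<beta> \<Longrightarrow> \<beta> \<subseteq> O' \<Longrightarrow> 1 \<notin> outer O'"
  using sep_outer outer_sphere_iff(1) by (metis subsetD)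

text \<open>If \<open>cc y\<close> misses the side of \<infinity> of \<open>cc x\<close>, that side
  is a connected set through \<infinity> off \<open>cc y\<close>. Otherwise \<open>cc y\<close> lies
  within it, and the rest of the plane is a connected set through 1 off \<open>cc y\<close>, hence
  disjoint from the side of \<infinity> of \<open>cc y\<close>.\<close>

lemma outer_nested:
  assumes x: "sep \<beta>" "\<beta> \<subseteq> cc x" and y: "sep \<gamma>" "\<gamma> \<subseteq> cc y"
  shows "outer_sphere (cc x) \<subseteq> outer_sphere (cc y) \<or> outer_sphere (cc y) \<subseteq> outer_sphere (cc x)"
proof (cases "cc x = cc y")
  case False
  then have disj: "cc x \<inter> cc y = {}" using cc_eq by blast
  show ?thesis
  proof (cases "cc y \<inter> outer (cc x) = {}")
    case True
    then have "outer_sphere (cc x) \<inter> Finite ` cc y = {}"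
      using outer_sphere_iff[OF cc_subset(2)] by blast
    then show ?thesis
      using outer_sphere_maximal[OF cc_subset(2) connected_outer_sphere[OF cc_subset(2)] outer_sphere_iff(2)[OF cc_subset(2)]] by blast
  next
    case False
    then obtain p where p: "p \<in> cc y" "p \<in> outer (cc x)" by blast
    have "cc y \<subseteq> outer (cc x)" unfolding outer_def
      by (rule connected_subset_component[where p = p]) (use disj p in \<open>auto simp: outer_def\<close>)
    then have "Finite ` (- outer (cc x)) \<inter> Finite ` cc y = {}" by blast
    moreover have "connected (Finite ` (- outer (cc x)))"
      by (intro connected_Finite_image component_complement_connected[OF _ outer_component] cc_subset) simp
    moreover have "Finite 1 \<in> Finite ` (- outer (cc x))"
      using one_notin_outer[OF cc_subset(2) x] by blast
    ultimately have "Finite ` (- outer (cc x)) \<inter> outer_sphere (cc y) = {}"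
      by (intro outer_sphere_avoids[OF cc_subset(2) y]) auto
    then have "z \<in> outer_sphere (cc x)" if "z \<in> outer_sphere (cc y)" for z
      using that outer_sphere_iff[OF cc_subset(2)] by (cases z) auto
    then show ?thesis by blast
  qed
qed simp

text \<open>Otherwise the component of \<open>f x\<close> contains 0 or cuts it off from
  \<infinity>. Either way it holds a continuum with connected preimage. This preimage lies in
  \<open>cc x\<close> and contains all \<open>d\<close> preimages of some nonzero point, against
  injectivity.\<close>

lemma zero_in_outer:
  assumes x: "x \<in> interior K" and inj: "inj_on f (cc x)"
  shows "0 \<in> outer (cc (f x))"
proof (rule ccontr)
  assume no: "0 \<notin> outer (cc (f x))"
  let ?o = "cc (f x)"
  have fx: "f x \<in> ?o" using f_cc[OF x] cc_self[OF x] by blast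
  have pc: "path_connected ?o" using open_cc by (simp add: connected_open_path_connected)
  have path: "\<exists>P. compact P \<and> connected P \<and> P \<subseteq> ?o \<and> f x \<in> P \<and> y \<in> P" if y: "y \<in> ?o" for y
  proof -
    obtain \<gamma> where \<gamma>: "path \<gamma>" "path_image \<gamma> \<subseteq> ?o" "pathstart \<gamma> = f x" "pathfinish \<gamma> = y"
      using pc fx y unfolding path_connected_def by metis
    show ?thesis
      using \<gamma>(2) compact_path_image[OF \<gamma>(1)] connected_path_image[OF \<gamma>(1)]
        pathstart_in_path_image[of \<gamma>] pathfinish_in_path_image[of \<gamma>] unfolding \<gamma>(3,4) by blast
  qed
  \<comment> \<open>Containing \<open>f x\<close> makes the preimage of \<open>\<kappa>\<close> meet
    \<open>cc x\<close>; the nonzero point \<open>y\<close> has several d-th roots.\<close>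
  have "\<exists>\<kappa> y. connected (F -` (Finite ` \<kappa>)) \<and> \<kappa> \<subseteq> ?o \<and> f x \<in> \<kappa> \<and> y \<in> \<kappa> \<and> y \<noteq> 0"
  proof (cases "0 \<in> ?o")
    case True
    obtain y where y: "y \<in> ?o" "y \<noteq> 0"
    proof -
      have "?o \<noteq> {0}" using open_cc[of "f x"] not_open_singleton[of "0::complex"] by metis
      then show ?thesis using True that by blast
    qed
    obtain P where P: "compact P" "connected P" "P \<subseteq> ?o" "f x \<in> P" "0 \<in> P" using path[OF True] by blast
    obtain P' where P': "compact P'" "connected P'" "P' \<subseteq> ?o" "f x \<in> P'" "y \<in> P'" using path[OF y(1)] by blast
    have "connected (P \<union> P')" using P P' by (intro connected_Un) auto
    moreover have "compact (P \<union> P')" using P P' by auto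
    ultimately have "connected (F -` (Finite ` (P \<union> P')))" using P(5) F_eq_0
      by (intro connected_preimage_critical[of _ "Finite 0" "Finite (1 - lam)"] connected_Finite_image
          compact_imp_closed[OF compact_continuous_image] continuous_on_Finite) auto
    then show ?thesis using P P' y(2) by (intro exI[of _ "P \<union> P'"] exI[of _ y]) auto
  next
    case False
    let ?X = "- (Finite ` ?o)"
    have clX: "closed ?X" using open_cc by (intro closed_Compl open_Finite_image)
    have nC: "Finite 0 \<notin> C" if "connected C" "C \<subseteq> ?X" "Infinity \<in> C" for C
    proof -
      have "C \<subseteq> outer_sphere ?o" using that by (intro outer_sphere_maximal cc_subset) auto
      then show ?thesis using no outer_sphere_iff(1)[OF cc_subset(2)] by blast
    qed
    have X: "Infinity \<in> ?X" "Finite 0 \<in> ?X" using False by auto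
    \<comment> \<open>Only one point has to be cut off, so it is passed for both \<open>p\<close>
      and \<open>q\<close>.\<close>
    obtain S where S: "open S" "Infinity \<in> S" "Finite 0 \<notin> S" "Finite 0 \<notin> S" "frontier S \<inter> ?X = {}"
      by (rule clopen_separation[OF closed_imp_compact_sphere[OF clX] X(1,2) nC X(2) nC])
    have frS: "frontier S \<subseteq> Finite ` ?o" using S(5) by blast
    define \<beta> where "\<beta> = {z. Finite z \<in> frontier S}"
    have cl\<beta>: "closed \<beta>" unfolding \<beta>_def by (intro closed_Finite_vimage frontier_closed)
    have \<beta>o: "\<beta> \<subseteq> ?o" using frS by (auto simp: \<beta>_def)
    have ncc: "\<not> connected_component (- \<beta>) 0 (of_real R)"
    proof
      assume "connected_component (- \<beta>) 0 (of_real R)"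
      then obtain D where D: "connected D" "D \<subseteq> - \<beta>" "0 \<in> D" "of_real R \<in> D" unfolding connected_component_def by blast
      have "Finite (of_real R) \<in> Finite ` D \<inter> Doo" using D(4) R_gt_1 by (auto simp: Doo_def)
      then have "connected (Finite ` D \<union> Doo)" by (intro connected_Un connected_Finite_image D connected_Doo) auto
      moreover have "Doo \<inter> Finite ` ?o = {}" using Doo_subset_Boo B_eq Finite_K cc_subset(2) by blast
      then have "(Finite ` D \<union> Doo) \<inter> frontier S = {}" using D(2) frS by (auto simp: \<beta>_def)
      ultimately have "Finite ` D \<union> Doo \<subseteq> S"
        using S(2) Infinity_in by (intro connected_subset_if_frontier_disjoint) auto
      then show False using D(3) S(3) by blast
    qed
    then obtain \<kappa>0 where \<kappa>0: "\<kappa>0 \<in> components \<beta>" "\<not> connected_component (- \<kappa>0) 0 (of_real R)"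
      using separation_by_component_closed_pointwise[OF cl\<beta>] by blast
    have \<kappa>0': "connected \<kappa>0" "\<kappa>0 \<subseteq> ?o" "closed \<kappa>0" "\<kappa>0 \<noteq> {}"
      using \<kappa>0(1) in_components_connected in_components_subset closed_components[OF cl\<beta>] in_components_nonempty \<beta>o by blast+
    have "\<kappa>0 \<subseteq> K" using \<kappa>0'(2) cc_subset(2) by blast
    then have cp: "compact \<kappa>0" using \<kappa>0'(3) compact_K by (metis compact_Int_closed inf.absorb_iff2)
    obtain k where k: "k \<in> \<kappa>0" using \<kappa>0'(4) by blast
    then have "k \<in> ?o" using \<kappa>0'(2) by blast
    then obtain P where P: "compact P" "connected P" "P \<subseteq> ?o" "f x \<in> P" "k \<in> P" using path by blast
    let ?\<kappa> = "\<kappa>0 \<union> P"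
    have 1: "connected ?\<kappa>" using \<kappa>0' P k by (intro connected_Un) auto
    have 2: "compact ?\<kappa>" using cp P by auto
    have \<kappa>o: "?\<kappa> \<subseteq> ?o" using \<kappa>0'(2) P(3) by blast
    have 3: "0 \<notin> ?\<kappa>" using False \<kappa>o by blast
    have "connected_component_set (- ?\<kappa>) 0 \<subseteq> ball 0 R"
    proof (rule ccontr)
      assume "\<not> ?thesis"
      then obtain z where z: "z \<in> connected_component_set (- ?\<kappa>) 0" "R \<le> cmod z" by force
      have "{z. R \<le> cmod z} \<subseteq> connected_component_set (- ?\<kappa>) 0"
        by (rule connected_subset_component[OF connected_far, where p = z])
          (use z \<kappa>o cc_subset(2) K_norm in \<open>force simp: not_less[symmetric]\<close>)+
      moreover have "complex_of_real R \<in> {z. R \<le> cmod z}" using R_gt_1 by simp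
      ultimately have "connected_component (- ?\<kappa>) 0 (of_real R)" by blast
      then have "connected_component (- \<kappa>0) 0 (of_real R)"
        using connected_component_mono[of "- ?\<kappa>" "- \<kappa>0" 0] by blast
      then show False using \<kappa>0(2) by blast
    qed
    then have 4: "bounded (connected_component_set (- ?\<kappa>) 0)" using bounded_subset bounded_ball by blast
    have "connected (F -` (Finite ` ?\<kappa>))" by (rule connected_preimage_annular[OF 2 1 3 4])
    then show ?thesis using \<kappa>o P(4) 3 by (intro exI[of _ ?\<kappa>] exI[of _ "f x"]) auto
  qed
  then obtain \<kappa> y where \<kappa>: "connected (F -` (Finite ` \<kappa>))" "\<kappa> \<subseteq> ?o" "f x \<in> \<kappa>" "y \<in> \<kappa>" "y \<noteq> 0" by blast
  let ?T = "{z. Finite z \<in> F -` (Finite ` \<kappa>)}"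
  have "1 \<notin> \<kappa>" using \<kappa>(2) cc_subset(2) K_props(1) by blast
  then have inf: "Infinity \<notin> F -` (Finite ` \<kappa>)" by auto
  have coT: "connected ?T" by (rule connected_Finite_vimage[OF \<kappa>(1) inf])
  have TI: "?T \<subseteq> interior K" using preimage_interior_K \<kappa>(2) cc_subset(1) by fastforce
  have "x \<noteq> 1" using x interior_subset K_props(1) by blast
  then have xT: "x \<in> ?T" using \<kappa>(3) by simp
  have Tcc: "?T \<subseteq> cc x" by (rule connected_component_maximal[OF xT coT TI])
  have "card {w. w ^ d = y} = d" using card_nth_roots[of y d] \<kappa>(5) d by simp
  then have "\<not> card {w. w ^ d = y} \<le> 1" using d by simp
  moreover have fin: "finite {w. w ^ d = y}" using \<open>card {w. w ^ d = y} = d\<close> d by (intro card_ge_0_finite) simp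
  ultimately obtain w1 w2 where w: "w1 ^ d = y" "w2 ^ d = y" "w1 \<noteq> w2"
    using card_le_Suc0_iff_eq[OF fin] by auto
  have pre: "\<exists>z\<in>cc x. Finite z = msp (Finite w) \<and> f z = y" if "w ^ d = y" for w
  proof -
    have Fm: "F (msp (Finite w)) = Finite y" unfolding F_def msp_msp using that by simp
    then have "msp (Finite w) \<in> F -` (Finite ` \<kappa>)" using \<kappa>(4) by simp
    moreover from this obtain z where z: "msp (Finite w) = Finite z" using inf by (cases "msp (Finite w)") auto
    ultimately have "z \<in> cc x" using Tcc by auto
    moreover have "f z = y" using Fm calculation cc_subset(2) K_props(1) unfolding z by (metis F_Finite riemann_sphere.inject subsetD)
    ultimately show ?thesis using z by auto
  qed
  obtain z1 where z1: "z1 \<in> cc x" "Finite z1 = msp (Finite w1)" "f z1 = y" using pre[OF w(1)] by blast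
  obtain z2 where z2: "z2 \<in> cc x" "Finite z2 = msp (Finite w2)" "f z2 = y" using pre[OF w(2)] by blast
  have "z1 = z2" using inj_onD[OF inj] z1 z2 by blast
  then have "msp (msp (Finite w1)) = msp (msp (Finite w2))" using z1(2) z2(2) by simp
  then show False using w(3) unfolding msp_msp by simp
qed

text \<open>Off the side of \<infinity> of \<open>cc (f x)\<close> there is a branch
  \<open>G\<close> of the inverse of \<open>F\<close> with \<open>G 1\<close> at \<infinity>. Its
  image \<open>N\<close> is open, \<open>F\<close> is injective on it, and \<open>F\<close> maps its
  frontier into that side; so a connected set through \<infinity> whose image avoids the side stays
  in \<open>N\<close>. The second claim prepares the condition \<open>branch\<close> of
  \<open>no_swapped_continuum\<close>.\<close>

lemma outer_branch:
  assumes x: "x \<in> interior K" and \<beta>: "sep \<beta>" "\<beta> \<subseteq> cc x" and zero: "0 \<in> outer (cc (f x))"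
  shows "F ` outer_sphere (cc x) \<inter> Finite ` cc (f x) = {}" (is ?a)
    and "\<lbrakk>connected C; Infinity \<in> C; F ` C \<inter> outer_sphere (cc (f x)) = {};
      connected Z; Finite 1 \<in> Z; Z \<inter> Finite ` cc x = {}\<rbrakk> \<Longrightarrow> C \<inter> Z = {}" (is "PROP ?b")
proof -
  let ?o = "cc (f x)" and ?Y = "outer_sphere (cc x)" and ?Y' = "outer_sphere (cc (f x))"
  have oK: "cc x \<subseteq> K" "?o \<subseteq> K" by (rule cc_subset(2))+
  have f\<beta>: "sep (f ` \<beta>)" "f ` \<beta> \<subseteq> ?o" using sep_image[OF \<beta>(1)] \<beta>(2) oK f_cc[OF x] by blast+
  define Om where "Om = - outer ?o"
  have cl: "closed (outer ?o)" by (rule closed_outer[OF open_cc oK(2)])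
  have Om: "open Om" "connected Om" "1 \<in> Om" "0 \<notin> Om"
    using cl one_notin_outer[OF oK(2) f\<beta>] zero component_complement_connected[OF _ outer_component[OF oK(2)]]
    by (auto simp: Om_def)
  have co: "connected (- Om)" by (simp add: Om_def outer_def)
  have "\<not> bounded (outer ?o)"
  proof
    assume "bounded (outer ?o)"
    then have "bounded {z::complex. R \<le> cmod z}" using outer_far(1)[OF oK(2)] bounded_subset by blast
    then have "bounded ({z::complex. R \<le> cmod z} \<union> ball 0 R)" by (simp add: bounded_Un)
    moreover have "{z::complex. R \<le> cmod z} \<union> ball 0 R = UNIV" by auto
    ultimately show False by simp
  qed
  then have ub: "\<not> bounded (- Om)" by (simp add: Om_def)
  obtain r where r: "r holomorphic_on Om" "\<And>z. z \<in> Om \<Longrightarrow> r z ^ d = z" "r 1 = 1"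
    using root_branch[OF Om(1,2) co ub Om(4,3)] by metis
  have Y'_iff: "Finite z \<in> ?Y' \<longleftrightarrow> z \<notin> Om" for z using outer_sphere_iff(1)[OF oK(2)] by (simp add: Om_def)
  have Y'_inf: "Infinity \<in> ?Y'" by (rule outer_sphere_iff(2)[OF oK(2)])
  define G where "G = (\<lambda>z. msp (Finite (r z)))"
  define N where "N = G ` Om"
  have FG: "F (G z) = Finite z" if "z \<in> Om" for z unfolding G_def by (rule F_branch[OF r(2)[OF that]])
  have G1: "G 1 = Infinity" by (simp add: G_def r)
  have contG: "continuous_on Om G" unfolding G_def by (rule continuous_on_branch[OF r(1)])
  have "inj_on r Om" by (rule inj_on_inverseI[where g = "\<lambda>w. w ^ d"]) (rule r(2))
  then have "open (r ` Om)" using open_mapping_thm3[OF r(1) Om(1)] by blast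
  then have "open (msp -` (Finite ` r ` Om))" using isCont_msp by (intro continuous_open_vimage open_Finite_image) auto
  moreover have "N = msp -` (Finite ` r ` Om)"
  proof (intro equalityI subsetI)
    fix v assume "v \<in> N"
    then show "v \<in> msp -` (Finite ` r ` Om)" unfolding N_def G_def by (auto simp del: msp.simps)
  next
    fix v assume "v \<in> msp -` (Finite ` r ` Om)"
    then obtain z where "z \<in> Om" "msp v = Finite (r z)" by auto
    then show "v \<in> N" unfolding N_def G_def by (metis imageI msp_msp)
  qed
  ultimately have oN: "open N" by simp
  \<comment> \<open>If the values \<open>G (t n)\<close> converge to a point whose image lies in
    \<open>Om\<close>, then \<open>t n\<close> converges in \<open>Om\<close>, so the limit is a
    value of \<open>G\<close> too.\<close>
  have clN: "v \<in> N" if v: "v \<in> closure N" "F v \<notin> ?Y'" for v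
  proof -
    obtain y where y: "F v = Finite y" "y \<in> Om" using v(2) Y'_iff Y'_inf by (cases "F v") auto
    obtain u where u: "\<And>n. u n \<in> N" "u \<longlonglongrightarrow> v" using v(1) unfolding closure_sequential by blast
    have "\<exists>t. t \<in> Om \<and> u n = G t" for n using u(1)[of n] by (auto simp: N_def)
    then obtain t where t: "\<And>n. t n \<in> Om" "\<And>n. u n = G (t n)" by metis
    have "(\<lambda>n. F (u n)) \<longlonglongrightarrow> Finite y" using isCont_tendsto_compose[OF isCont_F u(2)] y(1) by simp
    then have "(\<lambda>n. toC (F (u n))) \<longlonglongrightarrow> toC (Finite y)" by (rule isCont_tendsto_compose[OF isCont_toC])
    then have "t \<longlonglongrightarrow> y" using t FG by simp
    moreover have "isCont G y" using contG Om(1) y(2) continuous_on_eq_continuous_at by blast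
    ultimately have "(\<lambda>n. G (t n)) \<longlonglongrightarrow> G y" using isCont_tendsto_compose by blast
    moreover have "u = (\<lambda>n. G (t n))" by (rule ext) (rule t(2))
    ultimately have "u \<longlonglongrightarrow> G y" by simp
    then have "v = G y" using u(2) LIMSEQ_unique by blast
    then show ?thesis using y(2) by (simp add: N_def)
  qed
  have frN: "F v \<in> ?Y'" if "v \<in> frontier N" for v
    using clN[of v] that oN by (auto simp: frontier_def interior_open)
  have Ninf: "Infinity \<in> N" using G1 Om(3) unfolding N_def by (metis imageI)
  \<comment> \<open>Total ramification over \<infinity> makes the full preimage of the side
    connected. It contains 1 and misses \<open>cc x\<close>, so it cannot meet the side of
    \<infinity> of \<open>cc x\<close>; therefore the latter stays in \<open>N\<close>.\<close>
  have coPY: "connected (F -` ?Y')"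
    by (rule connected_preimage_critical[OF closed_outer_sphere[OF open_cc oK(2)] connected_outer_sphere[OF oK(2)] Y'_inf])
      (use F_eq_Infinity_iff in blast)
  have Fo: "F v \<in> Finite ` ?o" if v: "v \<in> Finite ` cc x" for v
  proof -
    obtain z where z: "z \<in> cc x" "v = Finite z" using v by blast
    then have "z \<noteq> 1" using oK(1) K_props(1) by blast
    then show ?thesis using z f_cc[OF x] by auto
  qed
  have "F -` ?Y' \<inter> Finite ` cc x = {}" using Fo outer_sphere_disjoint[OF oK(2)] by blast
  moreover have "Finite 1 \<in> F -` ?Y'" using Y'_inf by simp
  ultimately have PYY: "F -` ?Y' \<inter> ?Y = {}" by (intro outer_sphere_avoids[OF oK(1) \<beta>] coPY)
  have YN: "?Y \<subseteq> N"
  proof (rule connected_subset_if_frontier_disjoint[OF connected_outer_sphere[OF oK(1)]])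
    show "?Y \<inter> frontier N = {}" using frN PYY by blast
    show "?Y \<inter> N \<noteq> {}" using Ninf outer_sphere_iff(2)[OF oK(1)] by blast
  qed
  have oOm: "?o \<subseteq> Om" using outer_far(3)[OF oK(2)] by (auto simp: Om_def)
  \<comment> \<open>A frontier point of the side of \<infinity> of \<open>cc x\<close> lies in the
    open set \<open>N\<close> and in the closure of \<open>cc x\<close>, so \<open>N\<close> meets
    \<open>cc x\<close>. Being connected and inside the interior of \<open>K\<close>, the branch
    image of \<open>cc (f x)\<close> then lies in \<open>cc x\<close>.\<close>
  have Gcc: "G y \<in> Finite ` cc x" if y: "y \<in> ?o" for y
  proof -
    have "outer (cc x) \<noteq> {}" "outer (cc x) \<noteq> UNIV"
      using outer_far(2)[OF oK(1)] one_notin_outer[OF oK(1) \<beta>] by blast+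
    then obtain q where q: "q \<in> frontier (outer (cc x))" using frontier_eq_empty by blast
    have "q \<in> outer (cc x)" using q frontier_subset_closed[OF closed_outer[OF open_cc oK(1)]] by blast
    then have "Finite q \<in> N" using YN outer_sphere_iff(1)[OF oK(1)] by blast
    moreover have "q \<in> frontier (cc x)"
      using q frontier_of_components_subset[OF outer_component[OF oK(1)]] by (auto simp: frontier_complement)
    then have "q \<in> closure (cc x)" by (simp add: frontier_def)
    moreover have "open {z. Finite z \<in> N}" by (rule open_Finite_vimage[OF oN])
    ultimately have "{z. Finite z \<in> N} \<inter> cc x \<noteq> {}" using open_Int_closure_eq_empty by blast
    then obtain p where p: "Finite p \<in> N" "p \<in> cc x" by blast
    let ?P = "{z. Finite z \<in> G ` ?o}"
    have "connected (G ` ?o)" by (intro connected_continuous_image continuous_on_subset[OF contG oOm]) simp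
    moreover have ninf: "Infinity \<notin> G ` ?o"
    proof
      assume "Infinity \<in> G ` ?o"
      then obtain t where "t \<in> ?o" "Infinity = G t" by blast
      then have "t = 1" using FG[of t] oOm by auto
      then show False using \<open>t \<in> ?o\<close> oK(2) K_props(1) by blast
    qed
    ultimately have coP: "connected ?P" by (rule connected_Finite_vimage)
    have PI: "?P \<subseteq> interior K"
    proof
      fix z assume "z \<in> ?P"
      then obtain t where "t \<in> ?o" "Finite z = G t" by auto
      then have "F (Finite z) = Finite t" using FG oOm by auto
      then show "z \<in> interior K" using preimage_interior_K \<open>t \<in> ?o\<close> cc_subset(1) by blast
    qed
    have "p \<in> ?P"
    proof -
      obtain t where t: "t \<in> Om" "Finite p = G t" using p(1) by (auto simp: N_def)
      have "F (Finite p) = Finite t" using FG[OF t(1)] t(2) by simp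
      moreover have "F (Finite p) \<in> Finite ` ?o" using p(2) by (intro Fo imageI)
      ultimately have "t \<in> ?o" by (simp add: Finite_in_Finite_image)
      then have "G t \<in> G ` ?o" by (rule imageI)
      then show ?thesis unfolding t(2)[symmetric] by (rule CollectI)
    qed
    then have "?P \<subseteq> cc p" using coP PI by (intro connected_component_maximal) auto
    then have "?P \<subseteq> cc x" using cc_eq[OF p(2)] by simp
    moreover have "G y \<in> G ` ?o" using y by blast
    ultimately show ?thesis using ninf by (cases "G y") auto
  qed
  show ?a
  proof (rule ccontr)
    assume "\<not> ?a"
    then obtain v y where v: "v \<in> ?Y" "F v = Finite y" "y \<in> ?o" by blast
    obtain t where t: "t \<in> Om" "v = G t" using v(1) YN by (auto simp: N_def)
    then have "v = G y" using FG[OF t(1)] v(2) by simp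
    then have "v \<in> Finite ` cc x" using Gcc[OF v(3)] by simp
    then show False using v(1) outer_sphere_disjoint[OF oK(1)] by blast
  qed
  show "PROP ?b"
  proof (rule ccontr)
    assume C: "connected C" "Infinity \<in> C" "F ` C \<inter> ?Y' = {}"
      and Z: "connected Z" "Finite 1 \<in> Z" "Z \<inter> Finite ` cc x = {}" and ne: "C \<inter> Z \<noteq> {}"
    have "C \<inter> frontier N = {}" using C(3) frN by blast
    moreover have "C \<inter> N \<noteq> {}" using C(2) Ninf by blast
    ultimately have CN: "C \<subseteq> N" by (rule connected_subset_if_frontier_disjoint[OF C(1)])
    obtain v where v: "v \<in> C" "v \<in> Z" using ne by blast
    obtain y where y: "y \<in> Om" "v = G y" using CN v(1) by (auto simp: N_def)
    have yo: "y \<notin> ?o" using Gcc[of y] v(2) y(2) Z(3) by blast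
    let ?X = "- (Finite ` ?o)"
    have clX: "closed ?X" using open_cc by (intro closed_Compl open_Finite_image)
    have nC: "Finite t \<notin> C'" if "t \<in> Om" "connected C'" "C' \<subseteq> ?X" "Infinity \<in> C'" for C' t
    proof -
      have "C' \<subseteq> ?Y'" using that by (intro outer_sphere_maximal oK) auto
      then show ?thesis using Y'_iff that(1) by blast
    qed
    have "1 \<notin> ?o" using oK(2) K_props(1) by blast
    then have X: "Infinity \<in> ?X" "Finite y \<in> ?X" "Finite 1 \<in> ?X" using yo by auto
    obtain S where S: "open S" "Infinity \<in> S" "Finite y \<notin> S" "Finite 1 \<notin> S" "frontier S \<inter> ?X = {}"
      by (rule clopen_separation[OF closed_imp_compact_sphere[OF clX] X(1,2) nC[OF y(1)] X(3) nC[OF Om(3)]])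
    have frS: "frontier S \<subseteq> Finite ` ?o" using S(5) by blast
    have "?Y' \<inter> frontier S = {}" using outer_sphere_disjoint[OF oK(2)] frS by blast
    moreover have "?Y' \<inter> S \<noteq> {}" using Y'_inf S(2) by blast
    ultimately have Y'S: "?Y' \<subseteq> S"
      by (rule connected_subset_if_frontier_disjoint[OF connected_outer_sphere[OF oK(2)]])
    define S' where "S' = - closure S"
    have oS': "open S'" unfolding S'_def by (intro open_Compl closed_closure)
    have clS': "closure S' \<subseteq> - S" unfolding S'_def
      by (rule closure_minimal) (use closure_subset S(1) in \<open>auto simp: closed_Compl\<close>)
    have S'in: "Finite y \<in> S'" "Finite 1 \<in> S'"
      using S(3,4) frS yo \<open>1 \<notin> ?o\<close> unfolding S'_def closure_Un_frontier by auto
    \<comment> \<open>\<open>S'\<close> contains \<open>y\<close> and 1 but not \<infinity>, and its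
      frontier lies in \<open>cc (f x)\<close>. A frontier point of \<open>?N'\<close> on
      \<open>Z\<close> would be a value of \<open>G\<close> on \<open>cc (f x)\<close>, hence in
      \<open>cc x\<close>, which \<open>Z\<close> avoids. So \<open>Z\<close> stays in
      \<open>?N'\<close>, yet \<open>F\<close> sends its point 1 to \<infinity>.\<close>
    let ?N' = "N \<inter> F -` S'"
    have "open (F -` S')" using isCont_F by (intro continuous_open_vimage oS') auto
    then have oN': "open ?N'" using oN by auto
    have "Z \<inter> frontier ?N' = {}"
    proof (rule ccontr)
      assume "Z \<inter> frontier ?N' \<noteq> {}"
      moreover have "frontier ?N' = closure ?N' - ?N'" unfolding frontier_def interior_open[OF oN'] ..
      ultimately obtain w where w: "w \<in> Z" "w \<in> closure ?N'" "w \<notin> ?N'" by blast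
      have "closed (F -` closure S')" using isCont_F by (intro continuous_closed_vimage) auto
      then have "closure ?N' \<subseteq> F -` closure S'" by (intro closure_minimal) (use closure_subset in blast)+
      then have Fw: "F w \<in> closure S'" using w(2) by blast
      then have "F w \<notin> ?Y'" using clS' Y'S by blast
      moreover have "w \<in> closure N" using w(2) closure_mono[of ?N' N] by blast
      ultimately have wN: "w \<in> N" by (intro clN)
      then have "F w \<notin> S'" using w(3) by blast
      then have "F w \<in> frontier S'" using Fw oS' by (simp add: frontier_def interior_open)
      then have "F w \<in> Finite ` ?o" using frontier_Compl_closure_subset[of S] frS unfolding S'_def by blast
      then obtain t where t: "t \<in> ?o" "F w = Finite t" by blast
      obtain t' where t': "t' \<in> Om" "w = G t'" using wN by (auto simp: N_def)
      then have "w = G t" using FG[OF t'(1)] t(2) by simp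
      then show False using Gcc[OF t(1)] w(1) Z(3) by blast
    qed
    moreover have "v \<in> ?N'" using y FG[OF y(1)] S'in(1) by (simp add: N_def)
    then have "Z \<inter> ?N' \<noteq> {}" using v(2) by blast
    ultimately have "Z \<subseteq> ?N'" by (rule connected_subset_if_frontier_disjoint[OF Z(1)])
    then have "Infinity \<in> S'" using Z(2) by auto
    then show False using S(2) closure_subset unfolding S'_def by blast
  qed
qed

section \<open>Connectedness of the frontier\<close>

lemma connected_frontier_K: "connected (frontier K)"
proof (rule ccontr)
  assume "\<not> ?thesis"
  then obtain x0 \<beta>0 where "x0 \<in> interior K" "compact \<beta>0" "\<beta>0 \<subseteq> cc x0" "sep \<beta>0"
    using disconnected_frontier_sep by metis
  then obtain x1 p \<beta>1 where x1: "x1 \<in> interior K" and p: "p > 0" "(f ^^ p) x1 \<in> cc x1"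
    and \<beta>1: "compact \<beta>1" "\<beta>1 \<subseteq> cc x1" "sep \<beta>1"
    using periodic_component by metis
  define x where "x n = (f ^^ n) x1" for n
  define \<beta> where "\<beta> n = (f ^^ n) ` \<beta>1" for n
  define Y where "Y n = outer_sphere (cc (x n))" for n
  have xI: "x n \<in> interior K" for n unfolding x_def by (rule funpow_f_interior[OF x1])
  have fx: "f (x n) = x (Suc n)" for n by (simp add: x_def)
  have \<beta>1I: "\<beta>1 \<subseteq> interior K" "\<beta>1 \<subseteq> K" using \<beta>1(2) cc_subset by blast+
  have \<beta>: "compact (\<beta> n)" "\<beta> n \<subseteq> cc (x n)" "sep (\<beta> n)" for n
  proof -
    show "compact (\<beta> n)" unfolding \<beta>_def
      by (intro compact_continuous_image continuous_on_subset[OF continuous_f_iterates \<beta>1I(1)] \<beta>1(1))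
    show "\<beta> n \<subseteq> cc (x n)" unfolding \<beta>_def x_def using \<beta>1(2) f_iterate_cc[OF x1, of n] by blast
    show "sep (\<beta> n)" unfolding \<beta>_def by (rule sep_iterate[OF \<beta>1(3) \<beta>1I(2)])
  qed
  have per1: "x (n + p) \<in> cc (x n)" for n
  proof -
    have "x (n + p) = (f ^^ n) ((f ^^ p) x1)" unfolding x_def by (simp only: funpow_add comp_apply)
    then show ?thesis using f_iterate_cc[OF x1, of n] p(2) unfolding x_def by auto
  qed
  then have per: "cc (x (n + k * p)) = cc (x n)" for n k
  proof (induction k)
    case (Suc k)
    have "x (n + Suc k * p) \<in> cc (x (n + k * p))" using per1[of "n + k * p"] by (simp add: add_ac)
    then show ?case using Suc cc_eq by metis
  qed simp
  have inj: "inj_on f (cc (x n))" for n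
  proof (rule injective_on_periodic_component[OF xI p(1) _ \<beta>])
    have "(f ^^ p) (x n) = x (p + n)" unfolding x_def by (simp only: funpow_add comp_apply)
    also have "\<dots> = x (n + p)" by (simp only: add.commute)
    finally have "(f ^^ p) (x n) = x (n + p)" .
    then show "(f ^^ p) (x n) \<in> cc (x n)" using per1 by simp
  qed
  have zero: "0 \<in> outer (cc (f (x n)))" for n by (rule zero_in_outer[OF xI inj])
  note branch = outer_branch[OF xI \<beta>(3,2) zero]
  have "range Y \<subseteq> Y ` {..<p}"
  proof
    fix M assume "M \<in> range Y"
    then obtain n where "M = Y n" by blast
    moreover have "cc (x n) = cc (x (n mod p))" using per[of "n mod p" "n div p"] by simp
    ultimately show "M \<in> Y ` {..<p}" using p(1) by (auto simp: Y_def)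
  qed
  then have fin: "finite (range Y)" by (rule finite_subset) simp
  \<comment> \<open>The sides of \<infinity> are nested, so a minimal one is the least; it belongs
    to the outermost component of the cycle.\<close>
  obtain M where M: "M \<in> range Y" "\<And>M'. M' \<in> range Y \<Longrightarrow> M' \<subseteq> M \<Longrightarrow> M = M'"
    using finite_has_minimal[OF fin] by auto
  obtain i where i: "M = Y i" using M(1) by blast
  have minY: "Y i \<subseteq> Y n" for n
    using outer_nested[OF \<beta>(3,2) \<beta>(3,2), of i n] M(2)[of "Y n"] i unfolding Y_def by blast
  \<comment> \<open>Two steps before a return to the component of index \<open>i\<close>; the
    multiple \<open>2 * p\<close> keeps the subtraction from being truncated also when
    \<open>p = 1\<close>.\<close>
  define n where "n = i + 2 * p - 2"
  have n: "Suc (Suc n) = i + 2 * p" using p(1) by (simp add: n_def)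
  have Yn2: "Y (Suc (Suc n)) = Y i" unfolding n Y_def per ..
  let ?Y = "Y (Suc (Suc n))" and ?Z = "F ` Y n"
  have minY': "?Y \<subseteq> Y k" for k using minY Yn2 by simp
  have K: "cc (x k) \<subseteq> K" for k by (rule cc_subset(2))
  have Yinf: "Infinity \<in> Y k" for k unfolding Y_def by (rule outer_sphere_iff(2)[OF K])
  have coY: "connected (Y k)" for k unfolding Y_def by (rule connected_outer_sphere[OF K])
  have Z: "connected ?Z" "Finite 1 \<in> ?Z" "?Z \<inter> Finite ` cc (x (Suc n)) = {}"
  proof -
    show "connected ?Z" by (intro connected_continuous_image continuous_F coY)
    show "Finite 1 \<in> ?Z" using Yinf[of n] F_Infinity by (metis imageI)
    show "?Z \<inter> Finite ` cc (x (Suc n)) = {}" using branch(1)[of n] unfolding fx Y_def .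
  qed
  have FYZ: "F ` ?Y \<subseteq> ?Z" using minY'[of n] by blast
  show False
  proof (rule no_swapped_continuum[of ?Y])
    show "closed ?Y" unfolding Y_def by (rule closed_outer_sphere[OF open_cc K])
    show "connected ?Y" by (rule coY)
    show "Doo \<subseteq> ?Y" by (simp add: Y_def outer_sphere_def)
    show "Finite 0 \<in> ?Y" using zero[of "Suc n"] unfolding fx Y_def by (simp add: outer_sphere_iff(1)[OF K])
    \<comment> \<open>Minimality turns statements about three consecutive components into statements
      about \<open>?Y\<close> alone: its image lies in \<open>?Z\<close>, and it lies itself in
      \<open>Y (Suc n)\<close>.\<close>
    have "?Z \<inter> Y (Suc n) = {}" unfolding Y_def[of "Suc n"]
      by (rule outer_sphere_avoids[OF K \<beta>(3,2) Z])
    then show "F ` ?Y \<inter> ?Y = {}" using FYZ minY'[of "Suc n"] by blast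
    show "C \<inter> F ` ?Y = {}" if "connected C" "Infinity \<in> C" "F ` C \<inter> ?Y = {}" for C
    proof -
      have "C \<inter> ?Z = {}"
        by (rule branch(2)[of C "Suc n" ?Z, OF that(1,2) _ Z]) (use that(3) in \<open>simp add: fx Y_def\<close>)
      then show ?thesis using FYZ by blast
    qed
  qed
qed

end

theorem theorem1p1:
  fixes d :: nat and lam :: complex
  assumes "d \<ge> 2" and "lam \<noteq> 0"
  shows "connected (julia_set (U_map d lam))"
proof -
  interpret diamond d lam by unfold_locales (use assms in auto)
  obtain R \<epsilon> where "1 + \<epsilon> < R" "0 < \<epsilon>"
    "\<And>z. R \<le> cmod z \<Longrightarrow> cmod (f z - 1) < \<epsilon>"
    "\<And>y. cmod (y - 1) < \<epsilon> \<Longrightarrow> y \<noteq> 1 \<Longrightarrow> R < cmod (f y)"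
    "\<And>z. R \<le> cmod z \<Longrightarrow> f z \<noteq> 1 \<Longrightarrow> 2 * cmod z \<le> cmod (f (f z))"
    using trap_exists by metis
  then interpret trapped d lam R \<epsilon> by unfold_locales
  show ?thesis unfolding julia_set_eq by (intro connected_Finite_image connected_frontier_K)
qed

end
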